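(* Let $E$ be a row-finite directed graph with no sources. Let $X$ be a set of pairs $(T,z)$ consisting of a maximal tail $T$ in $E^0$ and an element $z$ of $\{w^{\operatorname{Per}(T)}:w\in\mathbb{T}\}$. Let $(S,w)$ be another such pair. Then $\bigcap_{(T,z)\in X}I_{T,z}\subseteq I_{S,w}$ if and only if both of the following hold: (a) $S\subseteq\bigcup_{(T,z)\in X}T$; and (b) if $S$ is a cyclic tail and the cycle $\mu$ with no entrance in $S$ also has no entrance in $\bigcup_{(T,z)\in X}T$, then $w\in\overline{\{z:(S,z)\in X\}}$ (closure in $\mathbb{T}$).
   Context: A row-finite directed graph $E$ with no sources consists of countable sets $E^0$ (vertices), $E^1$ (edges) and maps $r,s:E^1\to E^0$ with $r$ surjective and finite-to-one. Write $vE^1=\{e\in E^1: r(e)=v\}$. A path of length $n>0$ is a string $\mu=e_1\cdots e_n$ of edges with $s(e_i)=r(e_{i+1})$; $r(\mu)=r(e_1)$, $s(\mu)=s(e_n)$, $|\mu|=n$; vertices are paths of length $0$. $E^*$ is the set of finite paths, $vE^*=\{\mu\in E^*:r(\mu)=v\}$. $C^*(E)$ is the universal $C^*$-algebra generated by projections $p_v$ ($v\in E^0$), mutually orthogonal, and partial isometries $s_e$ ($e\in E^1$) with $s_e^*s_e=p_{s(e)}$ and $p_v=\sum_{r(e)=v}s_es_e^*$. A maximal tail is a nonempty set $T\subseteq E^0$ such that: (T1) if $e\in E^1$ and $s(e)\in T$ then $r(e)\in T$; (T2) if $v\in T$ there is $e\in vE^1$ with $s(e)\in T$; (T3) if $v,w\in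 T$ there are $\mu\in vE^*$, $\nu\in wE^*$ with $s(\mu)=s(\nu)\in T$. A cycle is a path $\mu=\mu_1\cdots\mu_n$ ($n\ge1$) with $r(\mu_1)=s(\mu_n)$ and $s(\mu_i)\neq s(\mu_j)$ for $i\ne j$. If $A\subseteq E^0$ contains all $r(\mu_i)$, then $\mu$ is a cycle with no entrance in $A$ if $\{e\in r(\mu_i)E^1: s(e)\in A\}=\{\mu_i\}$ for each $i$. A maximal tail $T$ is cyclic if there is a cycle $\mu$ with no entrance in $T$ (such $\mu$ is unique up to cyclic permutation of its edges), and then $\operatorname{Per}(T):=|\mu|$; otherwise $T$ is aperiodic and $\operatorname{Per}(T):=0$. An infinite path is a string $x=x_1x_2\cdots$ of edges with $s(x_i)=r(x_{i+1})$ for all $i$, with $r(x)=r(x_1)$; $E^\infty$ is the set of infinite paths. Infinite paths $x,y$ are shift-tail equivalent if there are $m,n\in\mathbb{N}$ with $x_{i+m}=y_{i+n}$ for all $i\in\mathbb{N}$; $[x]$ is the class of $x$, and $[x]^0:=\{r(y):y\in[x]\}$. Every maximal tail equals $[x]^0$ for some $x\in E^\infty$, and every $[x]^0$ is a maximal tail. For $x\in E^\infty$, $u\in\mathbb{T}$ (the unit circle in $\mathbb{C}$), $\pi_{x,u}:C^*(E)\to\mathcal{B}(\ell^2([x]))$ is the irreducible representation with $\pi_{x,u}(p_v)\delta_y=\delta_y$ if $r(y)=v$ and $0$ otherwise, and $\pi_{x,u}(s_e)\delta_y=u\,\delta_{ey}$ if $r(y)=s(e)$ and $0$ otherwise. For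 a maximal tail $T$ and $z\in\{u^{\operatorname{Per}(T)}:u\in\mathbb{T}\}$, $I_{T,z}:=\ker\pi_{x,u}$ for any $(x,u)\in E^\infty\times\mathbb{T}$ with $[x]^0=T$ and $u^{\operatorname{Per}(T)}=z$ (this is independent of the choice). An intersection over an empty index set of ideals is $C^*(E)$. *)

theory Defs
  imports "HOL-Analysis.Analysis" "Graph_Theory.Digraph"
begin

section \<open>Row-finite directed graphs\<close>

text \<open>
  A directed graph $E = (E^0, E^1, r, s)$ is a \<^type>\<open>pre_digraph\<close> with $E^0$ = \<^const>\<open>verts\<close>,
  $E^1$ = \<^const>\<open>arcs\<close>, range map $r$ = \<^const>\<open>head\<close> and source map $s$ = \<^const>\<open>tail\<close>.
  Paths are traversed from range to source: in $e_1 e_2 \cdots$ one has $s(e_i) = r(e_{i+1})$,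
  i.e. they run against the direction used for walks in \<^theory>\<open>Graph_Theory.Digraph\<close> and
  the theories built on it.
\<close>

definition row_finite_no_sources :: "('v, 'e) pre_digraph \<Rightarrow> bool" where
  "row_finite_no_sources E \<longleftrightarrow>
     wf_digraph E \<and> countable (verts E) \<and> countable (arcs E) \<and>
     (\<forall>v\<in>verts E. finite {e\<in>arcs E. head E e = v} \<and> {e\<in>arcs E. head E e = v} \<noteq> {})"

text \<open>\<open>graph_path E v \<mu> w\<close>: \<open>\<mu>\<close> is a finite path with $r(\mu) = v$ and $s(\mu) = w$; the empty
  list is the path of length 0 at a vertex.\<close>

fun graph_path :: "('v, 'e) pre_digraph \<Rightarrow> 'v \<Rightarrow> 'e list \<Rightarrow> 'v \<Rightarrow> bool" where
  "graph_path E v [] w \<longleftrightarrow> v \<in> verts E \<and> v = w"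
| "graph_path E v (e # \<mu>) w \<longleftrightarrow> e \<in> arcs E \<and> head E e = v \<and> graph_path E (tail E e) \<mu> w"

definition maximal_tail :: "('v, 'e) pre_digraph \<Rightarrow> 'v set \<Rightarrow> bool" where
  "maximal_tail E T \<longleftrightarrow>
     T \<subseteq> verts E \<and> T \<noteq> {} \<and>
     (\<forall>e\<in>arcs E. tail E e \<in> T \<longrightarrow> head E e \<in> T) \<and>
     (\<forall>v\<in>T. \<exists>e\<in>arcs E. head E e = v \<and> tail E e \<in> T) \<and>
     (\<forall>v\<in>T. \<forall>w\<in>T. \<exists>\<mu> \<nu> t. graph_path E v \<mu> t \<and> graph_path E w \<nu> t \<and> t \<in> T)"

definition graph_cycle :: "('v, 'e) pre_digraph \<Rightarrow> 'e list \<Rightarrow> bool" where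
  "graph_cycle E \<mu> \<longleftrightarrow> \<mu> \<noteq> [] \<and> (\<exists>v. graph_path E v \<mu> v) \<and> distinct (map (tail E) \<mu>)"

definition cycle_no_entrance :: "('v, 'e) pre_digraph \<Rightarrow> 'v set \<Rightarrow> 'e list \<Rightarrow> bool" where
  "cycle_no_entrance E A \<mu> \<longleftrightarrow>
     graph_cycle E \<mu> \<and> head E ` set \<mu> \<subseteq> A \<and>
     (\<forall>e\<in>set \<mu>. {f\<in>arcs E. head E f = head E e \<and> tail E f \<in> A} = {e})"

definition cyclic_tail :: "('v, 'e) pre_digraph \<Rightarrow> 'v set \<Rightarrow> bool" where
  "cyclic_tail E T \<longleftrightarrow> maximal_tail E T \<and> (\<exists>\<mu>. cycle_no_entrance E T \<mu>)"

definition Per :: "('v, 'e) pre_digraph \<Rightarrow> 'v set \<Rightarrow> nat" where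
  "Per E T = (if cyclic_tail E T then THE n. \<exists>\<mu>. cycle_no_entrance E T \<mu> \<and> n = length \<mu> else 0)"

text \<open>The pairs $(T, z)$ with $T$ a maximal tail and $z \in \{w^{\mathrm{Per}(T)} : w \in \mathbb{T}\}$.\<close>

definition tail_pairs :: "('v, 'e) pre_digraph \<Rightarrow> ('v set \<times> complex) set" where
  "tail_pairs E = {(T, z). maximal_tail E T \<and> z \<in> (\<lambda>w. w ^ Per E T) ` sphere 0 1}"

definition infinite_paths :: "('v, 'e) pre_digraph \<Rightarrow> (nat \<Rightarrow> 'e) set" where
  "infinite_paths E = {x. \<forall>i. x i \<in> arcs E \<and> tail E (x i) = head E (x (Suc i))}"

definition path_range :: "('v, 'e) pre_digraph \<Rightarrow> (nat \<Rightarrow> 'e) \<Rightarrow> 'v" where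
  "path_range E x = head E (x 0)"

definition path_cons :: "'e \<Rightarrow> (nat \<Rightarrow> 'e) \<Rightarrow> nat \<Rightarrow> 'e" where
  "path_cons e x = case_nat e x"

definition shift_tail_class :: "('v, 'e) pre_digraph \<Rightarrow> (nat \<Rightarrow> 'e) \<Rightarrow> (nat \<Rightarrow> 'e) set" where
  "shift_tail_class E x = {y \<in> infinite_paths E. \<exists>m n. \<forall>i. x (i + m) = y (i + n)}"

definition class_vertices :: "('v, 'e) pre_digraph \<Rightarrow> (nat \<Rightarrow> 'e) \<Rightarrow> 'v set" where
  "class_vertices E x = path_range E ` shift_tail_class E x"


section \<open>Star-algebras, C*-seminorms and completions\<close>

text \<open>Complex star-algebras, not necessarily unital, with an explicit carrier set.\<close>

record 'a star_algebra =
  sa_carrier :: "'a set"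
  sa_add :: "'a \<Rightarrow> 'a \<Rightarrow> 'a"
  sa_scale :: "complex \<Rightarrow> 'a \<Rightarrow> 'a"
  sa_mult :: "'a \<Rightarrow> 'a \<Rightarrow> 'a"
  sa_star :: "'a \<Rightarrow> 'a"

record 'a normed_star_algebra = "'a star_algebra" +
  sa_norm :: "'a \<Rightarrow> real"

definition sa_diff :: "('a, 'b) star_algebra_scheme \<Rightarrow> 'a \<Rightarrow> 'a \<Rightarrow> 'a" where
  "sa_diff A a b = sa_add A a (sa_scale A (-1) b)"

definition cstar_seminorm :: "('a, 'b) star_algebra_scheme \<Rightarrow> ('a \<Rightarrow> real) \<Rightarrow> bool" where
  "cstar_seminorm A \<rho> \<longleftrightarrow>
     (\<forall>a\<in>sa_carrier A. 0 \<le> \<rho> a) \<and>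
     (\<forall>a\<in>sa_carrier A. \<forall>b\<in>sa_carrier A. \<rho> (sa_add A a b) \<le> \<rho> a + \<rho> b) \<and>
     (\<forall>c. \<forall>a\<in>sa_carrier A. \<rho> (sa_scale A c a) = cmod c * \<rho> a) \<and>
     (\<forall>a\<in>sa_carrier A. \<forall>b\<in>sa_carrier A. \<rho> (sa_mult A a b) \<le> \<rho> a * \<rho> b) \<and>
     (\<forall>a\<in>sa_carrier A. \<rho> (sa_mult A (sa_star A a) a) = (\<rho> a)\<^sup>2)"

text \<open>
  The Hausdorff completion of a star-algebra in a seminorm \<open>\<rho>\<close>: Cauchy sequences modulo null
  sequences, with the operations acting on representatives. Elements of the seminorm kernel
  become 0.
\<close>

definition cauchy_seqs :: "('a, 'b) star_algebra_scheme \<Rightarrow> ('a \<Rightarrow> real) \<Rightarrow> (nat \<Rightarrow> 'a) set" where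
  "cauchy_seqs A \<rho> =
     {X. (\<forall>k. X k \<in> sa_carrier A) \<and>
         (\<forall>\<epsilon>>0. \<exists>N. \<forall>j\<ge>N. \<forall>k\<ge>N. \<rho> (sa_diff A (X j) (X k)) < \<epsilon>)}"

definition null_rel ::
    "('a, 'b) star_algebra_scheme \<Rightarrow> ('a \<Rightarrow> real) \<Rightarrow> ((nat \<Rightarrow> 'a) \<times> (nat \<Rightarrow> 'a)) set" where
  "null_rel A \<rho> =
     {(X, Y). X \<in> cauchy_seqs A \<rho> \<and> Y \<in> cauchy_seqs A \<rho> \<and>
              (\<lambda>k. \<rho> (sa_diff A (X k) (Y k))) \<longlonglongrightarrow> 0}"

definition seq_class ::
    "('a, 'b) star_algebra_scheme \<Rightarrow> ('a \<Rightarrow> real) \<Rightarrow> (nat \<Rightarrow> 'a) \<Rightarrow> (nat \<Rightarrow> 'a) set" where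
  "seq_class A \<rho> X = null_rel A \<rho> `` {X}"

definition class_rep :: "(nat \<Rightarrow> 'a) set \<Rightarrow> nat \<Rightarrow> 'a" where
  "class_rep a = (SOME X. X \<in> a)"

definition completion ::
    "('a, 'b) star_algebra_scheme \<Rightarrow> ('a \<Rightarrow> real) \<Rightarrow> (nat \<Rightarrow> 'a) set normed_star_algebra" where
  "completion A \<rho> =
     \<lparr> sa_carrier = cauchy_seqs A \<rho> // null_rel A \<rho>,
       sa_add = (\<lambda>a b. seq_class A \<rho> (\<lambda>k. sa_add A (class_rep a k) (class_rep b k))),
       sa_scale = (\<lambda>c a. seq_class A \<rho> (\<lambda>k. sa_scale A c (class_rep a k))),
       sa_mult = (\<lambda>a b. seq_class A \<rho> (\<lambda>k. sa_mult A (class_rep a k) (class_rep b k))),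
       sa_star = (\<lambda>a. seq_class A \<rho> (\<lambda>k. sa_star A (class_rep a k))),
       sa_norm = (\<lambda>a. lim (\<lambda>k. \<rho> (class_rep a k))) \<rparr>"

definition embed :: "('a, 'b) star_algebra_scheme \<Rightarrow> ('a \<Rightarrow> real) \<Rightarrow> 'a \<Rightarrow> (nat \<Rightarrow> 'a) set" where
  "embed A \<rho> a = seq_class A \<rho> (\<lambda>_. a)"


section \<open>The graph C*-algebra\<close>

text \<open>
  $C^*(E)$ is constructed in the standard way for a universal C*-algebra given by generators and
  relations: take the free complex star-algebra on symbols $p_v$ ($v \in E^0$) and $s_e$
  ($e \in E^1$) and complete it in the largest C*-seminorm that vanishes on the defining relations.
\<close>

datatype ('v, 'e) generator = Vert 'v | Edge 'e

text \<open>A letter is a generator together with a flag that is \<^const>\<open>True\<close> for its formal adjoint.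
  Elements of the free star-algebra are finite linear combinations of nonempty words, given by
  their coefficient functions; multiplication extends concatenation of words bilinearly.\<close>

type_synonym ('v, 'e) letter = "('v, 'e) generator \<times> bool"
type_synonym ('v, 'e) free_elem = "('v, 'e) letter list \<Rightarrow> complex"

definition letters :: "('v, 'e) pre_digraph \<Rightarrow> ('v, 'e) letter set" where
  "letters E = (Vert ` verts E \<union> Edge ` arcs E) \<times> UNIV"

definition adj_word :: "('v, 'e) letter list \<Rightarrow> ('v, 'e) letter list" where
  "adj_word W = rev (map (\<lambda>(g, b). (g, \<not> b)) W)"

definition free_alg :: "('v, 'e) pre_digraph \<Rightarrow> ('v, 'e) free_elem star_algebra" where
  "free_alg E =
     \<lparr> sa_carrier = {f. finite {W. f W \<noteq> 0} \<and> {W. f W \<noteq> 0} \<subseteq> lists (letters E) - {[]}},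
       sa_add = (\<lambda>f g W. f W + g W),
       sa_scale = (\<lambda>c f W. c * f W),
       sa_mult = (\<lambda>f g W. \<Sum>k\<le>length W. f (take k W) * g (drop k W)),
       sa_star = (\<lambda>f W. cnj (f (adj_word W))) \<rparr>"

definition free_gen :: "('v, 'e) generator \<Rightarrow> ('v, 'e) free_elem" where
  "free_gen g = (\<lambda>W. if W = [(g, False)] then 1 else 0)"

text \<open>Each element of the following set is required to vanish: the $p_v$ are mutually orthogonal
  projections, the $s_e$ are partial isometries, $s_e^* s_e = p_{s(e)}$ and
  $p_v = \sum_{r(e) = v} s_e s_e^*$.\<close>

definition graph_relations :: "('v, 'e) pre_digraph \<Rightarrow> ('v, 'e) free_elem set" where
  "graph_relations E =
     (let F = free_alg E; p = (\<lambda>v. free_gen (Vert v)); s = (\<lambda>e. free_gen (Edge e)) in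
       {sa_diff F (sa_mult F (p v) (p v)) (p v) | v. v \<in> verts E} \<union>
       {sa_diff F (sa_star F (p v)) (p v) | v. v \<in> verts E} \<union>
       {sa_mult F (p v) (p w) | v w. v \<in> verts E \<and> w \<in> verts E \<and> v \<noteq> w} \<union>
       {sa_diff F (sa_mult F (sa_mult F (s e) (sa_star F (s e))) (s e)) (s e) | e. e \<in> arcs E} \<union>
       {sa_diff F (sa_mult F (sa_star F (s e)) (s e)) (p (tail E e)) | e. e \<in> arcs E} \<union>
       {sa_diff F (p v)
          (\<lambda>W. \<Sum>e | e \<in> arcs E \<and> head E e = v. sa_mult F (s e) (sa_star F (s e)) W)
          | v. v \<in> verts E})"

definition universal_seminorm :: "('v, 'e) pre_digraph \<Rightarrow> ('v, 'e) free_elem \<Rightarrow> real" where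
  "universal_seminorm E f =
     (SUP \<rho> \<in> {\<rho>. cstar_seminorm (free_alg E) \<rho> \<and> (\<forall>g\<in>graph_relations E. \<rho> g = 0)}. \<rho> f)"

definition graph_cstar ::
    "('v, 'e) pre_digraph \<Rightarrow> (nat \<Rightarrow> ('v, 'e) free_elem) set normed_star_algebra" where
  "graph_cstar E = completion (free_alg E) (universal_seminorm E)"

definition gen_p :: "('v, 'e) pre_digraph \<Rightarrow> 'v \<Rightarrow> (nat \<Rightarrow> ('v, 'e) free_elem) set" where
  "gen_p E v = embed (free_alg E) (universal_seminorm E) (free_gen (Vert v))"

definition gen_s :: "('v, 'e) pre_digraph \<Rightarrow> 'e \<Rightarrow> (nat \<Rightarrow> ('v, 'e) free_elem) set" where
  "gen_s E e = embed (free_alg E) (universal_seminorm E) (free_gen (Edge e))"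


section \<open>Representations on l2-spaces\<close>

text \<open>The Hilbert space $\ell^2(I)$, realised by functions that vanish outside \<open>I\<close>.\<close>

definition l2 :: "'i set \<Rightarrow> ('i \<Rightarrow> complex) set" where
  "l2 I = {f. (\<forall>i. i \<notin> I \<longrightarrow> f i = 0) \<and> (\<lambda>i. (cmod (f i))\<^sup>2) summable_on I}"

definition l2_inner :: "'i set \<Rightarrow> ('i \<Rightarrow> complex) \<Rightarrow> ('i \<Rightarrow> complex) \<Rightarrow> complex" where
  "l2_inner I f g = (\<Sum>\<^sub>\<infinity>i\<in>I. cnj (f i) * g i)"

definition l2_norm :: "'i set \<Rightarrow> ('i \<Rightarrow> complex) \<Rightarrow> real" where
  "l2_norm I f = sqrt (\<Sum>\<^sub>\<infinity>i\<in>I. (cmod (f i))\<^sup>2)"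

definition l2_delta :: "'i \<Rightarrow> 'i \<Rightarrow> complex" where
  "l2_delta y = (\<lambda>i. if i = y then 1 else 0)"

text \<open>$\mathcal{B}(\ell^2(I))$; operators are \<^const>\<open>extensional\<close>, so that they are determined by
  their values on $\ell^2(I)$.\<close>

definition bounded_ops :: "'i set \<Rightarrow> (('i \<Rightarrow> complex) \<Rightarrow> 'i \<Rightarrow> complex) set" where
  "bounded_ops I =
     {V \<in> l2 I \<rightarrow>\<^sub>E l2 I.
        (\<forall>f\<in>l2 I. \<forall>g\<in>l2 I. V (\<lambda>i. f i + g i) = (\<lambda>i. V f i + V g i)) \<and>
        (\<forall>c. \<forall>f\<in>l2 I. V (\<lambda>i. c * f i) = (\<lambda>i. c * V f i)) \<and>
        (\<exists>C. \<forall>f\<in>l2 I. l2_norm I (V f) \<le> C * l2_norm I f)}"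

text \<open>Star-homomorphisms from \<open>A\<close> to $\mathcal{B}(\ell^2(I))$. Contractivity is automatic when \<open>A\<close>
  is a C*-algebra; it is included because \<open>A\<close> is an arbitrary normed star-algebra here.\<close>

definition star_representation ::
    "('a, 'b) normed_star_algebra_scheme \<Rightarrow> 'i set \<Rightarrow>
      ('a \<Rightarrow> ('i \<Rightarrow> complex) \<Rightarrow> 'i \<Rightarrow> complex) \<Rightarrow> bool" where
  "star_representation A I \<pi> \<longleftrightarrow>
     \<pi> \<in> sa_carrier A \<rightarrow>\<^sub>E bounded_ops I \<and>
     (\<forall>a\<in>sa_carrier A. \<forall>b\<in>sa_carrier A. \<forall>f\<in>l2 I.
        \<pi> (sa_add A a b) f = (\<lambda>i. \<pi> a f i + \<pi> b f i) \<and>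
        \<pi> (sa_mult A a b) f = \<pi> a (\<pi> b f)) \<and>
     (\<forall>c. \<forall>a\<in>sa_carrier A. \<forall>f\<in>l2 I. \<pi> (sa_scale A c a) f = (\<lambda>i. c * \<pi> a f i)) \<and>
     (\<forall>a\<in>sa_carrier A. \<forall>f\<in>l2 I. \<forall>g\<in>l2 I.
        l2_inner I (\<pi> (sa_star A a) f) g = l2_inner I f (\<pi> a g)) \<and>
     (\<forall>a\<in>sa_carrier A. \<forall>f\<in>l2 I. l2_norm I (\<pi> a f) \<le> sa_norm A a * l2_norm I f)"

definition rep_kernel ::
    "('a, 'b) normed_star_algebra_scheme \<Rightarrow> 'i set \<Rightarrow>
      ('a \<Rightarrow> ('i \<Rightarrow> complex) \<Rightarrow> 'i \<Rightarrow> complex) \<Rightarrow> 'a set" where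
  "rep_kernel A I \<pi> = {a \<in> sa_carrier A. \<forall>f\<in>l2 I. \<pi> a f = (\<lambda>_. 0)}"

text \<open>The representation $\pi_{x,u}$ of $C^*(E)$ on $\ell^2([x])$, determined by its values on the
  generators.\<close>

definition path_rep ::
    "('v, 'e) pre_digraph \<Rightarrow> (nat \<Rightarrow> 'e) \<Rightarrow> complex \<Rightarrow> (nat \<Rightarrow> ('v, 'e) free_elem) set \<Rightarrow>
      ((nat \<Rightarrow> 'e) \<Rightarrow> complex) \<Rightarrow> (nat \<Rightarrow> 'e) \<Rightarrow> complex" where
  "path_rep E x u =
     (THE \<pi>. star_representation (graph_cstar E) (shift_tail_class E x) \<pi> \<and>
        (\<forall>v\<in>verts E. \<forall>y\<in>shift_tail_class E x.
           \<pi> (gen_p E v) (l2_delta y) = (if path_range E y = v then l2_delta y else (\<lambda>_. 0))) \<and>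
        (\<forall>e\<in>arcs E. \<forall>y\<in>shift_tail_class E x.
           \<pi> (gen_s E e) (l2_delta y) =
             (if path_range E y = tail E e then (\<lambda>i. u * l2_delta (path_cons e y) i)
              else (\<lambda>_. 0))))"

text \<open>$I_{T,z} = \ker \pi_{x,u}$ for any $x \in E^\infty$ and $u \in \mathbb{T}$ with $[x]^0 = T$ and
  $u^{\mathrm{Per}(T)} = z$. The kernel does not depend on the choice of such a pair.\<close>

definition tail_ideal ::
    "('v, 'e) pre_digraph \<Rightarrow> 'v set \<Rightarrow> complex \<Rightarrow> (nat \<Rightarrow> ('v, 'e) free_elem) set set" where
  "tail_ideal E T z =
     (let (x, u) = (SOME (x, u). x \<in> infinite_paths E \<and> u \<in> sphere 0 1 \<and>
                       class_vertices E x = T \<and> u ^ Per E T = z)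
      in rep_kernel (graph_cstar E) (shift_tail_class E x) (path_rep E x u))"

end

theory Submission
  imports Defs
begin

text \<open>Every element of the graph algebra is the class of a Cauchy sequence in the free star-algebra, and
  on \<open>\<ell>\<^sup>2([x])\<close> a word acts as a power of \<open>u\<close> times a partial permutation of the basis
  that changes only finitely many initial edges of a path. Membership of a class in \<open>ker \<pi>\<^bsub>x,u\<^esub>\<close>
  means that the matrix coefficients of the sequence tend to 0 (\<open>kernel_iff\<close>), so both directions
  are about finite sums of words. To get there one has to know that the universal seminorm dominates
  the operator norms of all these representations (\<open>rep_contractive\<close>) and that the prescribed values
  on the generators determine a unique representation of the completion (\<open>path_rep_eq\<close>).

  Sufficiency of (a) and (b). Let \<open>a\<close> lie in all \<open>I\<^bsub>T,z\<^esub>\<close>, approximate it by a combination \<open>f\<close> of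
  words of length at most \<open>n\<close>, and consider the coefficient of \<open>f\<close> at paths \<open>g\<^sub>1 \<tau>\<close> and \<open>g\<^sub>2 \<tau>\<close> of the
  class of \<open>S\<close>, where \<open>g\<^sub>1\<close> has length at least \<open>n\<close>. Words do not see beyond \<open>g\<^sub>1\<close>, so \<open>\<tau>\<close> may be
  replaced by a path \<open>t\<close> belonging to some \<open>T\<close> with \<open>(T, z) \<in> X\<close>, which exists by (a). If \<open>t\<close> has no
  short period, the coefficient for \<open>S\<close> is recovered from coefficients for \<open>T\<close>, even with the phases of
  a different \<open>u\<close> (\<open>matrix_coeff_transfer\<close>). If all candidates \<open>t\<close> have short periods, then \<open>\<tau>\<close> runs
  around a cycle without entrance in \<open>S\<close> and in the union of the tails (\<open>bounded_periods_imp_cycle\<close>,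
  \<open>no_entrance_Union\<close>); the coefficients are then Laurent polynomials in \<open>z\<close>, up to a phase, and (b) and
  continuity in \<open>z\<close> finish the argument (\<open>matrix_coeff_closure\<close>).

  Necessity. If \<open>v \<in> S\<close> lies in no \<open>T\<close>, then \<open>p\<^sub>v\<close> separates the ideals. If (b) fails for a cycle
  \<open>\<mu>\<close> at \<open>v\<close>, then compression by \<open>p\<^sub>v\<close> annihilates all representations with \<open>v \<notin> T\<close>, and those with
  \<open>v \<in> T\<close> have \<open>T = S\<close> and become one-dimensional, \<open>\<mu>\<close> acting as the scalar \<open>z\<close>. It remains to find a
  function of \<open>\<mu>\<close> that vanishes off a small arc around \<open>w\<close> but not at \<open>w\<close>. Such a function is
  a product of two functions of the form \<open>\<bar>h\<bar> + h\<close> with \<open>h = Re (d z)\<close>; the modulus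
  \<open>\<bar>h\<bar> = sqrt (1 - (1 - h\<^sup>2))\<close> is available because the iteration for \<open>1 - sqrt (1 - b)\<close> converges
  whenever \<open>b\<close> has norm at most 1 (\<open>sqrt_iter_cauchy\<close>).\<close>

section \<open>Sequence spaces\<close>

text \<open>Testing on finite subsets reduces norm estimates to the finite-dimensional Minkowski and
  Cauchy-Schwarz inequalities.\<close>

lemma l2_bounded:
  assumes "\<And>i. i \<notin> I \<Longrightarrow> \<xi> i = 0" "0 \<le> C"
    and "\<And>F. finite F \<Longrightarrow> F \<subseteq> I \<Longrightarrow> L2_set (\<lambda>i. cmod (\<xi> i)) F \<le> C"
  shows "\<xi> \<in> l2 I" "l2_norm I \<xi> \<le> C"
proof -
  have *: "(\<Sum>i\<in>F. (cmod (\<xi> i))\<^sup>2) \<le> C\<^sup>2" if "finite F" "F \<subseteq> I" for F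
    using assms(3)[OF that] \<open>0 \<le> C\<close> by (simp add: L2_set_def sqrt_le_D)
  have s: "(\<lambda>i. (cmod (\<xi> i))\<^sup>2) summable_on I"
    by (rule nonneg_bdd_above_summable_on) (auto intro!: bdd_aboveI2[where M="C\<^sup>2"] *)
  then show "\<xi> \<in> l2 I" using assms(1) by (simp add: l2_def)
  have "(\<Sum>\<^sub>\<infinity>i\<in>I. (cmod (\<xi> i))\<^sup>2) \<le> C\<^sup>2"
    by (rule infsum_le_finite_sums[OF s]) (use * in auto)
  then show "l2_norm I \<xi> \<le> C" unfolding l2_norm_def
    using \<open>0 \<le> C\<close> real_le_lsqrt by (simp add: real_le_lsqrt infsum_nonneg)
qed

lemma l2_support: "\<xi> \<in> l2 I \<Longrightarrow> i \<notin> I \<Longrightarrow> \<xi> i = 0"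
  by (simp add: l2_def)

lemma l2_norm_nonneg [simp]: "0 \<le> l2_norm I \<xi>"
  by (simp add: l2_norm_def infsum_nonneg)

lemma L2_set_le_l2_norm:
  assumes "\<xi> \<in> l2 I" "finite F" "F \<subseteq> I"
  shows "L2_set (\<lambda>i. cmod (\<xi> i)) F \<le> l2_norm I \<xi>"
  unfolding L2_set_def l2_norm_def
  using assms by (intro real_sqrt_le_mono finite_sum_le_infsum) (auto simp: l2_def)

lemma cmod_le_l2_norm:
  assumes "\<xi> \<in> l2 I"
  shows "cmod (\<xi> i) \<le> l2_norm I \<xi>"
proof (cases "i \<in> I")
  case True
  then show ?thesis using L2_set_le_l2_norm[OF assms, of "{i}"] by simp
qed (use assms in \<open>simp add: l2_support\<close>)

lemma l2_0: "(\<lambda>i. 0) \<in> l2 I" and l2_norm_0: "l2_norm I (\<lambda>i. 0) = 0"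
  using l2_bounded[of I "\<lambda>i. 0" 0] by (auto simp: L2_set_0' l2_norm_def)

lemma l2_add:
  assumes "\<xi> \<in> l2 I" "\<eta> \<in> l2 I"
  shows "(\<lambda>i. \<xi> i + \<eta> i) \<in> l2 I" "l2_norm I (\<lambda>i. \<xi> i + \<eta> i) \<le> l2_norm I \<xi> + l2_norm I \<eta>"
proof -
  have "L2_set (\<lambda>i. cmod (\<xi> i + \<eta> i)) F \<le> l2_norm I \<xi> + l2_norm I \<eta>" if F: "finite F" "F \<subseteq> I" for F
  proof -
    have "L2_set (\<lambda>i. cmod (\<xi> i + \<eta> i)) F \<le> L2_set (\<lambda>i. cmod (\<xi> i) + cmod (\<eta> i)) F"
      by (rule L2_set_mono) (auto simp: norm_triangle_ineq)
    also have "\<dots> \<le> L2_set (\<lambda>i. cmod (\<xi> i)) F + L2_set (\<lambda>i. cmod (\<eta> i)) F"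
      by (rule L2_set_triangle_ineq)
    also have "\<dots> \<le> l2_norm I \<xi> + l2_norm I \<eta>"
      using L2_set_le_l2_norm[OF assms(1) F] L2_set_le_l2_norm[OF assms(2) F] by simp
    finally show ?thesis .
  qed
  moreover have "\<xi> i + \<eta> i = 0" if "i \<notin> I" for i using assms that by (simp add: l2_support)
  ultimately show "(\<lambda>i. \<xi> i + \<eta> i) \<in> l2 I" "l2_norm I (\<lambda>i. \<xi> i + \<eta> i) \<le> l2_norm I \<xi> + l2_norm I \<eta>"
    using l2_bounded[of I "\<lambda>i. \<xi> i + \<eta> i" "l2_norm I \<xi> + l2_norm I \<eta>"] by auto
qed

lemma l2_scale:
  assumes "\<xi> \<in> l2 I"
  shows "(\<lambda>i. c * \<xi> i) \<in> l2 I" "l2_norm I (\<lambda>i. c * \<xi> i) = cmod c * l2_norm I \<xi>"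
proof -
  show "(\<lambda>i. c * \<xi> i) \<in> l2 I"
    using assms by (auto simp: l2_def norm_mult power_mult_distrib intro: summable_on_cmult_right)
  show "l2_norm I (\<lambda>i. c * \<xi> i) = cmod c * l2_norm I \<xi>"
    by (simp add: l2_norm_def norm_mult power_mult_distrib infsum_cmult_right' real_sqrt_mult)
qed

lemma l2_sum:
  assumes "finite A" "\<And>a. a \<in> A \<Longrightarrow> \<xi> a \<in> l2 I"
  shows "(\<lambda>i. \<Sum>a\<in>A. \<xi> a i) \<in> l2 I" "l2_norm I (\<lambda>i. \<Sum>a\<in>A. \<xi> a i) \<le> (\<Sum>a\<in>A. l2_norm I (\<xi> a))"
proof -
  have "(\<lambda>i. \<Sum>a\<in>A. \<xi> a i) \<in> l2 I \<and> l2_norm I (\<lambda>i. \<Sum>a\<in>A. \<xi> a i) \<le> (\<Sum>a\<in>A. l2_norm I (\<xi> a))"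
    using assms
  proof (induction A rule: finite_induct)
    case empty
    then show ?case by (simp add: l2_0 l2_norm_0)
  next
    case (insert a A)
    then show ?case
      using l2_add[of "\<xi> a" I "\<lambda>i. \<Sum>a\<in>A. \<xi> a i"] by auto
  qed
  then show "(\<lambda>i. \<Sum>a\<in>A. \<xi> a i) \<in> l2 I" "l2_norm I (\<lambda>i. \<Sum>a\<in>A. \<xi> a i) \<le> (\<Sum>a\<in>A. l2_norm I (\<xi> a))" by auto
qed

lemma l2_limit:
  assumes "\<And>i. i \<notin> I \<Longrightarrow> \<xi> i = 0" "\<And>i. i \<in> I \<Longrightarrow> (\<lambda>k. X k i) \<longlonglongrightarrow> \<xi> i"
    and "\<And>k. X k \<in> l2 I" "\<And>k. l2_norm I (X k) \<le> B k" "B \<longlonglongrightarrow> C"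
  shows "\<xi> \<in> l2 I" "l2_norm I \<xi> \<le> C"
proof -
  have C: "0 \<le> C"
    by (rule LIMSEQ_le_const[OF assms(5)]) (use assms(4) l2_norm_nonneg order_trans in blast)
  have "L2_set (\<lambda>i. cmod (\<xi> i)) F \<le> C" if F: "finite F" "F \<subseteq> I" for F
  proof (rule LIMSEQ_le[OF _ assms(5)])
    show "(\<lambda>k. L2_set (\<lambda>i. cmod (X k i)) F) \<longlonglongrightarrow> L2_set (\<lambda>i. cmod (\<xi> i)) F"
      unfolding L2_set_def using F by (intro tendsto_intros assms(2)) auto
    show "\<exists>N. \<forall>k\<ge>N. L2_set (\<lambda>i. cmod (X k i)) F \<le> B k"
      using L2_set_le_l2_norm[OF assms(3) F] assms(4) order_trans by blast
  qed
  then show "\<xi> \<in> l2 I" "l2_norm I \<xi> \<le> C" using l2_bounded[of I \<xi> C] assms(1) C by auto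
qed

lemma l2_finite_support:
  assumes "finite A" "A \<subseteq> I" "\<And>i. i \<notin> A \<Longrightarrow> \<xi> i = 0"
  shows "\<xi> \<in> l2 I" "l2_norm I \<xi> \<le> L2_set (\<lambda>i. cmod (\<xi> i)) A"
proof -
  have "L2_set (\<lambda>i. cmod (\<xi> i)) F \<le> L2_set (\<lambda>i. cmod (\<xi> i)) A" if F: "finite F" "F \<subseteq> I" for F
  proof -
    have "(\<Sum>i\<in>F. (cmod (\<xi> i))\<^sup>2) = (\<Sum>i\<in>F \<inter> A. (cmod (\<xi> i))\<^sup>2)"
      using assms(3) F by (intro sum.mono_neutral_right) auto
    also have "\<dots> \<le> (\<Sum>i\<in>A. (cmod (\<xi> i))\<^sup>2)"
      using assms(1) by (intro sum_mono2) auto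
    finally show ?thesis by (simp add: L2_set_def)
  qed
  then show "\<xi> \<in> l2 I" "l2_norm I \<xi> \<le> L2_set (\<lambda>i. cmod (\<xi> i)) A"
    using l2_bounded[of I \<xi> "L2_set (\<lambda>i. cmod (\<xi> i)) A"] assms by auto
qed

lemma l2_delta_in: "y \<in> I \<Longrightarrow> l2_delta y \<in> l2 I"
  using l2_finite_support[of "{y}" I "l2_delta y"] by (auto simp: l2_delta_def)

lemma l2_inner_summable:
  assumes "\<xi> \<in> l2 I" "\<eta> \<in> l2 I"
  shows "(\<lambda>i. cmod (cnj (\<xi> i) * \<eta> i)) summable_on I"
proof (rule nonneg_bdd_above_summable_on)
  show "bdd_above (sum (\<lambda>i. cmod (cnj (\<xi> i) * \<eta> i)) ` {F. F \<subseteq> I \<and> finite F})"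
  proof (rule bdd_aboveI2[where M="l2_norm I \<xi> * l2_norm I \<eta>"])
    fix F assume F: "F \<in> {F. F \<subseteq> I \<and> finite F}"
    have "(\<Sum>i\<in>F. cmod (cnj (\<xi> i) * \<eta> i)) \<le> L2_set (\<lambda>i. cmod (\<xi> i)) F * L2_set (\<lambda>i. cmod (\<eta> i)) F"
      using L2_set_mult_ineq[of "\<lambda>i. cmod (\<xi> i)" "\<lambda>i. cmod (\<eta> i)" F] by (simp add: norm_mult)
    also have "\<dots> \<le> l2_norm I \<xi> * l2_norm I \<eta>"
      using F by (intro mult_mono L2_set_le_l2_norm assms) auto
    finally show "(\<Sum>i\<in>F. cmod (cnj (\<xi> i) * \<eta> i)) \<le> l2_norm I \<xi> * l2_norm I \<eta>" .
  qed
qed auto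

lemma l2_cauchy_schwarz:
  assumes "\<xi> \<in> l2 I" "\<eta> \<in> l2 I"
  shows "cmod (l2_inner I \<xi> \<eta>) \<le> l2_norm I \<xi> * l2_norm I \<eta>"
proof -
  have "cmod (l2_inner I \<xi> \<eta>) \<le> (\<Sum>\<^sub>\<infinity>i\<in>I. cmod (cnj (\<xi> i) * \<eta> i))"
    unfolding l2_inner_def by (rule norm_infsum_bound[OF l2_inner_summable[OF assms]])
  also have "\<dots> \<le> l2_norm I \<xi> * l2_norm I \<eta>"
  proof (rule infsum_le_finite_sums[OF l2_inner_summable[OF assms]])
    fix F assume F: "finite F" "F \<subseteq> I"
    have "(\<Sum>i\<in>F. cmod (cnj (\<xi> i) * \<eta> i)) \<le> L2_set (\<lambda>i. cmod (\<xi> i)) F * L2_set (\<lambda>i. cmod (\<eta> i)) F"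
      using L2_set_mult_ineq[of "\<lambda>i. cmod (\<xi> i)" "\<lambda>i. cmod (\<eta> i)" F] by (simp add: norm_mult)
    also have "\<dots> \<le> l2_norm I \<xi> * l2_norm I \<eta>"
      using F by (intro mult_mono L2_set_le_l2_norm assms) auto
    finally show "(\<Sum>i\<in>F. cmod (cnj (\<xi> i) * \<eta> i)) \<le> l2_norm I \<xi> * l2_norm I \<eta>" .
  qed
  finally show ?thesis .
qed

lemma l2_inner_self:
  assumes "\<xi> \<in> l2 I" shows "l2_inner I \<xi> \<xi> = of_real ((l2_norm I \<xi>)\<^sup>2)"
proof -
  have "((\<lambda>i. complex_of_real ((cmod (\<xi> i))\<^sup>2)) has_sum of_real (\<Sum>\<^sub>\<infinity>i\<in>I. (cmod (\<xi> i))\<^sup>2)) I"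
    using assms by (simp add: l2_def has_sum_of_real_iff del: of_real_power)
  moreover have "complex_of_real ((cmod (\<xi> i))\<^sup>2) = cnj (\<xi> i) * \<xi> i" for i
    by (metis complex_norm_square mult.commute)
  ultimately have "l2_inner I \<xi> \<xi> = of_real (\<Sum>\<^sub>\<infinity>i\<in>I. (cmod (\<xi> i))\<^sup>2)"
    by (simp add: l2_inner_def infsumI)
  then show ?thesis by (simp add: l2_norm_def infsum_nonneg)
qed

lemma l2_inner_cnj: "cnj (l2_inner I \<xi> \<eta>) = l2_inner I \<eta> \<xi>"
  unfolding l2_inner_def by (subst infsum_cnj[symmetric]) (simp add: mult.commute)

lemma l2_inner_sum_right:
  assumes "\<xi> \<in> l2 I" "finite A" "\<And>a. a \<in> A \<Longrightarrow> \<eta> a \<in> l2 I"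
  shows "l2_inner I \<xi> (\<lambda>i. \<Sum>a\<in>A. c a * \<eta> a i) = (\<Sum>a\<in>A. c a * l2_inner I \<xi> (\<eta> a))"
  using assms(2,3)
proof (induction A rule: finite_induct)
  case (insert a A)
  have s: "(\<lambda>i. cnj (\<xi> i) * \<zeta> i) summable_on I" if "\<zeta> \<in> l2 I" for \<zeta>
    using l2_inner_summable[OF assms(1) that] by (rule abs_summable_summable)
  have "l2_inner I \<xi> (\<lambda>i. \<Sum>a\<in>insert a A. c a * \<eta> a i) =
      (\<Sum>\<^sub>\<infinity>i\<in>I. c a * (cnj (\<xi> i) * \<eta> a i) + cnj (\<xi> i) * (\<Sum>a\<in>A. c a * \<eta> a i))"
    unfolding l2_inner_def using insert by (intro infsum_cong) (simp add: algebra_simps)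
  also have "\<dots> = (\<Sum>\<^sub>\<infinity>i\<in>I. c a * (cnj (\<xi> i) * \<eta> a i)) + (\<Sum>\<^sub>\<infinity>i\<in>I. cnj (\<xi> i) * (\<Sum>a\<in>A. c a * \<eta> a i))"
    using insert by (intro infsum_add summable_on_cmult_right s l2_sum l2_scale) auto
  finally show ?case using insert by (simp add: infsum_cmult_right' l2_inner_def)
qed (simp add: l2_inner_def)

lemma l2_inner_delta:
  assumes "y \<in> I" shows "l2_inner I (l2_delta y) \<xi> = \<xi> y"
proof -
  have "l2_inner I (l2_delta y) \<xi> = (\<Sum>\<^sub>\<infinity>i\<in>{y}. cnj (l2_delta y i) * \<xi> i)"
    unfolding l2_inner_def using assms by (intro infsum_cong_neutral) (auto simp: l2_delta_def)
  then show ?thesis by (simp add: l2_delta_def)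
qed

text \<open>The operators that come up are weighted combinations of partial permutations of the standard
  basis; a partial permutation is encoded as an \<open>option\<close>-valued map.\<close>

definition partial_shift :: "'i set \<Rightarrow> complex \<Rightarrow> ('i \<Rightarrow> 'i option) \<Rightarrow> ('i \<Rightarrow> complex) \<Rightarrow> 'i \<Rightarrow> complex" where
  "partial_shift I c P \<xi> i = (if i \<in> I then case P i of None \<Rightarrow> 0 | Some j \<Rightarrow> c * \<xi> j else 0)"

lemma partial_shift_l2:
  assumes inj: "\<And>i j k. i \<in> I \<Longrightarrow> j \<in> I \<Longrightarrow> P i = Some k \<Longrightarrow> P j = Some k \<Longrightarrow> i = j"
    and into: "\<And>i j. i \<in> I \<Longrightarrow> P i = Some j \<Longrightarrow> j \<in> I"
    and \<xi>: "\<xi> \<in> l2 I"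
  shows "partial_shift I c P \<xi> \<in> l2 I" "l2_norm I (partial_shift I c P \<xi>) \<le> cmod c * l2_norm I \<xi>"
proof -
  have "L2_set (\<lambda>i. cmod (partial_shift I c P \<xi> i)) F \<le> cmod c * l2_norm I \<xi>"
    if F: "finite F" "F \<subseteq> I" for F
  proof -
    let ?G = "{i\<in>F. P i \<noteq> None}"
    have "(\<Sum>i\<in>F. (cmod (partial_shift I c P \<xi> i))\<^sup>2) = (\<Sum>i\<in>?G. (cmod (c * \<xi> (the (P i))))\<^sup>2)"
      using F by (intro sum.mono_neutral_cong_right) (auto simp: partial_shift_def split: option.splits)
    also have "\<dots> = (\<Sum>j\<in>(\<lambda>i. the (P i)) ` ?G. (cmod (c * \<xi> j))\<^sup>2)"
    proof (subst sum.reindex)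
      show "inj_on (\<lambda>i. the (P i)) ?G"
        using inj F by (intro inj_onI) (metis (mono_tags, lifting) mem_Collect_eq option.collapse subsetD)
    qed simp
    finally have "L2_set (\<lambda>i. cmod (partial_shift I c P \<xi> i)) F
        = L2_set (\<lambda>j. cmod (c * \<xi> j)) ((\<lambda>i. the (P i)) ` ?G)"
      by (simp add: L2_set_def)
    also have "\<dots> \<le> l2_norm I (\<lambda>i. c * \<xi> i)"
      using F into by (intro L2_set_le_l2_norm l2_scale \<xi>) auto
    finally show ?thesis using l2_scale[OF \<xi>] by simp
  qed
  then show "partial_shift I c P \<xi> \<in> l2 I" "l2_norm I (partial_shift I c P \<xi>) \<le> cmod c * l2_norm I \<xi>"
    using l2_bounded[of I "partial_shift I c P \<xi>" "cmod c * l2_norm I \<xi>"]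
    by (auto simp: partial_shift_def)
qed

lemma partial_shift_adjoint:
  assumes inv: "\<And>i j. i \<in> I \<Longrightarrow> P i = Some j \<Longrightarrow> j \<in> I \<and> Q j = Some i"
    and inv': "\<And>i j. i \<in> I \<Longrightarrow> Q i = Some j \<Longrightarrow> j \<in> I \<and> P j = Some i"
  shows "l2_inner I (partial_shift I (cnj c) Q \<xi>) \<eta> = l2_inner I \<xi> (partial_shift I c P \<eta>)"
proof -
  let ?D = "{i\<in>I. P i \<noteq> None}" and ?R = "{i\<in>I. Q i \<noteq> None}"
  have bij: "bij_betw (\<lambda>i. the (P i)) ?D ?R"
  proof (rule bij_betwI[where g="\<lambda>i. the (Q i)"])
    show "(\<lambda>i. the (P i)) \<in> ?D \<rightarrow> ?R"
    proof
      fix i assume "i \<in> ?D"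
      then show "the (P i) \<in> ?R" using inv[of i "the (P i)"] by auto
    qed
    show "(\<lambda>i. the (Q i)) \<in> ?R \<rightarrow> ?D"
    proof
      fix i assume "i \<in> ?R"
      then show "the (Q i) \<in> ?D" using inv'[of i "the (Q i)"] by auto
    qed
    show "the (Q (the (P i))) = i" if "i \<in> ?D" for i
      using that inv[of i "the (P i)"] by auto
    show "the (P (the (Q i))) = i" if "i \<in> ?R" for i
      using that inv'[of i "the (Q i)"] by auto
  qed
  have "l2_inner I \<xi> (partial_shift I c P \<eta>) = (\<Sum>\<^sub>\<infinity>i\<in>?D. cnj (\<xi> i) * (c * \<eta> (the (P i))))"
    unfolding l2_inner_def
    by (intro infsum_cong_neutral) (auto simp: partial_shift_def split: option.splits)
  also have "\<dots> = (\<Sum>\<^sub>\<infinity>i\<in>?D. cnj (\<xi> (the (Q (the (P i))))) * (c * \<eta> (the (P i))))"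
  proof (rule infsum_cong)
    fix i assume "i \<in> ?D"
    then show "cnj (\<xi> i) * (c * \<eta> (the (P i))) = cnj (\<xi> (the (Q (the (P i))))) * (c * \<eta> (the (P i)))"
      using inv[of i "the (P i)"] by auto
  qed
  also have "\<dots> = (\<Sum>\<^sub>\<infinity>j\<in>?R. cnj (\<xi> (the (Q j))) * (c * \<eta> j))"
    by (rule infsum_reindex_bij_betw[OF bij])
  also have "\<dots> = l2_inner I (partial_shift I (cnj c) Q \<xi>) \<eta>"
    unfolding l2_inner_def
    by (intro infsum_cong_neutral) (auto simp: partial_shift_def split: option.splits)
  finally show ?thesis by simp
qed

section \<open>The free star-algebra and its universal seminorm\<close>

definition monomial :: "('v, 'e) letter list \<Rightarrow> ('v, 'e) free_elem" where
  "monomial W = (\<lambda>V. if V = W then 1 else 0)"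

abbreviation free_carrier :: "('v, 'e) pre_digraph \<Rightarrow> ('v, 'e) free_elem set" where
  "free_carrier E \<equiv> sa_carrier (free_alg E)"

lemma free_alg_simps [simp]:
  "sa_add (free_alg E) f g = (\<lambda>W. f W + g W)"
  "sa_scale (free_alg E) c f = (\<lambda>W. c * f W)"
  "sa_star (free_alg E) f = (\<lambda>W. cnj (f (adj_word W)))"
  "sa_diff (free_alg E) f g = (\<lambda>W. f W - g W)"
  by (simp_all add: free_alg_def sa_diff_def)

lemma free_mult: "sa_mult (free_alg E) f g = (\<lambda>W. \<Sum>k\<le>length W. f (take k W) * g (drop k W))"
  by (simp add: free_alg_def)

lemma free_gen_monomial: "free_gen g = monomial [(g, False)]"
  by (simp add: free_gen_def monomial_def)

lemma adj_word_adj_word [simp]: "adj_word (adj_word W) = W"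
  by (simp add: adj_word_def rev_map[symmetric] comp_def case_prod_unfold)

lemma adj_word_eq_iff: "adj_word V = W \<longleftrightarrow> V = adj_word W"
  by auto

lemma adj_word_Cons: "adj_word (l # W) = adj_word W @ [(fst l, \<not> snd l)]"
  by (simp add: adj_word_def case_prod_unfold)

lemma adj_word_Nil [simp]: "adj_word [] = []"
  by (simp add: adj_word_def)

lemma adj_word_lists [simp]: "adj_word W \<in> lists (letters E) \<longleftrightarrow> W \<in> lists (letters E)"
  by (auto simp: adj_word_def letters_def lists_eq_set image_iff)

lemma adj_word_eq_Nil [simp]: "adj_word W = [] \<longleftrightarrow> W = []"
  by (auto simp: adj_word_def)

lemma free_carrier_iff:
  "f \<in> free_carrier E \<longleftrightarrow> finite {W. f W \<noteq> 0} \<and> {W. f W \<noteq> 0} \<subseteq> lists (letters E) - {[]}"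
  by (simp add: free_alg_def)

lemma free_carrierI:
  assumes "finite A" "A \<subseteq> lists (letters E) - {[]}" "\<And>W. W \<notin> A \<Longrightarrow> f W = 0"
  shows "f \<in> free_carrier E"
  unfolding free_carrier_iff
proof
  have "{W. f W \<noteq> 0} \<subseteq> A" using assms(3) by auto
  then show "finite {W. f W \<noteq> 0}" "{W. f W \<noteq> 0} \<subseteq> lists (letters E) - {[]}"
    using assms(1,2) finite_subset by (blast, blast)
qed

lemma free_carrier_0 [simp]: "(\<lambda>W. 0) \<in> free_carrier E"
  by (rule free_carrierI[of "{}"]) auto

lemma free_carrier_add [simp]:
  assumes "f \<in> free_carrier E" "g \<in> free_carrier E" shows "(\<lambda>W. f W + g W) \<in> free_carrier E"
  by (rule free_carrierI[of "{W. f W \<noteq> 0} \<union> {W. g W \<noteq> 0}"])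
    (use assms in \<open>auto simp: free_carrier_iff\<close>)

lemma free_carrier_scale [simp]:
  assumes "f \<in> free_carrier E" shows "(\<lambda>W. c * f W) \<in> free_carrier E"
  by (rule free_carrierI[of "{W. f W \<noteq> 0}"]) (use assms in \<open>auto simp: free_carrier_iff\<close>)

lemma free_carrier_diff [simp]:
  assumes "f \<in> free_carrier E" "g \<in> free_carrier E" shows "(\<lambda>W. f W - g W) \<in> free_carrier E"
  using free_carrier_add[OF assms(1) free_carrier_scale[OF assms(2), of "-1"]] by simp

lemma free_carrier_star [simp]:
  assumes "f \<in> free_carrier E" shows "(\<lambda>W. cnj (f (adj_word W))) \<in> free_carrier E"
proof (rule free_carrierI[of "adj_word ` {W. f W \<noteq> 0}"])
  show "finite (adj_word ` {W. f W \<noteq> 0})" using assms by (simp add: free_carrier_iff)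
  show "adj_word ` {W. f W \<noteq> 0} \<subseteq> lists (letters E) - {[]}"
    using assms by (force simp: free_carrier_iff)
  show "cnj (f (adj_word W)) = 0" if "W \<notin> adj_word ` {W. f W \<noteq> 0}" for W
    using that by (metis (mono_tags, lifting) adj_word_adj_word complex_cnj_zero image_eqI mem_Collect_eq)
qed

lemma free_carrier_sum:
  assumes "finite A" "\<And>a. a \<in> A \<Longrightarrow> f a \<in> free_carrier E"
  shows "(\<lambda>W. \<Sum>a\<in>A. f a W) \<in> free_carrier E"
  using assms by (induction A rule: finite_induct) auto

lemma free_carrier_mult [simp]:
  assumes "f \<in> free_carrier E" "g \<in> free_carrier E"
  shows "sa_mult (free_alg E) f g \<in> free_carrier E"
proof (rule free_carrierI[of "(\<lambda>(V, W). V @ W) ` ({W. f W \<noteq> 0} \<times> {W. g W \<noteq> 0})"])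
  show "finite ((\<lambda>(V, W). V @ W) ` ({W. f W \<noteq> 0} \<times> {W. g W \<noteq> 0}))"
    using assms by (simp add: free_carrier_iff)
  show "(\<lambda>(V, W). V @ W) ` ({W. f W \<noteq> 0} \<times> {W. g W \<noteq> 0}) \<subseteq> lists (letters E) - {[]}"
  proof
    fix U assume "U \<in> (\<lambda>(V, W). V @ W) ` ({W. f W \<noteq> 0} \<times> {W. g W \<noteq> 0})"
    then obtain V W where U: "U = V @ W" "f V \<noteq> 0" "g W \<noteq> 0" by auto
    then have "V \<in> lists (letters E) - {[]}" "W \<in> lists (letters E) - {[]}"
      using assms unfolding free_carrier_iff by blast+
    then show "U \<in> lists (letters E) - {[]}" by (simp add: U)
  qed
  show "sa_mult (free_alg E) f g W = 0"
    if W: "W \<notin> (\<lambda>(V, W). V @ W) ` ({W. f W \<noteq> 0} \<times> {W. g W \<noteq> 0})" for W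
  proof -
    have "f (take k W) * g (drop k W) = 0" for k
    proof (rule ccontr)
      assume "f (take k W) * g (drop k W) \<noteq> 0"
      then have "(take k W, drop k W) \<in> {W. f W \<noteq> 0} \<times> {W. g W \<noteq> 0}" by simp
      then have "W \<in> (\<lambda>(V, W). V @ W) ` ({W. f W \<noteq> 0} \<times> {W. g W \<noteq> 0})"
        by (rule rev_image_eqI) simp
      with W show False by blast
    qed
    then show ?thesis unfolding free_mult by (intro sum.neutral) blast
  qed
qed

lemma monomial_in [simp]: "W \<in> lists (letters E) \<Longrightarrow> W \<noteq> [] \<Longrightarrow> monomial W \<in> free_carrier E"
  by (rule free_carrierI[of "{W}"]) (auto simp: monomial_def)

lemma monomial_star: "sa_star (free_alg E) (monomial W) = monomial (adj_word W)"
  by (auto simp: monomial_def fun_eq_iff adj_word_eq_iff)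

lemma monomial_mult: "sa_mult (free_alg E) (monomial V) (monomial W) = monomial (V @ W)"
proof
  fix U :: "('a, 'b) letter list"
  have *: "(take k U = V \<and> drop k U = W) \<longleftrightarrow> (k = length V \<and> U = V @ W)" if "k \<le> length U" for k
    using that by (auto simp: append_eq_conv_conj)
  have "sa_mult (free_alg E) (monomial V) (monomial W) U =
      (\<Sum>k\<le>length U. if take k U = V \<and> drop k U = W then 1 else 0)"
    unfolding free_mult monomial_def by (intro sum.cong) auto
  also have "\<dots> = (\<Sum>k\<le>length U. if k = length V then (if U = V @ W then 1 else 0) else 0)"
    by (intro sum.cong) (use * in auto)
  also have "\<dots> = monomial (V @ W) U"
    by (auto simp: monomial_def)
  finally show "sa_mult (free_alg E) (monomial V) (monomial W) U = monomial (V @ W) U" .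
qed

lemma free_mult_sum_left:
  "sa_mult (free_alg E) (\<lambda>W. \<Sum>a\<in>A. c a * f a W) g = (\<lambda>W. \<Sum>a\<in>A. c a * sa_mult (free_alg E) (f a) g W)"
proof
  fix W
  show "sa_mult (free_alg E) (\<lambda>W. \<Sum>a\<in>A. c a * f a W) g W = (\<Sum>a\<in>A. c a * sa_mult (free_alg E) (f a) g W)"
    unfolding free_mult sum_distrib_right sum_distrib_left
    by (subst sum.swap) (simp add: mult.assoc)
qed

lemma free_mult_sum_right:
  "sa_mult (free_alg E) g (\<lambda>W. \<Sum>a\<in>A. c a * f a W) = (\<lambda>W. \<Sum>a\<in>A. c a * sa_mult (free_alg E) g (f a) W)"
proof
  fix W
  show "sa_mult (free_alg E) g (\<lambda>W. \<Sum>a\<in>A. c a * f a W) W = (\<Sum>a\<in>A. c a * sa_mult (free_alg E) g (f a) W)"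
    unfolding free_mult sum_distrib_right sum_distrib_left
    by (subst sum.swap) (simp add: algebra_simps)
qed

lemma free_mult_diff_left:
  "sa_mult (free_alg E) (\<lambda>W. f W - f' W) g = (\<lambda>W. sa_mult (free_alg E) f g W - sa_mult (free_alg E) f' g W)"
  by (simp add: free_mult fun_eq_iff left_diff_distrib sum_subtractf)

lemma free_mult_diff_right:
  "sa_mult (free_alg E) g (\<lambda>W. f W - f' W) = (\<lambda>W. sa_mult (free_alg E) g f W - sa_mult (free_alg E) g f' W)"
  by (simp add: free_mult fun_eq_iff right_diff_distrib sum_subtractf)

lemma free_expand:
  assumes "finite A" "{W. f W \<noteq> 0} \<subseteq> A"
  shows "f = (\<lambda>V. \<Sum>W\<in>A. f W * monomial W V)"
proof
  fix V
  have "(\<Sum>W\<in>A. f W * monomial W V) = (\<Sum>W\<in>A. if W = V then f V else 0)"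
    by (intro sum.cong) (auto simp: monomial_def)
  then show "f V = (\<Sum>W\<in>A. f W * monomial W V)" using assms by auto
qed

definition graph_seminorm :: "('v, 'e) pre_digraph \<Rightarrow> (('v, 'e) free_elem \<Rightarrow> real) \<Rightarrow> bool" where
  "graph_seminorm E \<rho> \<longleftrightarrow> cstar_seminorm (free_alg E) \<rho> \<and> (\<forall>g\<in>graph_relations E. \<rho> g = 0)"

context
  fixes E :: "('v, 'e) pre_digraph" and \<rho>
  assumes \<rho>: "cstar_seminorm (free_alg E) \<rho>"
begin

lemma seminorm_nonneg: "f \<in> free_carrier E \<Longrightarrow> 0 \<le> \<rho> f"
  using \<rho> by (simp add: cstar_seminorm_def)

lemma seminorm_add: "f \<in> free_carrier E \<Longrightarrow> g \<in> free_carrier E \<Longrightarrow> \<rho> (\<lambda>W. f W + g W) \<le> \<rho> f + \<rho> g"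
  using \<rho> by (simp add: cstar_seminorm_def)

lemma seminorm_scale: "f \<in> free_carrier E \<Longrightarrow> \<rho> (\<lambda>W. c * f W) = cmod c * \<rho> f"
  using \<rho> by (simp add: cstar_seminorm_def)

lemma seminorm_mult:
  "f \<in> free_carrier E \<Longrightarrow> g \<in> free_carrier E \<Longrightarrow> \<rho> (sa_mult (free_alg E) f g) \<le> \<rho> f * \<rho> g"
  using \<rho> by (simp add: cstar_seminorm_def)

lemma seminorm_star_mult:
  "f \<in> free_carrier E \<Longrightarrow> \<rho> (sa_mult (free_alg E) (sa_star (free_alg E) f) f) = (\<rho> f)\<^sup>2"
  using \<rho> by (simp add: cstar_seminorm_def)

lemma seminorm_0: "\<rho> (\<lambda>W. 0) = 0"
  using seminorm_scale[of "\<lambda>W. 0" 0] by simp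

lemma seminorm_diff:
  assumes "f \<in> free_carrier E" "g \<in> free_carrier E" shows "\<rho> (\<lambda>W. f W - g W) \<le> \<rho> f + \<rho> g"
  using seminorm_add[OF assms(1) free_carrier_scale[OF assms(2), of "-1"]]
    seminorm_scale[OF assms(2), of "-1"] by simp

lemma seminorm_minus_commute:
  assumes "f \<in> free_carrier E" "g \<in> free_carrier E" shows "\<rho> (\<lambda>W. f W - g W) = \<rho> (\<lambda>W. g W - f W)"
  using seminorm_scale[OF free_carrier_diff[OF assms], of "-1"] by simp

lemma seminorm_triangle:
  assumes "f \<in> free_carrier E" "g \<in> free_carrier E" "h \<in> free_carrier E"
  shows "\<rho> (\<lambda>W. f W - h W) \<le> \<rho> (\<lambda>W. f W - g W) + \<rho> (\<lambda>W. g W - h W)"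
  using seminorm_add[of "\<lambda>W. f W - g W" "\<lambda>W. g W - h W"] assms by simp

lemma seminorm_abs_diff:
  assumes "f \<in> free_carrier E" "g \<in> free_carrier E" shows "\<bar>\<rho> f - \<rho> g\<bar> \<le> \<rho> (\<lambda>W. f W - g W)"
  using seminorm_add[of "\<lambda>W. f W - g W" g] seminorm_add[of "\<lambda>W. g W - f W" f]
    seminorm_minus_commute[OF assms] assms by simp

lemma seminorm_sum:
  assumes "finite A" "\<And>a. a \<in> A \<Longrightarrow> f a \<in> free_carrier E"
  shows "\<rho> (\<lambda>W. \<Sum>a\<in>A. f a W) \<le> (\<Sum>a\<in>A. \<rho> (f a))"
  using assms
proof (induction A rule: finite_induct)
  case (insert a A)
  then show ?case
    using seminorm_add[of "f a" "\<lambda>W. \<Sum>a\<in>A. f a W"] free_carrier_sum[of A f E] by auto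
qed (simp add: seminorm_0)

lemma seminorm_star:
  assumes "f \<in> free_carrier E" shows "\<rho> (\<lambda>W. cnj (f (adj_word W))) = \<rho> f"
proof -
  have le: "\<rho> g \<le> \<rho> (\<lambda>W. cnj (g (adj_word W)))" if "g \<in> free_carrier E" for g
  proof (cases "\<rho> g = 0")
    case False
    then have "0 < \<rho> g" using seminorm_nonneg[OF that] by simp
    moreover have "\<rho> g * \<rho> g \<le> \<rho> (\<lambda>W. cnj (g (adj_word W))) * \<rho> g"
      using seminorm_star_mult[OF that] seminorm_mult[OF free_carrier_star[OF that] that]
      by (simp add: power2_eq_square)
    ultimately show ?thesis by simp
  qed (use that in \<open>simp add: seminorm_nonneg\<close>)
  show ?thesis using le[OF assms] le[OF free_carrier_star[OF assms]] by simp
qed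

lemma seminorm_zero_diff:
  assumes "f \<in> free_carrier E" "g \<in> free_carrier E" "\<rho> (\<lambda>W. f W - g W) = 0" shows "\<rho> f = \<rho> g"
  using seminorm_abs_diff[OF assms(1,2)] assms(3) by simp

end

lemma letters_simps [simp]:
  "(Vert v, b) \<in> letters E \<longleftrightarrow> v \<in> verts E" "(Edge e, b) \<in> letters E \<longleftrightarrow> e \<in> arcs E"
  by (auto simp: letters_def)

lemma graph_seminorm_relations:
  assumes "graph_seminorm E \<rho>"
  shows "v \<in> verts E \<Longrightarrow> \<rho> (\<lambda>W. monomial [(Vert v, False), (Vert v, False)] W - monomial [(Vert v, False)] W) = 0"
    and "v \<in> verts E \<Longrightarrow> \<rho> (\<lambda>W. monomial [(Vert v, True)] W - monomial [(Vert v, False)] W) = 0"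
    and "e \<in> arcs E \<Longrightarrow> \<rho> (\<lambda>W. monomial [(Edge e, True), (Edge e, False)] W - monomial [(Vert (tail E e), False)] W) = 0"
proof -
  have *: "adj_word [(g, False)] = [(g, True)]" for g :: "('a, 'b) generator" by (simp add: adj_word_def)
  have mm: "sa_diff F (sa_mult F (free_gen g) (free_gen g)) (free_gen g)
      = (\<lambda>W. monomial [(g, False), (g, False)] W - monomial [(g, False)] W)"
    if "F = free_alg E" for F and g :: "('a, 'b) generator"
    using that by (simp add: free_gen_monomial monomial_mult)
  have st: "sa_diff F (sa_star F (free_gen g)) (free_gen g)
      = (\<lambda>W. monomial [(g, True)] W - monomial [(g, False)] W)"
    if "F = free_alg E" for F and g :: "('a, 'b) generator"
    using monomial_star[of E "[(g, False)]"] that by (simp add: free_gen_monomial * del: free_alg_simps(3))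
  have ss: "sa_diff F (sa_mult F (sa_star F (free_gen g)) (free_gen g)) (free_gen h)
      = (\<lambda>W. monomial [(g, True), (g, False)] W - monomial [(h, False)] W)"
    if "F = free_alg E" for F and g h :: "('a, 'b) generator"
    using monomial_star[of E "[(g, False)]"] that
    by (simp add: free_gen_monomial * monomial_mult del: free_alg_simps(3))
  have R: "\<forall>g\<in>graph_relations E. \<rho> g = 0" using assms by (simp add: graph_seminorm_def)
  show "v \<in> verts E \<Longrightarrow> \<rho> (\<lambda>W. monomial [(Vert v, False), (Vert v, False)] W - monomial [(Vert v, False)] W) = 0"
    by (rule R[rule_format]) (auto simp: graph_relations_def Let_def mm[symmetric])
  show "v \<in> verts E \<Longrightarrow> \<rho> (\<lambda>W. monomial [(Vert v, True)] W - monomial [(Vert v, False)] W) = 0"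
    by (rule R[rule_format]) (auto simp: graph_relations_def Let_def st[symmetric])
  show "e \<in> arcs E \<Longrightarrow> \<rho> (\<lambda>W. monomial [(Edge e, True), (Edge e, False)] W - monomial [(Vert (tail E e), False)] W) = 0"
    by (rule R[rule_format]) (auto simp: graph_relations_def Let_def ss[symmetric])
qed

text \<open>The C*-identity turns the relations into \<open>\<rho>(p)\<^sup>2 = \<rho>(p)\<close> and \<open>\<rho>(s\<^sub>e)\<^sup>2 = \<rho>(p)\<close> with
  \<open>p = p\<^bsub>s(e)\<^esub>\<close>.\<close>

lemma graph_seminorm_letter:
  assumes E: "wf_digraph E" and \<rho>: "graph_seminorm E \<rho>" and l: "l \<in> letters E"
  shows "\<rho> (monomial [l]) \<le> 1"
proof -
  have cs: "cstar_seminorm (free_alg E) \<rho>" using \<rho> by (simp add: graph_seminorm_def)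
  have star: "\<rho> (monomial [(g, True)]) = \<rho> (monomial [(g, False)])" if "(g, False) \<in> letters E" for g
    using seminorm_star[OF cs, of "monomial [(g, False)]"] monomial_star[of E "[(g, False)]"] that
    by (simp add: adj_word_def)
  have sq: "\<rho> (monomial [(g, True), (g, False)]) = (\<rho> (monomial [(g, False)]))\<^sup>2"
    if "(g, False) \<in> letters E" for g
    using seminorm_star_mult[OF cs, of "monomial [(g, False)]"] monomial_star[of E "[(g, False)]"] that
    by (simp add: adj_word_def monomial_mult del: free_alg_simps(3))
  have V: "\<rho> (monomial [(Vert v, False)]) \<le> 1" if v: "v \<in> verts E" for v
  proof -
    let ?p = "monomial [(Vert v, False)]" and ?q = "monomial [(Vert v, True)]"
    have p: "?p \<in> free_carrier E" "?q \<in> free_carrier E"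
      "monomial [(Vert v, False), (Vert v, False)] \<in> free_carrier E"
      using v by (auto intro: monomial_in)
    have "\<rho> (\<lambda>W. sa_mult (free_alg E) ?q ?p W - sa_mult (free_alg E) ?p ?p W) \<le> 0 * \<rho> ?p"
      unfolding graph_seminorm_relations(2)[OF \<rho> v, symmetric] free_mult_diff_left[symmetric]
      using p by (intro seminorm_mult[OF cs]) simp_all
    then have "\<rho> (\<lambda>W. sa_mult (free_alg E) ?q ?p W - sa_mult (free_alg E) ?p ?p W) = 0"
      using p seminorm_nonneg[OF cs] by (simp add: order.antisym)
    then have "\<rho> (sa_mult (free_alg E) ?q ?p) = \<rho> (sa_mult (free_alg E) ?p ?p)"
      using p by (intro seminorm_zero_diff[OF cs]) simp_all
    also have "\<dots> = \<rho> ?p"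
      using p graph_seminorm_relations(1)[OF \<rho> v]
      by (intro seminorm_zero_diff[OF cs]) (simp_all add: monomial_mult)
    finally have "(\<rho> ?p)\<^sup>2 = \<rho> ?p" using sq[of "Vert v"] v by (simp add: monomial_mult)
    then show ?thesis by (auto simp: power2_eq_square)
  qed
  have S: "\<rho> (monomial [(Edge e, False)]) \<le> 1" if e: "e \<in> arcs E" for e
  proof -
    have t: "tail E e \<in> verts E" using E e by (simp add: wf_digraph_def)
    have "\<rho> (monomial [(Edge e, True), (Edge e, False)]) = \<rho> (monomial [(Vert (tail E e), False)])"
      using e t graph_seminorm_relations(3)[OF \<rho> e] by (intro seminorm_zero_diff[OF cs]) auto
    then have "(\<rho> (monomial [(Edge e, False)]))\<^sup>2 \<le> 1"
      using sq[of "Edge e"] e V[OF t] by simp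
    then show ?thesis using power2_le_imp_le[of "\<rho> (monomial [(Edge e, False)])" 1] by simp
  qed
  obtain g b where gb: "l = (g, b)" by (cases l)
  have "\<rho> (monomial [(g, False)]) \<le> 1" using l V S by (cases g) (auto simp: gb)
  moreover have "(g, False) \<in> letters E" using l by (cases g) (auto simp: gb)
  ultimately show ?thesis using star by (cases b) (auto simp: gb)
qed

lemma graph_seminorm_monomial:
  assumes E: "wf_digraph E" and \<rho>: "graph_seminorm E \<rho>" and W: "W \<in> lists (letters E)" "W \<noteq> []"
  shows "\<rho> (monomial W) \<le> 1"
  using W(2,1)
proof (induction W rule: list_nonempty_induct)
  case (cons l W)
  have cs: "cstar_seminorm (free_alg E) \<rho>" using \<rho> by (simp add: graph_seminorm_def)
  have "\<rho> (monomial (l # W)) \<le> \<rho> (monomial [l]) * \<rho> (monomial W)"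
    using seminorm_mult[OF cs, of "monomial [l]" "monomial W"] cons by (simp add: monomial_mult)
  also have "\<dots> \<le> 1 * 1"
    using cons seminorm_nonneg[OF cs] graph_seminorm_letter[OF E \<rho>]
    by (intro mult_mono) auto
  finally show ?case by simp
qed (use graph_seminorm_letter[OF E \<rho>] in auto)

text \<open>This bound makes the supremum defining the universal seminorm a genuine one: over an unbounded
  set of reals \<open>Sup\<close> would carry no information.\<close>

lemma graph_seminorm_bound:
  assumes E: "wf_digraph E" and \<rho>: "graph_seminorm E \<rho>" and f: "f \<in> free_carrier E"
  shows "\<rho> f \<le> (\<Sum>W | f W \<noteq> 0. cmod (f W))"
proof -
  have cs: "cstar_seminorm (free_alg E) \<rho>" using \<rho> by (simp add: graph_seminorm_def)
  have fin: "finite {W. f W \<noteq> 0}" and sub: "{W. f W \<noteq> 0} \<subseteq> lists (letters E) - {[]}"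
    using f by (auto simp: free_carrier_iff)
  have m: "monomial W \<in> free_carrier E" if "f W \<noteq> 0" for W using sub that by (intro monomial_in) auto
  have "\<rho> f = \<rho> (\<lambda>V. \<Sum>W | f W \<noteq> 0. f W * monomial W V)"
    by (subst free_expand[OF fin]) auto
  also have "\<dots> \<le> (\<Sum>W | f W \<noteq> 0. \<rho> (\<lambda>V. f W * monomial W V))"
    using m by (intro seminorm_sum[OF cs fin] free_carrier_scale) auto
  also have "\<dots> = (\<Sum>W | f W \<noteq> 0. cmod (f W) * \<rho> (monomial W))"
    using m by (intro sum.cong seminorm_scale[OF cs]) auto
  also have "\<dots> \<le> (\<Sum>W | f W \<noteq> 0. cmod (f W) * 1)"
    using sub by (intro sum_mono mult_left_mono graph_seminorm_monomial[OF E \<rho>]) auto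
  finally show ?thesis by simp
qed

lemma universal_seminorm_eq: "universal_seminorm E f = (SUP \<rho>\<in>{\<rho>. graph_seminorm E \<rho>}. \<rho> f)"
  by (simp add: universal_seminorm_def graph_seminorm_def)

lemma graph_seminorm_le_universal:
  assumes E: "wf_digraph E" and \<rho>: "graph_seminorm E \<rho>" and f: "f \<in> free_carrier E"
  shows "\<rho> f \<le> universal_seminorm E f"
  unfolding universal_seminorm_eq
  by (rule cSUP_upper)
    (use \<rho> graph_seminorm_bound[OF E _ f] in \<open>auto intro!: bdd_aboveI2\<close>)

lemma graph_seminorm_zero: "graph_seminorm E (\<lambda>_. 0)"
  by (simp add: graph_seminorm_def cstar_seminorm_def)

lemma universal_seminorm_least:
  assumes "\<And>\<rho>. graph_seminorm E \<rho> \<Longrightarrow> \<rho> f \<le> C" shows "universal_seminorm E f \<le> C"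
  unfolding universal_seminorm_eq
  by (rule cSUP_least) (use graph_seminorm_zero assms in auto)

lemma graph_seminorm_universal:
  assumes E: "wf_digraph E" shows "graph_seminorm E (universal_seminorm E)"
proof -
  let ?U = "universal_seminorm E"
  note up = graph_seminorm_le_universal[OF E] and least = universal_seminorm_least
  have cs: "cstar_seminorm (free_alg E) \<rho>" if "graph_seminorm E \<rho>" for \<rho>
    using that by (simp add: graph_seminorm_def)
  have nonneg: "0 \<le> ?U f" if "f \<in> free_carrier E" for f
    using up[OF graph_seminorm_zero that] .
  have add: "?U (\<lambda>W. f W + g W) \<le> ?U f + ?U g" if "f \<in> free_carrier E" "g \<in> free_carrier E" for f g
  proof (rule least)
    fix \<rho> assume "graph_seminorm E \<rho>"
    then show "\<rho> (\<lambda>W. f W + g W) \<le> ?U f + ?U g"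
      using seminorm_add[OF cs that] up[of \<rho>] that by (meson add_mono order_trans)
  qed
  have scale_le: "?U (\<lambda>W. c * f W) \<le> cmod c * ?U f" if "f \<in> free_carrier E" for c f
  proof (rule least)
    fix \<rho> assume \<rho>: "graph_seminorm E \<rho>"
    show "\<rho> (\<lambda>W. c * f W) \<le> cmod c * ?U f"
      using seminorm_scale[OF cs[OF \<rho>] that, of c] up[OF \<rho> that] by (simp add: mult_left_mono)
  qed
  have scale: "?U (\<lambda>W. c * f W) = cmod c * ?U f" if f: "f \<in> free_carrier E" for c f
  proof (cases "c = 0")
    case True
    then show ?thesis using scale_le[OF f, of 0] nonneg[of "\<lambda>W. 0"] by simp
  next
    case False
    have "?U f = ?U (\<lambda>W. inverse c * (c * f W))" using False by (simp add: mult.assoc[symmetric])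
    also have "\<dots> \<le> cmod (inverse c) * ?U (\<lambda>W. c * f W)" using f by (intro scale_le) simp
    finally have "cmod c * ?U f \<le> ?U (\<lambda>W. c * f W)"
      using False by (simp add: norm_divide inverse_eq_divide field_simps)
    then show ?thesis using scale_le[OF f, of c] by simp
  qed
  have mult: "?U (sa_mult (free_alg E) f g) \<le> ?U f * ?U g" if f: "f \<in> free_carrier E" "g \<in> free_carrier E" for f g
  proof (rule least)
    fix \<rho> assume \<rho>: "graph_seminorm E \<rho>"
    have "\<rho> (sa_mult (free_alg E) f g) \<le> \<rho> f * \<rho> g" by (rule seminorm_mult[OF cs[OF \<rho>] f])
    also have "\<dots> \<le> ?U f * ?U g"
      using f by (intro mult_mono up \<rho> nonneg seminorm_nonneg[OF cs[OF \<rho>]])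
    finally show "\<rho> (sa_mult (free_alg E) f g) \<le> ?U f * ?U g" .
  qed
  have star: "?U (sa_mult (free_alg E) (sa_star (free_alg E) f) f) = (?U f)\<^sup>2" if f: "f \<in> free_carrier E" for f
  proof (rule antisym)
    show "?U (sa_mult (free_alg E) (sa_star (free_alg E) f) f) \<le> (?U f)\<^sup>2"
    proof (rule least)
      fix \<rho> assume \<rho>: "graph_seminorm E \<rho>"
      show "\<rho> (sa_mult (free_alg E) (sa_star (free_alg E) f) f) \<le> (?U f)\<^sup>2"
        unfolding seminorm_star_mult[OF cs[OF \<rho>] f]
        using up[OF \<rho> f] seminorm_nonneg[OF cs[OF \<rho>] f] by (simp add: power_mono)
    qed
    have "?U f \<le> sqrt (?U (sa_mult (free_alg E) (sa_star (free_alg E) f) f))"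
    proof (rule least)
      fix \<rho> assume \<rho>: "graph_seminorm E \<rho>"
      show "\<rho> f \<le> sqrt (?U (sa_mult (free_alg E) (sa_star (free_alg E) f) f))"
        using seminorm_star_mult[OF cs[OF \<rho>] f] up[OF \<rho>, of "sa_mult (free_alg E) (sa_star (free_alg E) f) f"] f
        by (intro real_le_rsqrt) simp
    qed
    then show "(?U f)\<^sup>2 \<le> ?U (sa_mult (free_alg E) (sa_star (free_alg E) f) f)"
      using nonneg[OF f] nonneg[of "sa_mult (free_alg E) (sa_star (free_alg E) f) f"] f
      by (metis free_alg_simps(3) free_carrier_mult free_carrier_star real_sqrt_le_iff real_sqrt_abs abs_of_nonneg)
  qed
  have rel: "?U g = 0" if "g \<in> graph_relations E" for g
  proof -
    have "?U g = (SUP \<rho>\<in>{\<rho>. graph_seminorm E \<rho>}. (0::real))"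
      unfolding universal_seminorm_eq using that by (intro SUP_cong) (auto simp: graph_seminorm_def)
    also have "\<dots> = 0" using graph_seminorm_zero[of E] by (intro cSUP_const) auto
    finally show ?thesis .
  qed
  show ?thesis
    unfolding graph_seminorm_def cstar_seminorm_def
    using nonneg add scale mult star rel by simp
qed

section \<open>The action of words on infinite paths\<close>

text \<open>The value of \<open>\<pi>\<^bsub>x,u\<^esub>(W) \<xi>\<close> at \<open>y\<close> is a multiple of the value of \<open>\<xi>\<close> at \<open>word_act E W y\<close>. Because
  functions are pulled back, \<open>s\<^sub>e\<close> deletes the edge \<open>e\<close> while \<open>s\<^sub>e\<^sup>*\<close> prepends it, and the first
  letter of a word acts first.\<close>

fun letter_act :: "('v, 'e) pre_digraph \<Rightarrow> ('v, 'e) letter \<Rightarrow> (nat \<Rightarrow> 'e) \<Rightarrow> (nat \<Rightarrow> 'e) option" where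
  "letter_act E (Vert v, b) y = (if path_range E y = v then Some y else None)"
| "letter_act E (Edge e, False) y = (if y 0 = e then Some (\<lambda>i. y (Suc i)) else None)"
| "letter_act E (Edge e, True) y = (if path_range E y = tail E e then Some (path_cons e y) else None)"

fun word_act :: "('v, 'e) pre_digraph \<Rightarrow> ('v, 'e) letter list \<Rightarrow> (nat \<Rightarrow> 'e) \<Rightarrow> (nat \<Rightarrow> 'e) option" where
  "word_act E [] y = Some y"
| "word_act E (l # W) y = Option.bind (letter_act E l y) (word_act E W)"

fun letter_degree :: "('v, 'e) letter \<Rightarrow> int" where
  "letter_degree (Vert v, b) = 0"
| "letter_degree (Edge e, b) = (if b then -1 else 1)"

definition word_degree :: "('v, 'e) letter list \<Rightarrow> int" where
  "word_degree W = sum_list (map letter_degree W)"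

lemma word_degree_simps [simp]:
  "word_degree [] = 0" "word_degree (l # W) = letter_degree l + word_degree W"
  "word_degree (V @ W) = word_degree V + word_degree W"
  by (simp_all add: word_degree_def)

lemma word_degree_adj [simp]: "word_degree (adj_word W) = - word_degree W"
proof (induction W)
  case (Cons l W)
  obtain g b where "l = (g, b)" by (cases l)
  then show ?case using Cons by (cases g) (auto simp: adj_word_Cons)
qed simp

lemma word_act_append: "word_act E (V @ W) y = Option.bind (word_act E V y) (word_act E W)"
  by (induction V arbitrary: y) (auto split: Option.bind_split)

lemma path_cons_simps [simp]: "path_cons e y 0 = e" "path_cons e y (Suc i) = y i"
  by (simp_all add: path_cons_def)

lemma path_cons_shift: "path_cons (y 0) (\<lambda>i. y (Suc i)) = y"
  by (auto simp: path_cons_def fun_eq_iff split: nat.splits)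

lemma infinite_path_shift: "y \<in> infinite_paths E \<Longrightarrow> (\<lambda>i. y (i + n)) \<in> infinite_paths E"
  by (auto simp: infinite_paths_def)

lemma infinite_path_cons:
  "y \<in> infinite_paths E \<Longrightarrow> e \<in> arcs E \<Longrightarrow> path_range E y = tail E e \<Longrightarrow> path_cons e y \<in> infinite_paths E"
  by (auto simp: infinite_paths_def path_cons_def path_range_def split: nat.splits)

lemma letter_act_infinite_path:
  assumes "y \<in> infinite_paths E" "l \<in> letters E" "letter_act E l y = Some y'"
  shows "y' \<in> infinite_paths E"
  using assms infinite_path_shift[of y E 1]
  by (cases "(E, l, y)" rule: letter_act.cases) (auto split: if_splits simp: infinite_path_cons)

lemma letter_act_adj:
  assumes "y \<in> infinite_paths E" "letter_act E l y = Some y'"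
  shows "letter_act E (fst l, \<not> snd l) y' = Some y"
  using assms
  by (cases "(E, l, y)" rule: letter_act.cases)
    (auto split: if_splits simp: path_cons_shift path_range_def infinite_paths_def)

lemma word_act_infinite_path:
  assumes "y \<in> infinite_paths E" "W \<in> lists (letters E)" "word_act E W y = Some y'"
  shows "y' \<in> infinite_paths E"
  using assms
proof (induction W arbitrary: y)
  case (Cons l W)
  then obtain z where z: "letter_act E l y = Some z" "word_act E W z = Some y'"
    by (auto split: Option.bind_splits)
  then show ?case
    using Cons letter_act_infinite_path[OF Cons.prems(1) _ z(1)] by auto
qed simp

lemma word_act_adj:
  assumes "y \<in> infinite_paths E" "W \<in> lists (letters E)" "word_act E W y = Some y'"
  shows "word_act E (adj_word W) y' = Some y"
  using assms
proof (induction W arbitrary: y)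
  case (Cons l W)
  then obtain z where z: "letter_act E l y = Some z" "word_act E W z = Some y'"
    by (auto split: Option.bind_splits)
  have "word_act E (adj_word W) y' = Some z"
    using Cons z letter_act_infinite_path[OF Cons.prems(1) _ z(1)] by simp
  then show ?case
    using letter_act_adj[OF Cons.prems(1) z(1)] by (simp add: adj_word_Cons word_act_append)
qed simp

text \<open>A word of length \<open>N\<close> changes at most the first \<open>N\<close> edges of a path: if \<open>n \<ge> N\<close>, the tail
  beyond position \<open>n\<close> is carried along, shifted by the degree, and may be exchanged for any other
  tail with the same range.\<close>

definition graft :: "(nat \<Rightarrow> 'e) \<Rightarrow> nat \<Rightarrow> (nat \<Rightarrow> 'e) \<Rightarrow> nat \<Rightarrow> 'e" where
  "graft y n t = (\<lambda>i. if i < n then y i else t (i - n))"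

lemma graft_shift [simp]: "graft y n t (i + n) = t i"
  by (simp add: graft_def)

lemma graft_self [simp]: "graft y n (\<lambda>i. y (i + n)) = y"
  by (auto simp: graft_def)

lemma graft_graft [simp]: "graft (graft y n t) n t' = graft y n t'"
  by (auto simp: graft_def)

lemma path_cons_graft: "path_cons e (graft y n t) = graft (path_cons e y) (Suc n) t"
  by (auto simp: graft_def path_cons_def fun_eq_iff split: nat.splits)

lemma shift_graft: "(\<lambda>i. graft y (Suc n) t (Suc i)) = graft (\<lambda>i. y (Suc i)) n t"
  by (auto simp: graft_def)

lemma path_range_graft:
  assumes "path_range E t = head E (y n)"
  shows "path_range E (graft y n t) = path_range E y"
  using assms by (auto simp: path_range_def graft_def)

lemma infinite_path_graft:
  assumes "y \<in> infinite_paths E" "t \<in> infinite_paths E" "path_range E t = head E (y n)"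
  shows "graft y n t \<in> infinite_paths E"
  unfolding infinite_paths_def
proof (clarify)
  fix i
  have y: "y i \<in> arcs E" "tail E (y i) = head E (y (Suc i))" using assms by (auto simp: infinite_paths_def)
  have t: "t j \<in> arcs E" "tail E (t j) = head E (t (Suc j))" for j using assms by (auto simp: infinite_paths_def)
  consider "Suc i < n" | "Suc i = n" | "n \<le> i" by linarith
  then show "graft y n t i \<in> arcs E \<and> tail E (graft y n t i) = head E (graft y n t (Suc i))"
  proof cases
    case 3
    then show ?thesis using t[of "i - n"] by (simp add: graft_def Suc_diff_le)
  qed (use y t[of 0] assms(3) in \<open>auto simp: graft_def path_range_def\<close>)
qed

lemma word_act_graft:
  assumes "y \<in> infinite_paths E" "W \<in> lists (letters E)" "word_act E W y = Some y'" "length W \<le> n"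
    and "path_range E t = head E (y n)"
  obtains m where "int m = int n - word_degree W" "\<And>i. y' (i + m) = y (i + n)"
    "word_act E W (graft y n t) = Some (graft y' m t)"
proof -
  have "\<exists>m. int m = int n - word_degree W \<and> (\<forall>i. y' (i + m) = y (i + n)) \<and>
    word_act E W (graft y n t) = Some (graft y' m t)"
    using assms
  proof (induction W arbitrary: y n)
    case (Cons l W)
    then obtain z where z: "letter_act E l y = Some z" "word_act E W z = Some y'"
      by (auto split: Option.bind_splits)
    have zp: "z \<in> infinite_paths E"
      using letter_act_infinite_path[OF Cons.prems(1) _ z(1)] Cons.prems by simp
    have W: "W \<in> lists (letters E)" using Cons.prems by simp
    have "\<exists>k. int k = int n - letter_degree l \<and> length W \<le> k \<and> (\<forall>i. z (i + k) = y (i + n)) \<and>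
      letter_act E l (graft y n t) = Some (graft z k t)"
    proof (cases "(E, l, y)" rule: letter_act.cases)
      case (1 _ v b y)
      then show ?thesis
        using z Cons.prems by (intro exI[of _ n]) (auto split: if_splits simp: path_range_graft)
    next
      case (2 _ e y)
      then obtain n' where "n = Suc n'" using Cons.prems by (cases n) auto
      then show ?thesis
        using 2 z Cons.prems
        by (intro exI[of _ n']) (auto split: if_splits simp: shift_graft, simp add: graft_def)
    next
      case (3 _ e y)
      then show ?thesis
        using z Cons.prems
        by (intro exI[of _ "Suc n"]) (auto split: if_splits simp: path_range_graft path_cons_graft)
    qed
    then obtain k where k: "int k = int n - letter_degree l" "length W \<le> k"
      "\<And>i. z (i + k) = y (i + n)" "letter_act E l (graft y n t) = Some (graft z k t)" by blast
    have "path_range E t = head E (z k)" using k(3)[of 0] Cons.prems by simp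
    from Cons.IH[OF zp W z(2) k(2) this] obtain m where
      "int m = int k - word_degree W" "\<forall>i. y' (i + m) = z (i + k)" "word_act E W (graft z k t) = Some (graft y' m t)"
      by blast
    then show ?case using k by (intro exI[of _ m]) simp
  qed auto
  then show ?thesis using that by blast
qed

lemma shift_tail_class_self: "x \<in> infinite_paths E \<Longrightarrow> x \<in> shift_tail_class E x"
  by (auto simp: shift_tail_class_def)

lemma shift_tail_class_paths: "y \<in> shift_tail_class E x \<Longrightarrow> y \<in> infinite_paths E"
  by (simp add: shift_tail_class_def)

lemma shift_tail_class_shift:
  assumes "y \<in> shift_tail_class E x" "z \<in> infinite_paths E" "\<And>i. z (i + m) = y (i + n)"
  shows "z \<in> shift_tail_class E x"
proof -
  obtain a b where ab: "\<And>i. x (i + a) = y (i + b)" using assms(1) by (auto simp: shift_tail_class_def)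
  have "x (i + (a + n)) = z (i + (b + m))" for i
    using ab[of "i + n"] assms(3)[of "i + b"] by (simp add: ac_simps)
  then show ?thesis using assms(2) by (auto simp: shift_tail_class_def)
qed

lemma shift_tail_class_word_act:
  assumes "y \<in> shift_tail_class E x" "W \<in> lists (letters E)" "word_act E W y = Some y'"
  shows "y' \<in> shift_tail_class E x"
proof -
  have y: "y \<in> infinite_paths E" using assms(1) by (rule shift_tail_class_paths)
  obtain m where "\<And>i. y' (i + m) = y (i + length W)"
    by (rule word_act_graft[OF y assms(2,3) le_refl, of "\<lambda>i. y (i + length W)"])
      (auto simp: path_range_def)
  then show ?thesis
    using shift_tail_class_shift[OF assms(1) word_act_infinite_path[OF y assms(2,3)]] by blast
qed

section \<open>The representation of the free star-algebra\<close>

text \<open>Restricting to the index set \<open>I\<close> matters at sequences that are not paths but have a path as their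
  shift; there the value has to be 0.\<close>

definition free_rep :: "('v, 'e) pre_digraph \<Rightarrow> (nat \<Rightarrow> 'e) set \<Rightarrow> complex \<Rightarrow> ('v, 'e) free_elem \<Rightarrow>
    ((nat \<Rightarrow> 'e) \<Rightarrow> complex) \<Rightarrow> (nat \<Rightarrow> 'e) \<Rightarrow> complex" where
  "free_rep E I u f \<xi> = (\<lambda>i. \<Sum>W | f W \<noteq> 0. f W * partial_shift I (u powi word_degree W) (word_act E W) \<xi> i)"

lemma free_rep_superset:
  assumes "finite A" "{W. f W \<noteq> 0} \<subseteq> A"
  shows "free_rep E I u f \<xi> i = (\<Sum>W\<in>A. f W * partial_shift I (u powi word_degree W) (word_act E W) \<xi> i)"
  unfolding free_rep_def using assms by (intro sum.mono_neutral_left) auto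

lemma partial_shift_sum:
  "partial_shift I c P (\<lambda>i. \<Sum>a\<in>A. d a * \<xi> a i) i = (\<Sum>a\<in>A. d a * partial_shift I c P (\<xi> a) i)"
  by (auto simp: partial_shift_def sum_distrib_left algebra_simps split: option.splits)

lemma free_rep_sum_vector:
  "free_rep E I u f (\<lambda>i. \<Sum>a\<in>A. d a * \<xi> a i) = (\<lambda>i. \<Sum>a\<in>A. d a * free_rep E I u f (\<xi> a) i)"
  unfolding free_rep_def partial_shift_sum sum_distrib_left
  by (rule ext, subst sum.swap) (simp add: mult.left_commute)

lemma free_rep_add_vector:
  "free_rep E I u f (\<lambda>i. \<xi> i + \<eta> i) = (\<lambda>i. free_rep E I u f \<xi> i + free_rep E I u f \<eta> i)"
  using free_rep_sum_vector[of E I u f "\<lambda>_. 1" "\<lambda>b. if b then \<xi> else \<eta>" UNIV] by (simp add: UNIV_bool add.commute)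

lemma free_rep_scale_vector: "free_rep E I u f (\<lambda>i. c * \<xi> i) = (\<lambda>i. c * free_rep E I u f \<xi> i)"
  using free_rep_sum_vector[of E I u f "\<lambda>_. c" "\<lambda>_. \<xi>" "{()}"] by simp

lemma free_rep_add:
  assumes "f \<in> free_carrier E" "g \<in> free_carrier E"
  shows "free_rep E I u (\<lambda>W. f W + g W) \<xi> i = free_rep E I u f \<xi> i + free_rep E I u g \<xi> i"
proof -
  let ?A = "{W. f W \<noteq> 0} \<union> {W. g W \<noteq> 0}"
  have A: "finite ?A" using assms by (simp add: free_carrier_iff)
  have "{W. f W + g W \<noteq> 0} \<subseteq> ?A" by auto
  then show ?thesis
    by (simp add: free_rep_superset[OF A] sum.distrib distrib_right)
qed

lemma free_rep_scale:
  assumes "f \<in> free_carrier E"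
  shows "free_rep E I u (\<lambda>W. c * f W) \<xi> i = c * free_rep E I u f \<xi> i"
proof -
  have A: "finite {W. f W \<noteq> 0}" using assms by (simp add: free_carrier_iff)
  have "{W. c * f W \<noteq> 0} \<subseteq> {W. f W \<noteq> 0}" by auto
  then show ?thesis
    by (simp add: free_rep_superset[OF A] sum_distrib_left mult.assoc)
qed

lemma free_rep_diff:
  assumes "f \<in> free_carrier E" "g \<in> free_carrier E"
  shows "free_rep E I u (\<lambda>W. f W - g W) \<xi> i = free_rep E I u f \<xi> i - free_rep E I u g \<xi> i"
  using free_rep_add[OF assms(1) free_carrier_scale[OF assms(2), of "-1"]] free_rep_scale[OF assms(2), of I u "-1"]
  by simp

lemma free_rep_sum:
  assumes "finite A" "\<And>a. a \<in> A \<Longrightarrow> f a \<in> free_carrier E"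
  shows "free_rep E I u (\<lambda>W. \<Sum>a\<in>A. d a * f a W) \<xi> i = (\<Sum>a\<in>A. d a * free_rep E I u (f a) \<xi> i)"
  using assms
proof (induction A rule: finite_induct)
  case (insert a A)
  have "free_rep E I u (\<lambda>W. \<Sum>a\<in>insert a A. d a * f a W) \<xi> i =
      free_rep E I u (\<lambda>W. d a * f a W + (\<Sum>a\<in>A. d a * f a W)) \<xi> i"
    using insert by simp
  also have "\<dots> = free_rep E I u (\<lambda>W. d a * f a W) \<xi> i + free_rep E I u (\<lambda>W. \<Sum>a\<in>A. d a * f a W) \<xi> i"
    using insert by (intro free_rep_add free_carrier_sum free_carrier_scale) auto
  finally show ?case using insert by (simp add: free_rep_scale)
qed (simp add: free_rep_def)

lemma free_rep_monomial:
  "free_rep E I u (monomial W) \<xi> = partial_shift I (u powi word_degree W) (word_act E W) \<xi>"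
  by (rule ext, subst free_rep_superset[of "{W}"]) (auto simp: monomial_def)

locale path_space =
  fixes E :: "('v, 'e) pre_digraph" and x :: "nat \<Rightarrow> 'e" and u :: complex
  assumes graph: "row_finite_no_sources E" and path: "x \<in> infinite_paths E" and unit: "cmod u = 1"
begin

abbreviation "I \<equiv> shift_tail_class E x"
abbreviation "rep \<equiv> free_rep E I u"

lemma wf: "wf_digraph E"
  using graph by (simp add: row_finite_no_sources_def)

lemma u_nonzero: "u \<noteq> 0"
  using unit by auto

lemma cnj_power: "cnj (u powi k) = u powi (- k)"
proof -
  have "cnj u = inverse u"
    using unit u_nonzero by (metis complex_norm_square inverse_unique of_real_1 power_one)
  then have "cnj (u powi k) = inverse u powi k"
    by (simp add: power_int_def)
  then show ?thesis by (simp add: power_int_minus power_int_inverse)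
qed

lemma word_act_inj:
  assumes "W \<in> lists (letters E)" "y \<in> I" "z \<in> I" "word_act E W y = Some t" "word_act E W z = Some t"
  shows "y = z"
  using word_act_adj[OF shift_tail_class_paths[OF assms(2)] assms(1,4)]
    word_act_adj[OF shift_tail_class_paths[OF assms(3)] assms(1,5)] by simp

lemma monomial_rep_l2:
  assumes "W \<in> lists (letters E)" "\<xi> \<in> l2 I"
  shows "partial_shift I (u powi word_degree W) (word_act E W) \<xi> \<in> l2 I"
    "l2_norm I (partial_shift I (u powi word_degree W) (word_act E W) \<xi>) \<le> l2_norm I \<xi>"
proof -
  have c: "cmod (u powi word_degree W) = 1" by (simp add: norm_power_int unit)
  have inj: "y = z" if "y \<in> I" "z \<in> I" "word_act E W y = Some t" "word_act E W z = Some t" for y z t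
    using word_act_inj[OF assms(1)] that .
  have into: "z \<in> I" if "y \<in> I" "word_act E W y = Some z" for y z
    using shift_tail_class_word_act[OF that(1) assms(1) that(2)] .
  show "partial_shift I (u powi word_degree W) (word_act E W) \<xi> \<in> l2 I"
    by (rule partial_shift_l2(1)[OF inj into assms(2)])
  show "l2_norm I (partial_shift I (u powi word_degree W) (word_act E W) \<xi>) \<le> l2_norm I \<xi>"
    using partial_shift_l2(2)[where P="word_act E W" and c="u powi word_degree W", OF inj into assms(2)] by (simp add: c)
qed

lemma rep_l2:
  assumes "f \<in> free_carrier E" "\<xi> \<in> l2 I" shows "rep f \<xi> \<in> l2 I"
  unfolding free_rep_def
  using assms by (intro l2_sum l2_scale monomial_rep_l2) (auto simp: free_carrier_iff)

lemma rep_bound: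
  assumes f: "f \<in> free_carrier E" and \<xi>: "\<xi> \<in> l2 I"
  shows "l2_norm I (rep f \<xi>) \<le> (\<Sum>W | f W \<noteq> 0. cmod (f W)) * l2_norm I \<xi>"
proof -
  have W: "W \<in> lists (letters E)" if "f W \<noteq> 0" for W using f that by (auto simp: free_carrier_iff)
  have "l2_norm I (rep f \<xi>) \<le>
    (\<Sum>W | f W \<noteq> 0. l2_norm I (\<lambda>i. f W * partial_shift I (u powi word_degree W) (word_act E W) \<xi> i))"
    unfolding free_rep_def
    using f W \<xi> by (intro l2_sum l2_scale monomial_rep_l2) (auto simp: free_carrier_iff)
  also have "\<dots> \<le> (\<Sum>W | f W \<noteq> 0. cmod (f W) * l2_norm I \<xi>)"
  proof (rule sum_mono)
    fix W assume "W \<in> {W. f W \<noteq> 0}"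
    then show "l2_norm I (\<lambda>i. f W * partial_shift I (u powi word_degree W) (word_act E W) \<xi> i) \<le> cmod (f W) * l2_norm I \<xi>"
      using monomial_rep_l2[OF W \<xi>, of W] by (simp add: l2_scale mult_left_mono)
  qed
  finally show ?thesis by (simp add: sum_distrib_right)
qed

lemma monomial_rep_append:
  assumes V: "V \<in> lists (letters E)"
  shows "partial_shift I (u powi word_degree (V @ W)) (word_act E (V @ W)) \<xi> =
    partial_shift I (u powi word_degree V) (word_act E V)
      (partial_shift I (u powi word_degree W) (word_act E W) \<xi>)"
proof
  fix i
  show "partial_shift I (u powi word_degree (V @ W)) (word_act E (V @ W)) \<xi> i =
    partial_shift I (u powi word_degree V) (word_act E V)
      (partial_shift I (u powi word_degree W) (word_act E W) \<xi>) i"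
    using shift_tail_class_word_act[OF _ V, of i x] u_nonzero
    by (auto simp: partial_shift_def word_act_append power_int_add split: option.splits)
qed

lemma rep_mult:
  assumes f: "f \<in> free_carrier E" and g: "g \<in> free_carrier E"
  shows "rep (sa_mult (free_alg E) f g) \<xi> = rep f (rep g \<xi>)"
proof
  fix i
  let ?F = "{W. f W \<noteq> 0}" and ?G = "{W. g W \<noteq> 0}"
  let ?op = "\<lambda>W. partial_shift I (u powi word_degree W) (word_act E W)"
  have F: "V \<in> lists (letters E) - {[]}" if "V \<in> ?F" for V using f that by (auto simp: free_carrier_iff)
  have fin: "finite ?F" "finite ?G" using f g by (auto simp: free_carrier_iff)
  have G: "V \<in> lists (letters E) - {[]}" if "V \<in> ?G" for V using g that by (auto simp: free_carrier_iff)
  have "sa_mult (free_alg E) f g =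
     sa_mult (free_alg E) (\<lambda>U. \<Sum>V\<in>?F. f V * monomial V U) (\<lambda>U. \<Sum>W\<in>?G. g W * monomial W U)"
    by (subst (1) free_expand[OF fin(1) order_refl], subst (1) free_expand[OF fin(2) order_refl]) simp
  also have "\<dots> = (\<lambda>U. \<Sum>V\<in>?F. f V * (\<Sum>W\<in>?G. g W * monomial (V @ W) U))"
    unfolding free_mult_sum_left free_mult_sum_right monomial_mult ..
  finally have mult: "sa_mult (free_alg E) f g = (\<lambda>U. \<Sum>V\<in>?F. f V * (\<Sum>W\<in>?G. g W * monomial (V @ W) U))" .
  have VW: "monomial (V @ W) \<in> free_carrier E" if "V \<in> ?F" "W \<in> ?G" for V W
    using F[OF that(1)] G[OF that(2)] by (intro monomial_in) auto
  have "rep (sa_mult (free_alg E) f g) \<xi> i = (\<Sum>V\<in>?F. f V * rep (\<lambda>U. \<Sum>W\<in>?G. g W * monomial (V @ W) U) \<xi> i)"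
    unfolding mult using VW fin by (intro free_rep_sum free_carrier_sum free_carrier_scale)
  also have "\<dots> = (\<Sum>V\<in>?F. f V * (\<Sum>W\<in>?G. g W * rep (monomial (V @ W)) \<xi> i))"
  proof (rule sum.cong[OF refl])
    fix V assume "V \<in> ?F"
    then have "rep (\<lambda>U. \<Sum>W\<in>?G. g W * monomial (V @ W) U) \<xi> i = (\<Sum>W\<in>?G. g W * rep (monomial (V @ W)) \<xi> i)"
      using VW fin by (intro free_rep_sum)
    then show "f V * rep (\<lambda>U. \<Sum>W\<in>?G. g W * monomial (V @ W) U) \<xi> i
      = f V * (\<Sum>W\<in>?G. g W * rep (monomial (V @ W)) \<xi> i)" by (rule arg_cong)
  qed
  also have "\<dots> = (\<Sum>V\<in>?F. f V * (\<Sum>W\<in>?G. g W * ?op V (?op W \<xi>) i))"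
  proof (intro sum.cong refl)
    fix V assume "V \<in> ?F"
    then show "f V * (\<Sum>W\<in>?G. g W * rep (monomial (V @ W)) \<xi> i) = f V * (\<Sum>W\<in>?G. g W * ?op V (?op W \<xi>) i)"
      using F[of V] monomial_rep_append[of V] by (simp add: free_rep_monomial)
  qed
  also have "\<dots> = rep f (rep g \<xi>) i"
    unfolding free_rep_def[of E I u g] free_rep_def[of E I u f] partial_shift_sum by simp
  finally show "rep (sa_mult (free_alg E) f g) \<xi> i = rep f (rep g \<xi>) i" .
qed

lemma monomial_rep_adjoint:
  assumes W: "W \<in> lists (letters E)"
  shows "l2_inner I (rep (monomial (adj_word W)) \<xi>) \<eta> = l2_inner I \<xi> (rep (monomial W) \<eta>)"
proof -
  have inv: "z \<in> I \<and> word_act E (adj_word V) z = Some y"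
    if "V \<in> lists (letters E)" "y \<in> I" "word_act E V y = Some z" for V y z
    using that shift_tail_class_word_act word_act_adj shift_tail_class_paths by metis
  show ?thesis
    unfolding free_rep_monomial word_degree_adj cnj_power[symmetric]
  proof (rule partial_shift_adjoint)
    show "j \<in> I \<and> word_act E W j = Some i" if "i \<in> I" "word_act E (adj_word W) i = Some j" for i j
      using inv[of "adj_word W" i j] that W by simp
  qed (use inv W in auto)
qed

lemma rep_adjoint:
  assumes f: "f \<in> free_carrier E" and \<xi>: "\<xi> \<in> l2 I" and \<eta>: "\<eta> \<in> l2 I"
  shows "l2_inner I (rep (\<lambda>W. cnj (f (adj_word W))) \<xi>) \<eta> = l2_inner I \<xi> (rep f \<eta>)"
proof -
  let ?F = "{W. f W \<noteq> 0}"
  have fin: "finite ?F" using f by (simp add: free_carrier_iff)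
  have F: "W \<in> lists (letters E)" "W \<noteq> []" if "W \<in> ?F" for W using f that by (auto simp: free_carrier_iff)
  have star: "(\<lambda>W. cnj (f (adj_word W))) = (\<lambda>V. \<Sum>W\<in>?F. cnj (f W) * monomial (adj_word W) V)"
  proof
    fix V
    show "cnj (f (adj_word V)) = (\<Sum>W\<in>?F. cnj (f W) * monomial (adj_word W) V)"
      by (subst free_expand[OF fin order_refl], subst (1) cnj_sum)
        (auto simp: monomial_def adj_word_eq_iff intro!: sum.cong)
  qed
  have r: "rep (monomial W) \<eta> \<in> l2 I" "rep (monomial (adj_word W)) \<xi> \<in> l2 I" if "W \<in> ?F" for W
    using F[OF that] \<xi> \<eta> by (intro rep_l2 monomial_in; simp del: in_lists_conv_set)+
  have "l2_inner I (rep (\<lambda>W. cnj (f (adj_word W))) \<xi>) \<eta>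
      = cnj (l2_inner I \<eta> (\<lambda>i. \<Sum>W\<in>?F. cnj (f W) * rep (monomial (adj_word W)) \<xi> i))"
  proof -
    have "rep (\<lambda>V. \<Sum>W\<in>?F. cnj (f W) * monomial (adj_word W) V) \<xi>
        = (\<lambda>i. \<Sum>W\<in>?F. cnj (f W) * rep (monomial (adj_word W)) \<xi> i)"
      using fin F by (intro ext free_rep_sum monomial_in) (simp_all del: in_lists_conv_set)
    then show ?thesis by (simp only: star l2_inner_cnj)
  qed
  also have "\<dots> = cnj (\<Sum>W\<in>?F. cnj (f W) * l2_inner I \<eta> (rep (monomial (adj_word W)) \<xi>))"
    using fin r \<eta> by (subst l2_inner_sum_right) auto
  also have "\<dots> = (\<Sum>W\<in>?F. f W * l2_inner I (rep (monomial (adj_word W)) \<xi>) \<eta>)"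
    by (simp add: l2_inner_cnj)
  also have "\<dots> = (\<Sum>W\<in>?F. f W * l2_inner I \<xi> (rep (monomial W) \<eta>))"
    using F by (intro sum.cong) (auto simp: monomial_rep_adjoint)
  also have "\<dots> = l2_inner I \<xi> (\<lambda>i. \<Sum>W\<in>?F. f W * rep (monomial W) \<eta> i)"
    using fin r \<xi> by (subst l2_inner_sum_right) auto
  also have "(\<lambda>i. \<Sum>W\<in>?F. f W * rep (monomial W) \<eta> i) = rep f \<eta>"
    unfolding free_rep_monomial free_rep_def[of E I u f] ..
  finally show ?thesis .
qed

lemma monomial_rep_cong:
  assumes "\<And>y. y \<in> I \<Longrightarrow> word_act E V y = word_act E W y" "word_degree V = word_degree W"
  shows "rep (monomial V) \<xi> = rep (monomial W) \<xi>"
  using assms by (auto simp: free_rep_monomial partial_shift_def fun_eq_iff)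

text \<open>For the last relation: a path with range \<open>v\<close> starts with exactly one edge \<open>e\<close> such that
  \<open>r(e) = v\<close>, and \<open>s\<^sub>e s\<^sub>e\<^sup>*\<close> projects to the paths starting with \<open>e\<close>.\<close>

lemma rep_relations:
  assumes "g \<in> graph_relations E"
  shows "g \<in> free_carrier E \<and> (\<forall>\<xi>. rep g \<xi> = (\<lambda>_. 0))"
proof -
  have adj: "adj_word [(a, False)] = [(a, True)]" for a :: "('v, 'e) generator" by (simp add: adj_word_def)
  have t: "tail E e \<in> verts E" if "e \<in> arcs E" for e using wf that by (simp add: wf_digraph_def)
  have diff: "(\<lambda>U. monomial V U - monomial W U) \<in> free_carrier E \<and>
      (\<forall>\<xi>. rep (\<lambda>U. monomial V U - monomial W U) \<xi> = (\<lambda>_. 0))"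
    if "V \<in> lists (letters E)" "W \<in> lists (letters E)" "V \<noteq> []" "W \<noteq> []"
      "\<And>y. y \<in> infinite_paths E \<Longrightarrow> word_act E V y = word_act E W y" "word_degree V = word_degree W" for V W
  proof -
    have "rep (monomial V) \<xi> = rep (monomial W) \<xi>" for \<xi>
      using that(5,6) shift_tail_class_paths by (intro monomial_rep_cong) auto
    moreover have "monomial V \<in> free_carrier E" "monomial W \<in> free_carrier E"
      using that by (auto intro: monomial_in)
    ultimately show ?thesis by (simp add: free_rep_diff fun_eq_iff)
  qed
  have next_range: "path_range E (\<lambda>i. y (Suc i)) = tail E (y 0)" if "y \<in> infinite_paths E" for y
    using that by (auto simp: infinite_paths_def path_range_def)
  let ?p = "\<lambda>v. [(Vert v, False)] :: ('v, 'e) letter list"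
  let ?s = "\<lambda>e. [(Edge e, False)] :: ('v, 'e) letter list"
  let ?t = "\<lambda>e. [(Edge e, True)] :: ('v, 'e) letter list"
  from assms consider
      v where "v \<in> verts E" "g = (\<lambda>U. monomial (?p v @ ?p v) U - monomial (?p v) U)"
    | v where "v \<in> verts E" "g = (\<lambda>U. monomial [(Vert v, True)] U - monomial (?p v) U)"
    | v w where "v \<in> verts E" "w \<in> verts E" "v \<noteq> w" "g = monomial (?p v @ ?p w)"
    | e where "e \<in> arcs E" "g = (\<lambda>U. monomial (?s e @ ?t e @ ?s e) U - monomial (?s e) U)"
    | e where "e \<in> arcs E" "g = (\<lambda>U. monomial (?t e @ ?s e) U - monomial (?p (tail E e)) U)"
    | v where "v \<in> verts E" "g = (\<lambda>U. monomial (?p v) U - (\<Sum>e | e \<in> arcs E \<and> head E e = v. 1 * monomial (?s e @ ?t e) U))"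
    unfolding graph_relations_def Let_def free_gen_monomial monomial_star adj monomial_mult free_alg_simps(4)
    by auto
  then show ?thesis
  proof cases
    case 1
    then show ?thesis by (simp only:) (rule diff, auto)
  next
    case 2
    then show ?thesis by (simp only:) (rule diff, auto)
  next
    case 3
    then have "rep g \<xi> = (\<lambda>_. 0)" for \<xi>
      unfolding 3(4) free_rep_monomial by (auto simp: partial_shift_def fun_eq_iff)
    then show ?thesis using 3 by auto
  next
    case 4
    then show ?thesis by (simp only:) (rule diff, auto simp: next_range path_cons_shift)
  next
    case 5
    then show ?thesis by (simp only:) (rule diff, auto simp: t)
  next
    case 6
    let ?D = "{e \<in> arcs E. head E e = v}"
    have fin: "finite ?D" using 6 graph by (simp add: row_finite_no_sources_def)
    have st: "monomial (?s e @ ?t e) \<in> free_carrier E" if "e \<in> ?D" for e using that by auto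
    have p: "monomial (?p v) \<in> free_carrier E" using 6 by auto
    have sum_in: "(\<lambda>U. \<Sum>e\<in>?D. 1 * monomial (?s e @ ?t e) U) \<in> free_carrier E"
      by (rule free_carrier_sum[OF fin]) (rule free_carrier_scale[OF st])
    have "rep (monomial (?p v)) \<xi> i = (\<Sum>e\<in>?D. 1 * rep (monomial (?s e @ ?t e)) \<xi> i)" for \<xi> i
    proof (cases "i \<in> I")
      case True
      then have i: "i \<in> infinite_paths E" by (rule shift_tail_class_paths)
      have "rep (monomial (?s e @ ?t e)) \<xi> i = (if i 0 = e then \<xi> i else 0)" for e
        using True i by (auto simp: free_rep_monomial partial_shift_def next_range path_cons_shift)
      moreover have "rep (monomial (?p v)) \<xi> i = (if head E (i 0) = v then \<xi> i else 0)"
        using True by (simp add: free_rep_monomial partial_shift_def path_range_def)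
      moreover have "i 0 \<in> arcs E" using i by (simp add: infinite_paths_def)
      ultimately show ?thesis using fin by simp
    qed (simp add: free_rep_monomial partial_shift_def)
    note p_eq = this
    have "rep g \<xi> = (\<lambda>_. 0)" for \<xi>
    proof (rule ext)
      fix i
      have "rep (\<lambda>U. \<Sum>e\<in>?D. 1 * monomial (?s e @ ?t e) U) \<xi> i = (\<Sum>e\<in>?D. 1 * rep (monomial (?s e @ ?t e)) \<xi> i)"
        by (rule free_rep_sum[OF fin st])
      then show "rep g \<xi> i = 0"
        unfolding 6(2) free_rep_diff[OF p sum_in] p_eq by (simp only: diff_self)
    qed
    then show ?thesis using 6(2) p sum_in by simp
  qed
qed

text \<open>The operator norm is one of the seminorms in the supremum that defines the universal one, which
  makes the representation contractive and lets it extend to the completion.\<close>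

definition op_seminorm :: "('v, 'e) free_elem \<Rightarrow> real" where
  "op_seminorm f = (SUP \<xi>\<in>{\<xi>\<in>l2 I. l2_norm I \<xi> \<le> 1}. l2_norm I (rep f \<xi>))"

lemma
  assumes "f \<in> free_carrier E"
  shows op_seminorm_nonneg: "0 \<le> op_seminorm f"
    and op_seminorm_bound: "\<xi> \<in> l2 I \<Longrightarrow> l2_norm I (rep f \<xi>) \<le> op_seminorm f * l2_norm I \<xi>"
proof -
  let ?C = "\<Sum>W | f W \<noteq> 0. cmod (f W)"
  have C: "0 \<le> ?C" by (simp add: sum_nonneg)
  have "bdd_above ((\<lambda>\<xi>. l2_norm I (rep f \<xi>)) ` {\<xi>\<in>l2 I. l2_norm I \<xi> \<le> 1})"
  proof (rule bdd_aboveI2)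
    fix \<xi> assume "\<xi> \<in> {\<xi>\<in>l2 I. l2_norm I \<xi> \<le> 1}"
    then show "l2_norm I (rep f \<xi>) \<le> ?C"
      using rep_bound[OF assms, of \<xi>] mult_left_mono[OF _ C, of "l2_norm I \<xi>" 1] by simp
  qed
  then have up: "l2_norm I (rep f \<xi>) \<le> op_seminorm f" if "\<xi> \<in> l2 I" "l2_norm I \<xi> \<le> 1" for \<xi>
    unfolding op_seminorm_def using that by (intro cSUP_upper) auto
  show "0 \<le> op_seminorm f" using up[OF l2_0] l2_norm_0 l2_norm_nonneg order_trans by (metis zero_le_one)
  assume \<xi>: "\<xi> \<in> l2 I"
  show "l2_norm I (rep f \<xi>) \<le> op_seminorm f * l2_norm I \<xi>"
  proof (cases "l2_norm I \<xi> = 0")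
    case True
    then show ?thesis using rep_bound[OF assms \<xi>] by simp
  next
    case False
    then have pos: "0 < l2_norm I \<xi>" by (simp add: less_le)
    let ?c = "complex_of_real (1 / l2_norm I \<xi>)"
    have "l2_norm I (\<lambda>i. ?c * \<xi> i) \<le> 1" using pos unfolding l2_scale(2)[OF \<xi>] by (simp add: norm_divide)
    then have "l2_norm I (rep f (\<lambda>i. ?c * \<xi> i)) \<le> op_seminorm f" using \<xi> by (intro up l2_scale)
    also have "l2_norm I (rep f (\<lambda>i. ?c * \<xi> i)) = l2_norm I (rep f \<xi>) / l2_norm I \<xi>"
      unfolding free_rep_scale_vector l2_scale(2)[OF rep_l2[OF assms \<xi>]] using pos by (simp add: norm_divide)
    finally show ?thesis using pos by (simp add: field_simps)
  qed
qed

lemma op_seminorm_least: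
  assumes "0 \<le> C" "\<And>\<xi>. \<xi> \<in> l2 I \<Longrightarrow> l2_norm I (rep f \<xi>) \<le> C * l2_norm I \<xi>"
  shows "op_seminorm f \<le> C"
  unfolding op_seminorm_def
proof (rule cSUP_least)
  show "{\<xi>\<in>l2 I. l2_norm I \<xi> \<le> 1} \<noteq> {}" using l2_0 l2_norm_0 by (metis (mono_tags, lifting) empty_iff mem_Collect_eq zero_le_one)
  fix \<xi> assume "\<xi> \<in> {\<xi>\<in>l2 I. l2_norm I \<xi> \<le> 1}"
  then show "l2_norm I (rep f \<xi>) \<le> C"
    using assms(2)[of \<xi>] mult_left_mono[OF _ assms(1), of "l2_norm I \<xi>" 1] by simp
qed

lemma op_seminorm_scale_le:
  assumes "f \<in> free_carrier E" shows "op_seminorm (\<lambda>W. c * f W) \<le> cmod c * op_seminorm f"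
proof (rule op_seminorm_least)
  fix \<xi> assume \<xi>: "\<xi> \<in> l2 I"
  have "rep (\<lambda>W. c * f W) \<xi> = (\<lambda>i. c * rep f \<xi> i)" using assms by (simp add: fun_eq_iff free_rep_scale)
  then have "l2_norm I (rep (\<lambda>W. c * f W) \<xi>) = cmod c * l2_norm I (rep f \<xi>)"
    using l2_scale(2)[OF rep_l2[OF assms \<xi>]] by simp
  then show "l2_norm I (rep (\<lambda>W. c * f W) \<xi>) \<le> cmod c * op_seminorm f * l2_norm I \<xi>"
    using op_seminorm_bound[OF assms \<xi>] by (simp add: mult_left_mono mult.assoc)
qed (simp add: op_seminorm_nonneg assms)

lemma op_seminorm_mult:
  assumes f: "f \<in> free_carrier E" and g: "g \<in> free_carrier E"
  shows "op_seminorm (sa_mult (free_alg E) f g) \<le> op_seminorm f * op_seminorm g"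
proof (rule op_seminorm_least)
  fix \<xi> assume \<xi>: "\<xi> \<in> l2 I"
  have "l2_norm I (rep (sa_mult (free_alg E) f g) \<xi>) \<le> op_seminorm f * l2_norm I (rep g \<xi>)"
    unfolding rep_mult[OF f g] using f g \<xi> by (intro op_seminorm_bound rep_l2)
  also have "\<dots> \<le> op_seminorm f * (op_seminorm g * l2_norm I \<xi>)"
    using f g \<xi> by (intro mult_left_mono op_seminorm_bound op_seminorm_nonneg)
  finally show "l2_norm I (rep (sa_mult (free_alg E) f g) \<xi>) \<le> op_seminorm f * op_seminorm g * l2_norm I \<xi>"
    by (simp add: mult.assoc)
qed (simp add: op_seminorm_nonneg f g)

lemma op_seminorm_star_mult:
  assumes f: "f \<in> free_carrier E"
  shows "(op_seminorm f)\<^sup>2 \<le> op_seminorm (sa_mult (free_alg E) (sa_star (free_alg E) f) f)"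
proof -
  let ?g = "sa_mult (free_alg E) (sa_star (free_alg E) f) f"
  have g: "?g \<in> free_carrier E" using f by simp
  have "op_seminorm f \<le> sqrt (op_seminorm ?g)"
  proof (rule op_seminorm_least)
    fix \<xi> assume \<xi>: "\<xi> \<in> l2 I"
    have "complex_of_real ((l2_norm I (rep f \<xi>))\<^sup>2) = l2_inner I (rep f \<xi>) (rep f \<xi>)"
      by (simp add: l2_inner_self rep_l2[OF f \<xi>])
    also have "\<dots> = l2_inner I (rep ?g \<xi>) \<xi>"
      using rep_adjoint[OF f rep_l2[OF f \<xi>] \<xi>] rep_mult[OF free_carrier_star[OF f] f] by simp
    finally have "(l2_norm I (rep f \<xi>))\<^sup>2 = cmod (l2_inner I (rep ?g \<xi>) \<xi>)"
      by (metis abs_of_nonneg norm_of_real zero_le_power2)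
    also have "\<dots> \<le> l2_norm I (rep ?g \<xi>) * l2_norm I \<xi>"
      by (intro l2_cauchy_schwarz rep_l2 g \<xi>)
    also have "\<dots> \<le> (op_seminorm ?g * l2_norm I \<xi>) * l2_norm I \<xi>"
      using op_seminorm_bound[OF g \<xi>] by (intro mult_right_mono) auto
    also have "\<dots> = (sqrt (op_seminorm ?g))\<^sup>2 * (l2_norm I \<xi>)\<^sup>2"
      using op_seminorm_nonneg[OF g] by (simp only: real_sqrt_pow2 power2_eq_square[of "l2_norm I \<xi>"] mult.assoc)
    finally have "(l2_norm I (rep f \<xi>))\<^sup>2 \<le> (sqrt (op_seminorm ?g) * l2_norm I \<xi>)\<^sup>2"
      by (simp only: power_mult_distrib)
    then show "l2_norm I (rep f \<xi>) \<le> sqrt (op_seminorm ?g) * l2_norm I \<xi>"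
      by (rule power2_le_imp_le) (intro mult_nonneg_nonneg real_sqrt_ge_zero op_seminorm_nonneg[OF g] l2_norm_nonneg)
  qed (use op_seminorm_nonneg[OF g] in simp)
  then have "(op_seminorm f)\<^sup>2 \<le> (sqrt (op_seminorm ?g))\<^sup>2"
    using op_seminorm_nonneg[OF f] by (intro power_mono)
  then show ?thesis using op_seminorm_nonneg[OF g] by simp
qed

lemma graph_seminorm_op: "graph_seminorm E op_seminorm"
proof -
  have add: "op_seminorm (\<lambda>W. f W + g W) \<le> op_seminorm f + op_seminorm g"
    if f: "f \<in> free_carrier E" and g: "g \<in> free_carrier E" for f g
  proof (rule op_seminorm_least)
    fix \<xi> assume \<xi>: "\<xi> \<in> l2 I"
    have "rep (\<lambda>W. f W + g W) \<xi> = (\<lambda>i. rep f \<xi> i + rep g \<xi> i)" using f g by (simp add: fun_eq_iff free_rep_add)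
    then show "l2_norm I (rep (\<lambda>W. f W + g W) \<xi>) \<le> (op_seminorm f + op_seminorm g) * l2_norm I \<xi>"
      using l2_add(2)[OF rep_l2[OF f \<xi>] rep_l2[OF g \<xi>]] op_seminorm_bound[OF f \<xi>] op_seminorm_bound[OF g \<xi>]
      by (simp add: distrib_right)
  qed (simp add: op_seminorm_nonneg f g)
  have scale: "op_seminorm (\<lambda>W. c * f W) = cmod c * op_seminorm f" if f: "f \<in> free_carrier E" for c f
  proof (cases "c = 0")
    case True
    then show ?thesis using op_seminorm_scale_le[OF f, of 0] op_seminorm_nonneg[OF free_carrier_0] by simp
  next
    case False
    have "op_seminorm f = op_seminorm (\<lambda>W. inverse c * (c * f W))" using False by (simp add: mult.assoc[symmetric])
    also have "\<dots> \<le> cmod (inverse c) * op_seminorm (\<lambda>W. c * f W)" using f by (intro op_seminorm_scale_le) simp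
    finally have "cmod c * op_seminorm f \<le> op_seminorm (\<lambda>W. c * f W)"
      using False by (simp add: norm_divide inverse_eq_divide field_simps)
    then show ?thesis using op_seminorm_scale_le[OF f, of c] by simp
  qed
  have star_le: "op_seminorm f \<le> op_seminorm (sa_star (free_alg E) f)" if f: "f \<in> free_carrier E" for f
  proof (cases "op_seminorm f = 0")
    case False
    then have "0 < op_seminorm f" using op_seminorm_nonneg[OF f] by simp
    moreover have "op_seminorm f * op_seminorm f \<le> op_seminorm (sa_star (free_alg E) f) * op_seminorm f"
      using op_seminorm_star_mult[OF f] op_seminorm_mult[OF free_carrier_star[OF f] f]
      by (simp add: power2_eq_square)
    ultimately show ?thesis by simp
  qed (use op_seminorm_nonneg f in simp)
  have star: "op_seminorm (sa_mult (free_alg E) (sa_star (free_alg E) f) f) = (op_seminorm f)\<^sup>2"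
    if f: "f \<in> free_carrier E" for f
  proof (rule antisym)
    have "op_seminorm (sa_star (free_alg E) f) \<le> op_seminorm f"
      using star_le[of "sa_star (free_alg E) f"] f by simp
    then have "op_seminorm (sa_star (free_alg E) f) * op_seminorm f \<le> op_seminorm f * op_seminorm f"
      using op_seminorm_nonneg[OF f] by (rule mult_right_mono)
    then show "op_seminorm (sa_mult (free_alg E) (sa_star (free_alg E) f) f) \<le> (op_seminorm f)\<^sup>2"
      using op_seminorm_mult[of "sa_star (free_alg E) f" f] f by (simp add: power2_eq_square)
  qed (rule op_seminorm_star_mult[OF f])
  have "op_seminorm g = 0" if "g \<in> graph_relations E" for g
  proof (rule antisym)
    show "op_seminorm g \<le> 0"
      using rep_relations[OF that] by (intro op_seminorm_least) (auto simp: l2_norm_0)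
  qed (use rep_relations[OF that] op_seminorm_nonneg in blast)
  then show ?thesis
    unfolding graph_seminorm_def cstar_seminorm_def
    using op_seminorm_nonneg add scale op_seminorm_mult star by simp
qed

lemma rep_contractive:
  assumes f: "f \<in> free_carrier E" and \<xi>: "\<xi> \<in> l2 I"
  shows "l2_norm I (rep f \<xi>) \<le> universal_seminorm E f * l2_norm I \<xi>"
  using order_trans[OF op_seminorm_bound[OF f \<xi>]
      mult_right_mono[OF graph_seminorm_le_universal[OF wf graph_seminorm_op f] l2_norm_nonneg]] .

end

section \<open>Hausdorff completion of the free star-algebra\<close>

context
  fixes E :: "('v, 'e) pre_digraph" and \<rho>
  assumes \<rho>: "cstar_seminorm (free_alg E) \<rho>"
begin

abbreviation (input) "F \<equiv> free_alg E"

lemma cauchy_seqs_carrier: "X \<in> cauchy_seqs F \<rho> \<Longrightarrow> X k \<in> free_carrier E"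
  by (simp add: cauchy_seqs_def)

lemma cauchy_seqs_small:
  "X \<in> cauchy_seqs F \<rho> \<Longrightarrow> 0 < \<epsilon> \<Longrightarrow> \<exists>N. \<forall>j\<ge>N. \<forall>k\<ge>N. \<rho> (\<lambda>W. X j W - X k W) < \<epsilon>"
  by (simp add: cauchy_seqs_def)

lemma cauchy_seqs_const: "f \<in> free_carrier E \<Longrightarrow> (\<lambda>_. f) \<in> cauchy_seqs F \<rho>"
  by (simp add: cauchy_seqs_def seminorm_0[OF \<rho>])

text \<open>The algebra operations are Lipschitz on the bounded sets in which Cauchy sequences live, so one
  criterion serves for all of them.\<close>

lemma cauchy_seqsI:
  assumes Z: "\<And>k. Z k \<in> free_carrier E" and X: "X \<in> cauchy_seqs F \<rho>" and Y: "Y \<in> cauchy_seqs F \<rho>"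
    and C: "\<And>j k. \<rho> (\<lambda>W. Z j W - Z k W) \<le> C * (\<rho> (\<lambda>W. X j W - X k W) + \<rho> (\<lambda>W. Y j W - Y k W))" "0 \<le> C"
  shows "Z \<in> cauchy_seqs F \<rho>"
  unfolding cauchy_seqs_def
proof (clarsimp simp: Z)
  fix \<epsilon> :: real assume "0 < \<epsilon>"
  then have e: "0 < \<epsilon> / (2 * (C + 1))" using C(2) by simp
  obtain M where M: "\<And>j k. j \<ge> M \<Longrightarrow> k \<ge> M \<Longrightarrow> \<rho> (\<lambda>W. X j W - X k W) < \<epsilon> / (2 * (C + 1))"
    using cauchy_seqs_small[OF X e] by blast
  obtain N where N: "\<And>j k. j \<ge> N \<Longrightarrow> k \<ge> N \<Longrightarrow> \<rho> (\<lambda>W. Y j W - Y k W) < \<epsilon> / (2 * (C + 1))"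
    using cauchy_seqs_small[OF Y e] by blast
  show "\<exists>N. \<forall>j\<ge>N. \<forall>k\<ge>N. \<rho> (\<lambda>W. Z j W - Z k W) < \<epsilon>"
  proof (intro exI allI impI)
    fix j k assume "max M N \<le> j" "max M N \<le> k"
    moreover have "\<epsilon> / (C + 1) = \<epsilon> / (2 * (C + 1)) + \<epsilon> / (2 * (C + 1))"
      using C(2) by (simp add: divide_simps)
    ultimately have "\<rho> (\<lambda>W. X j W - X k W) + \<rho> (\<lambda>W. Y j W - Y k W) \<le> \<epsilon> / (C + 1)"
      using M[of j k] N[of j k] by simp
    then have "\<rho> (\<lambda>W. Z j W - Z k W) \<le> C * (\<epsilon> / (C + 1))"
      using C(1)[of j k] C(2) by (meson mult_left_mono order_trans)
    also have "\<dots> < \<epsilon>" using C(2) \<open>0 < \<epsilon>\<close> by (simp add: field_simps)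
    finally show "\<rho> (\<lambda>W. Z j W - Z k W) < \<epsilon>" .
  qed
qed

lemma cauchy_seqs_norm_convergent:
  assumes X: "X \<in> cauchy_seqs F \<rho>" shows "convergent (\<lambda>k. \<rho> (X k))"
proof -
  have "Cauchy (\<lambda>k. \<rho> (X k))"
    unfolding Cauchy_def dist_real_def
  proof (intro allI impI)
    fix \<epsilon> :: real assume "0 < \<epsilon>"
    then obtain N where "\<And>j k. j \<ge> N \<Longrightarrow> k \<ge> N \<Longrightarrow> \<rho> (\<lambda>W. X j W - X k W) < \<epsilon>"
      using cauchy_seqs_small[OF X] by blast
    then show "\<exists>M. \<forall>m\<ge>M. \<forall>n\<ge>M. \<bar>\<rho> (X m) - \<rho> (X n)\<bar> < \<epsilon>"
      using seminorm_abs_diff[OF \<rho> cauchy_seqs_carrier[OF X] cauchy_seqs_carrier[OF X]] order_le_less_trans by blast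
  qed
  then show ?thesis by (simp add: Cauchy_convergent_iff)
qed

lemma cauchy_seqs_bounded:
  assumes X: "X \<in> cauchy_seqs F \<rho>" obtains B where "\<And>k. \<rho> (X k) \<le> B" "0 \<le> B"
proof -
  have "Bseq (\<lambda>k. \<rho> (X k))"
    using cauchy_seqs_norm_convergent[OF X] convergent_imp_Bseq by blast
  then obtain B where "\<And>k. \<bar>\<rho> (X k)\<bar> \<le> B" "0 < B" by (auto simp: Bseq_def)
  then show ?thesis using that[of B] by (auto simp: abs_le_iff)
qed

lemma cauchy_seqs_add:
  assumes X: "X \<in> cauchy_seqs F \<rho>" and Y: "Y \<in> cauchy_seqs F \<rho>"
  shows "(\<lambda>k. sa_add F (X k) (Y k)) \<in> cauchy_seqs F \<rho>"
proof (rule cauchy_seqsI[OF _ X Y, of _ 1])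
  note [simp] = cauchy_seqs_carrier[OF X] cauchy_seqs_carrier[OF Y]
  show "\<rho> (\<lambda>W. sa_add F (X j) (Y j) W - sa_add F (X k) (Y k) W) \<le> 1 * (\<rho> (\<lambda>W. X j W - X k W) + \<rho> (\<lambda>W. Y j W - Y k W))" for j k
    using seminorm_add[OF \<rho>, of "\<lambda>W. X j W - X k W" "\<lambda>W. Y j W - Y k W"] by (simp add: algebra_simps)
qed (simp_all add: cauchy_seqs_carrier[OF X] cauchy_seqs_carrier[OF Y])

lemma cauchy_seqs_scale:
  assumes X: "X \<in> cauchy_seqs F \<rho>" shows "(\<lambda>k. sa_scale F c (X k)) \<in> cauchy_seqs F \<rho>"
proof (rule cauchy_seqsI[OF _ X X, of _ "cmod c"])
  note [simp] = cauchy_seqs_carrier[OF X]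
  show "\<rho> (\<lambda>W. sa_scale F c (X j) W - sa_scale F c (X k) W) \<le> cmod c * (\<rho> (\<lambda>W. X j W - X k W) + \<rho> (\<lambda>W. X j W - X k W))" for j k
    using seminorm_scale[OF \<rho>, of "\<lambda>W. X j W - X k W" c] seminorm_nonneg[OF \<rho>, of "\<lambda>W. X j W - X k W"]
    by (simp add: right_diff_distrib mult_left_mono)
qed (simp_all add: cauchy_seqs_carrier[OF X])

lemma cauchy_seqs_star:
  assumes X: "X \<in> cauchy_seqs F \<rho>" shows "(\<lambda>k. sa_star F (X k)) \<in> cauchy_seqs F \<rho>"
proof (rule cauchy_seqsI[OF _ X X, of _ 1])
  note [simp] = cauchy_seqs_carrier[OF X]
  show "\<rho> (\<lambda>W. sa_star F (X j) W - sa_star F (X k) W) \<le> 1 * (\<rho> (\<lambda>W. X j W - X k W) + \<rho> (\<lambda>W. X j W - X k W))" for j k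
    using seminorm_star[OF \<rho>, of "\<lambda>W. X j W - X k W"] seminorm_nonneg[OF \<rho>, of "\<lambda>W. X j W - X k W"] by simp
qed (simp_all add: cauchy_seqs_carrier[OF X])

lemma seminorm_mult_diff:
  assumes "f \<in> free_carrier E" "g \<in> free_carrier E" "f' \<in> free_carrier E" "g' \<in> free_carrier E"
  shows "\<rho> (\<lambda>W. sa_mult F f g W - sa_mult F f' g' W)
    \<le> \<rho> f * \<rho> (\<lambda>W. g W - g' W) + \<rho> (\<lambda>W. f W - f' W) * \<rho> g'"
proof -
  have "(\<lambda>W. sa_mult F f g W - sa_mult F f' g' W) =
    (\<lambda>W. sa_mult F f (\<lambda>W. g W - g' W) W + sa_mult F (\<lambda>W. f W - f' W) g' W)"
    by (simp add: free_mult_diff_left free_mult_diff_right)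
  then show ?thesis
    using seminorm_add[OF \<rho>, of "sa_mult F f (\<lambda>W. g W - g' W)" "sa_mult F (\<lambda>W. f W - f' W) g'"]
      seminorm_mult[OF \<rho>, of f "\<lambda>W. g W - g' W"] seminorm_mult[OF \<rho>, of "\<lambda>W. f W - f' W" g'] assms
    by simp
qed

lemma cauchy_seqs_mult:
  assumes X: "X \<in> cauchy_seqs F \<rho>" and Y: "Y \<in> cauchy_seqs F \<rho>"
  shows "(\<lambda>k. sa_mult F (X k) (Y k)) \<in> cauchy_seqs F \<rho>"
proof -
  note [simp] = cauchy_seqs_carrier[OF X] cauchy_seqs_carrier[OF Y]
  obtain A where A: "\<And>k. \<rho> (X k) \<le> A" "0 \<le> A" using cauchy_seqs_bounded[OF X] by blast
  obtain B where B: "\<And>k. \<rho> (Y k) \<le> B" "0 \<le> B" using cauchy_seqs_bounded[OF Y] by blast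
  show ?thesis
  proof (rule cauchy_seqsI[OF _ X Y, of _ "A + B"])
    fix j k
    have n: "0 \<le> \<rho> (\<lambda>W. X j W - X k W)" "0 \<le> \<rho> (\<lambda>W. Y j W - Y k W)" by (auto intro!: seminorm_nonneg[OF \<rho>])
    have "\<rho> (\<lambda>W. sa_mult F (X j) (Y j) W - sa_mult F (X k) (Y k) W)
        \<le> \<rho> (X j) * \<rho> (\<lambda>W. Y j W - Y k W) + \<rho> (\<lambda>W. X j W - X k W) * \<rho> (Y k)"
      by (rule seminorm_mult_diff) auto
    also have "\<dots> \<le> (A + B) * \<rho> (\<lambda>W. Y j W - Y k W) + \<rho> (\<lambda>W. X j W - X k W) * (A + B)"
      using A(1)[of j] B(1)[of k] A(2) B(2) n seminorm_nonneg[OF \<rho> cauchy_seqs_carrier[OF Y], of k]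
      by (intro add_mono mult_mono) auto
    finally show "\<rho> (\<lambda>W. sa_mult F (X j) (Y j) W - sa_mult F (X k) (Y k) W)
        \<le> (A + B) * (\<rho> (\<lambda>W. X j W - X k W) + \<rho> (\<lambda>W. Y j W - Y k W))"
      by (simp add: algebra_simps)
  qed (use A B in auto)
qed

lemma null_relI:
  assumes "X \<in> cauchy_seqs F \<rho>" "Y \<in> cauchy_seqs F \<rho>"
    "\<And>k. \<rho> (\<lambda>W. X k W - Y k W) \<le> b k" "b \<longlonglongrightarrow> 0"
  shows "(X, Y) \<in> null_rel F \<rho>"
proof -
  have "(\<lambda>k. \<rho> (\<lambda>W. X k W - Y k W)) \<longlonglongrightarrow> 0"
  proof (rule tendsto_sandwich[OF _ _ tendsto_const assms(4)])
    show "\<forall>\<^sub>F k in sequentially. 0 \<le> \<rho> (\<lambda>W. X k W - Y k W)"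
      using seminorm_nonneg[OF \<rho>] cauchy_seqs_carrier assms by simp
  qed (simp add: assms(3))
  then show ?thesis using assms by (simp add: null_rel_def)
qed

lemma null_relD:
  assumes "(X, Y) \<in> null_rel F \<rho>"
  shows "X \<in> cauchy_seqs F \<rho>" "Y \<in> cauchy_seqs F \<rho>" "(\<lambda>k. \<rho> (\<lambda>W. X k W - Y k W)) \<longlonglongrightarrow> 0"
  using assms by (auto simp: null_rel_def)

lemma equiv_null_rel: "equiv (cauchy_seqs F \<rho>) (null_rel F \<rho>)"
proof (rule equivI)
  show "refl_on (cauchy_seqs F \<rho>) (null_rel F \<rho>)"
    by (auto simp: refl_on_def null_rel_def seminorm_0[OF \<rho>])
  show "sym (null_rel F \<rho>)"
  proof (rule symI)
    fix X Y assume XY: "(X, Y) \<in> null_rel F \<rho>"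
    show "(Y, X) \<in> null_rel F \<rho>"
      using null_relD[OF XY] seminorm_minus_commute[OF \<rho> cauchy_seqs_carrier cauchy_seqs_carrier]
      by (intro null_relI[OF _ _ order_refl]) auto
  qed
  show "trans (null_rel F \<rho>)"
  proof (rule transI)
    fix X Y Z assume XY: "(X, Y) \<in> null_rel F \<rho>" and YZ: "(Y, Z) \<in> null_rel F \<rho>"
    show "(X, Z) \<in> null_rel F \<rho>"
    proof (rule null_relI)
      show "\<rho> (\<lambda>W. X k W - Z k W) \<le> \<rho> (\<lambda>W. X k W - Y k W) + \<rho> (\<lambda>W. Y k W - Z k W)" for k
        by (intro seminorm_triangle[OF \<rho>] cauchy_seqs_carrier null_relD[OF XY] null_relD[OF YZ])
      show "(\<lambda>k. \<rho> (\<lambda>W. X k W - Y k W) + \<rho> (\<lambda>W. Y k W - Z k W)) \<longlonglongrightarrow> 0"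
        using tendsto_add[OF null_relD(3)[OF XY] null_relD(3)[OF YZ]] by simp
    qed (use null_relD[OF XY] null_relD[OF YZ] in auto)
  qed
qed (auto simp: null_rel_def)

abbreviation (input) "Q \<equiv> completion F \<rho>"

lemma carrier_completion: "sa_carrier Q = cauchy_seqs F \<rho> // null_rel F \<rho>"
  by (simp add: completion_def)

lemma seq_class_in: "X \<in> cauchy_seqs F \<rho> \<Longrightarrow> seq_class F \<rho> X \<in> sa_carrier Q"
  by (simp add: carrier_completion seq_class_def quotientI)

lemma seq_class_eq: "(X, Y) \<in> null_rel F \<rho> \<Longrightarrow> seq_class F \<rho> X = seq_class F \<rho> Y"
  by (simp add: seq_class_def equiv_class_eq[OF equiv_null_rel])

lemma class_rep_null: "X \<in> cauchy_seqs F \<rho> \<Longrightarrow> (X, class_rep (seq_class F \<rho> X)) \<in> null_rel F \<rho>"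
  unfolding class_rep_def seq_class_def
  using someI[of "\<lambda>Y. Y \<in> null_rel F \<rho> `` {X}" X] equiv_class_self[OF equiv_null_rel] by blast

lemma completion_cases:
  assumes "a \<in> sa_carrier Q" obtains X where "X \<in> cauchy_seqs F \<rho>" "a = seq_class F \<rho> X"
  using assms by (auto simp: carrier_completion seq_class_def elim: quotientE)

lemma completion_add:
  assumes X: "X \<in> cauchy_seqs F \<rho>" and Y: "Y \<in> cauchy_seqs F \<rho>"
  shows "sa_add Q (seq_class F \<rho> X) (seq_class F \<rho> Y) = seq_class F \<rho> (\<lambda>k. sa_add F (X k) (Y k))"
proof -
  let ?X = "class_rep (seq_class F \<rho> X)" and ?Y = "class_rep (seq_class F \<rho> Y)"
  note nX = null_relD[OF class_rep_null[OF X]] and nY = null_relD[OF class_rep_null[OF Y]]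
  note [simp] = cauchy_seqs_carrier[OF nX(1)] cauchy_seqs_carrier[OF nX(2)] cauchy_seqs_carrier[OF nY(1)] cauchy_seqs_carrier[OF nY(2)]
  have "(\<lambda>k. sa_add F (X k) (Y k), \<lambda>k. sa_add F (?X k) (?Y k)) \<in> null_rel F \<rho>"
  proof (rule null_relI)
    show "\<rho> (\<lambda>W. sa_add F (X k) (Y k) W - sa_add F (?X k) (?Y k) W)
        \<le> \<rho> (\<lambda>W. X k W - ?X k W) + \<rho> (\<lambda>W. Y k W - ?Y k W)" for k
      using seminorm_add[OF \<rho>, of "\<lambda>W. X k W - ?X k W" "\<lambda>W. Y k W - ?Y k W"] by (simp add: algebra_simps)
    show "(\<lambda>k. \<rho> (\<lambda>W. X k W - ?X k W) + \<rho> (\<lambda>W. Y k W - ?Y k W)) \<longlonglongrightarrow> 0"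
      using tendsto_add[OF nX(3) nY(3)] by simp
  qed (rule cauchy_seqs_add nX nY)+
  from seq_class_eq[OF this] show ?thesis by (simp add: completion_def)
qed

lemma completion_scale:
  assumes X: "X \<in> cauchy_seqs F \<rho>"
  shows "sa_scale Q c (seq_class F \<rho> X) = seq_class F \<rho> (\<lambda>k. sa_scale F c (X k))"
proof -
  let ?X = "class_rep (seq_class F \<rho> X)"
  note nX = null_relD[OF class_rep_null[OF X]]
  have "(\<lambda>k. sa_scale F c (X k), \<lambda>k. sa_scale F c (?X k)) \<in> null_rel F \<rho>"
  proof (rule null_relI)
    show "\<rho> (\<lambda>W. sa_scale F c (X k) W - sa_scale F c (?X k) W) \<le> cmod c * \<rho> (\<lambda>W. X k W - ?X k W)" for k
      using seminorm_scale[OF \<rho> free_carrier_diff[OF cauchy_seqs_carrier[OF nX(1)] cauchy_seqs_carrier[OF nX(2)]], of c k k]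
      by (simp add: right_diff_distrib)
    show "(\<lambda>k. cmod c * \<rho> (\<lambda>W. X k W - ?X k W)) \<longlonglongrightarrow> 0"
      using tendsto_mult_left[OF nX(3)] by simp
  qed (rule cauchy_seqs_scale nX)+
  from seq_class_eq[OF this] show ?thesis by (simp add: completion_def)
qed

lemma completion_star:
  assumes X: "X \<in> cauchy_seqs F \<rho>"
  shows "sa_star Q (seq_class F \<rho> X) = seq_class F \<rho> (\<lambda>k. sa_star F (X k))"
proof -
  let ?X = "class_rep (seq_class F \<rho> X)"
  note nX = null_relD[OF class_rep_null[OF X]]
  have "(\<lambda>k. sa_star F (X k), \<lambda>k. sa_star F (?X k)) \<in> null_rel F \<rho>"
  proof (rule null_relI[OF _ _ _ nX(3)])
    show "\<rho> (\<lambda>W. sa_star F (X k) W - sa_star F (?X k) W) \<le> \<rho> (\<lambda>W. X k W - ?X k W)" for k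
      using seminorm_star[OF \<rho> free_carrier_diff[OF cauchy_seqs_carrier[OF nX(1)] cauchy_seqs_carrier[OF nX(2)]], of k k]
      by simp
  qed (rule cauchy_seqs_star nX)+
  from seq_class_eq[OF this] show ?thesis by (simp add: completion_def)
qed

lemma completion_mult:
  assumes X: "X \<in> cauchy_seqs F \<rho>" and Y: "Y \<in> cauchy_seqs F \<rho>"
  shows "sa_mult Q (seq_class F \<rho> X) (seq_class F \<rho> Y) = seq_class F \<rho> (\<lambda>k. sa_mult F (X k) (Y k))"
proof -
  let ?X = "class_rep (seq_class F \<rho> X)" and ?Y = "class_rep (seq_class F \<rho> Y)"
  note nX = null_relD[OF class_rep_null[OF X]] and nY = null_relD[OF class_rep_null[OF Y]]
  note [simp] = cauchy_seqs_carrier[OF nX(1)] cauchy_seqs_carrier[OF nX(2)] cauchy_seqs_carrier[OF nY(1)] cauchy_seqs_carrier[OF nY(2)]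
  obtain A where A: "\<And>k. \<rho> (X k) \<le> A" "0 \<le> A" using cauchy_seqs_bounded[OF X] by blast
  obtain B where B: "\<And>k. \<rho> (?Y k) \<le> B" "0 \<le> B" using cauchy_seqs_bounded[OF nY(2)] by blast
  have "(\<lambda>k. sa_mult F (X k) (Y k), \<lambda>k. sa_mult F (?X k) (?Y k)) \<in> null_rel F \<rho>"
  proof (rule null_relI)
    show "\<rho> (\<lambda>W. sa_mult F (X k) (Y k) W - sa_mult F (?X k) (?Y k) W)
        \<le> A * \<rho> (\<lambda>W. Y k W - ?Y k W) + \<rho> (\<lambda>W. X k W - ?X k W) * B" for k
    proof -
      have n: "0 \<le> \<rho> (\<lambda>W. X k W - ?X k W)" "0 \<le> \<rho> (\<lambda>W. Y k W - ?Y k W)" by (auto intro!: seminorm_nonneg[OF \<rho>])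
      have "\<rho> (\<lambda>W. sa_mult F (X k) (Y k) W - sa_mult F (?X k) (?Y k) W)
          \<le> \<rho> (X k) * \<rho> (\<lambda>W. Y k W - ?Y k W) + \<rho> (\<lambda>W. X k W - ?X k W) * \<rho> (?Y k)"
        by (rule seminorm_mult_diff) auto
      also have "\<dots> \<le> A * \<rho> (\<lambda>W. Y k W - ?Y k W) + \<rho> (\<lambda>W. X k W - ?X k W) * B"
        using A(1)[of k] B(1)[of k] n by (intro add_mono mult_right_mono mult_left_mono) auto
      finally show ?thesis .
    qed
    show "(\<lambda>k. A * \<rho> (\<lambda>W. Y k W - ?Y k W) + \<rho> (\<lambda>W. X k W - ?X k W) * B) \<longlonglongrightarrow> 0"
      using tendsto_add[OF tendsto_mult_left[OF nY(3), of A] tendsto_mult_right[OF nX(3), of B]] by simp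
  qed (rule cauchy_seqs_mult nX nY)+
  from seq_class_eq[OF this] show ?thesis by (simp add: completion_def)
qed

lemma completion_norm:
  assumes X: "X \<in> cauchy_seqs F \<rho>"
  shows "(\<lambda>k. \<rho> (X k)) \<longlonglongrightarrow> sa_norm Q (seq_class F \<rho> X)"
proof -
  let ?X = "class_rep (seq_class F \<rho> X)"
  note nX = null_relD[OF class_rep_null[OF X]]
  have lim: "(\<lambda>k. \<rho> (?X k)) \<longlonglongrightarrow> sa_norm Q (seq_class F \<rho> X)"
    using cauchy_seqs_norm_convergent[OF nX(2)] by (simp add: completion_def convergent_LIMSEQ_iff)
  have "(\<lambda>k. \<rho> (X k) - \<rho> (?X k)) \<longlonglongrightarrow> 0"
  proof (rule Lim_null_comparison[OF _ nX(3)])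
    show "\<forall>\<^sub>F k in sequentially. norm (\<rho> (X k) - \<rho> (?X k)) \<le> \<rho> (\<lambda>W. X k W - ?X k W)"
      using seminorm_abs_diff[OF \<rho> cauchy_seqs_carrier[OF nX(1)] cauchy_seqs_carrier[OF nX(2)]] by simp
  qed
  from tendsto_add[OF this lim] show ?thesis by simp
qed

end

section \<open>The path-space representations of the graph algebra\<close>

lemma star_representationD:
  assumes "star_representation A J \<pi>" "a \<in> sa_carrier A" "\<xi> \<in> l2 J"
  shows "b \<in> sa_carrier A \<Longrightarrow> \<pi> (sa_add A a b) \<xi> = (\<lambda>i. \<pi> a \<xi> i + \<pi> b \<xi> i)"
    "b \<in> sa_carrier A \<Longrightarrow> \<pi> (sa_mult A a b) \<xi> = \<pi> a (\<pi> b \<xi>)"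
    "\<pi> (sa_scale A c a) \<xi> = (\<lambda>i. c * \<pi> a \<xi> i)"
    "\<eta> \<in> l2 J \<Longrightarrow> l2_inner J (\<pi> (sa_star A a) \<xi>) \<eta> = l2_inner J \<xi> (\<pi> a \<eta>)"
    "l2_norm J (\<pi> a \<xi>) \<le> sa_norm A a * l2_norm J \<xi>"
    "\<pi> a \<xi> \<in> l2 J"
proof -
  have "\<pi> \<in> sa_carrier A \<rightarrow>\<^sub>E bounded_ops J" using assms(1) by (simp add: star_representation_def)
  then have "\<pi> a \<in> bounded_ops J" by (rule PiE_mem[OF _ assms(2)])
  then have "\<pi> a \<in> l2 J \<rightarrow>\<^sub>E l2 J" by (simp add: bounded_ops_def)
  then show "\<pi> a \<xi> \<in> l2 J" by (rule PiE_mem[OF _ assms(3)])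
qed (use assms in \<open>simp_all add: star_representation_def\<close>)

context path_space
begin

abbreviation "U \<equiv> universal_seminorm E"
abbreviation "CE \<equiv> cauchy_seqs (free_alg E) U"
abbreviation "cls \<equiv> seq_class (free_alg E) U"

lemma cs: "cstar_seminorm (free_alg E) U"
  using graph_seminorm_universal[OF wf] by (simp add: graph_seminorm_def)

lemmas carr = cauchy_seqs_carrier[OF cs]

lemma l2_diff:
  assumes "\<xi> \<in> l2 J" "\<eta> \<in> l2 J" shows "(\<lambda>i. \<xi> i - \<eta> i) \<in> l2 J"
  using l2_add(1)[OF assms(1) l2_scale(1)[OF assms(2), of "-1"]] by simp

lemma rep_diff_bound:
  assumes "f \<in> free_carrier E" "g \<in> free_carrier E" "\<xi> \<in> l2 I"
  shows "l2_norm I (\<lambda>i. rep f \<xi> i - rep g \<xi> i) \<le> U (\<lambda>W. f W - g W) * l2_norm I \<xi>"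
proof -
  have "rep (\<lambda>W. f W - g W) \<xi> = (\<lambda>i. rep f \<xi> i - rep g \<xi> i)"
    by (rule ext) (rule free_rep_diff[OF assms(1,2)])
  then show ?thesis using rep_contractive[OF free_carrier_diff[OF assms(1,2)] assms(3)] by simp
qed

definition lim_rep :: "(nat \<Rightarrow> ('v, 'e) free_elem) \<Rightarrow> ((nat \<Rightarrow> 'e) \<Rightarrow> complex) \<Rightarrow> (nat \<Rightarrow> 'e) \<Rightarrow> complex" where
  "lim_rep X \<xi> = (\<lambda>i. lim (\<lambda>k. rep (X k) \<xi> i))"

lemma lim_rep_tendsto:
  assumes X: "X \<in> CE" and \<xi>: "\<xi> \<in> l2 I"
  shows "(\<lambda>k. rep (X k) \<xi> i) \<longlonglongrightarrow> lim_rep X \<xi> i"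
proof -
  have "Cauchy (\<lambda>k. rep (X k) \<xi> i)"
    unfolding Cauchy_def
  proof (intro allI impI)
    fix \<epsilon> :: real assume "0 < \<epsilon>"
    then have e: "0 < \<epsilon> / (l2_norm I \<xi> + 1)" using l2_norm_nonneg[of I \<xi>] by (intro divide_pos_pos) linarith+
    then obtain N where N: "\<And>j k. j \<ge> N \<Longrightarrow> k \<ge> N \<Longrightarrow> U (\<lambda>W. X j W - X k W) < \<epsilon> / (l2_norm I \<xi> + 1)"
      using cauchy_seqs_small[OF cs X] by blast
    have "dist (rep (X j) \<xi> i) (rep (X k) \<xi> i) < \<epsilon>" if "j \<ge> N" "k \<ge> N" for j k
    proof -
      have "dist (rep (X j) \<xi> i) (rep (X k) \<xi> i) \<le> l2_norm I (\<lambda>i. rep (X j) \<xi> i - rep (X k) \<xi> i)"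
        unfolding dist_norm
        using cmod_le_l2_norm[OF l2_diff[OF rep_l2[OF carr[OF X] \<xi>] rep_l2[OF carr[OF X] \<xi>]]] .
      also have "\<dots> \<le> U (\<lambda>W. X j W - X k W) * l2_norm I \<xi>"
        by (rule rep_diff_bound[OF carr[OF X] carr[OF X] \<xi>])
      also have "\<dots> \<le> \<epsilon> / (l2_norm I \<xi> + 1) * l2_norm I \<xi>"
        using N[OF that] by (intro mult_right_mono) auto
      also have "\<dots> < \<epsilon>"
        using \<open>0 < \<epsilon>\<close> add_nonneg_pos[OF l2_norm_nonneg zero_less_one, of I \<xi>] by (simp add: divide_simps)
      finally show ?thesis .
    qed
    then show "\<exists>M. \<forall>m\<ge>M. \<forall>n\<ge>M. dist (rep (X m) \<xi> i) (rep (X n) \<xi> i) < \<epsilon>" by blast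
  qed
  then show ?thesis by (simp add: lim_rep_def Cauchy_convergent_iff convergent_LIMSEQ_iff)
qed

lemma lim_rep_l2:
  assumes X: "X \<in> CE" and \<xi>: "\<xi> \<in> l2 I"
  shows "lim_rep X \<xi> \<in> l2 I" "l2_norm I (lim_rep X \<xi>) \<le> sa_norm (graph_cstar E) (cls X) * l2_norm I \<xi>"
proof -
  have "lim_rep X \<xi> i = 0" if "i \<notin> I" for i
    using that by (simp add: lim_rep_def free_rep_def partial_shift_def)
  moreover have "(\<lambda>k. U (X k) * l2_norm I \<xi>) \<longlonglongrightarrow> sa_norm (graph_cstar E) (cls X) * l2_norm I \<xi>"
    unfolding graph_cstar_def by (intro tendsto_intros completion_norm[OF cs X])
  ultimately show "lim_rep X \<xi> \<in> l2 I" "l2_norm I (lim_rep X \<xi>) \<le> sa_norm (graph_cstar E) (cls X) * l2_norm I \<xi>"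
    using l2_limit[OF _ lim_rep_tendsto[OF X \<xi>] rep_l2[OF carr[OF X] \<xi>] rep_contractive[OF carr[OF X] \<xi>]] by auto
qed

text \<open>Coordinatewise convergence defines the limit operator, but products and inner products pass to
  the limit only because the convergence is in norm.\<close>

lemma lim_rep_norm_tendsto:
  assumes X: "X \<in> CE" and \<xi>: "\<xi> \<in> l2 I"
  shows "(\<lambda>k. l2_norm I (\<lambda>i. rep (X k) \<xi> i - lim_rep X \<xi> i)) \<longlonglongrightarrow> 0"
proof (rule LIMSEQ_I)
  fix \<epsilon> :: real assume "0 < \<epsilon>"
  then have e: "0 < \<epsilon> / (l2_norm I \<xi> + 1)" using l2_norm_nonneg[of I \<xi>] by (intro divide_pos_pos) linarith+
  then obtain N where N: "\<And>j k. j \<ge> N \<Longrightarrow> k \<ge> N \<Longrightarrow> U (\<lambda>W. X j W - X k W) < \<epsilon> / (l2_norm I \<xi> + 1)"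
    using cauchy_seqs_small[OF cs X] by blast
  have "l2_norm I (\<lambda>i. rep (X k) \<xi> i - lim_rep X \<xi> i) < \<epsilon>" if k: "k \<ge> N" for k
  proof -
    let ?C = "\<epsilon> / (l2_norm I \<xi> + 1) * l2_norm I \<xi>"
    have "l2_norm I (\<lambda>i. rep (X k) \<xi> i - lim_rep X \<xi> i) \<le> ?C"
    proof (rule l2_limit(2))
      show "(\<lambda>m. rep (X k) \<xi> i - rep (X (m + N)) \<xi> i) \<longlonglongrightarrow> rep (X k) \<xi> i - lim_rep X \<xi> i" for i
        by (intro tendsto_intros LIMSEQ_ignore_initial_segment lim_rep_tendsto[OF X \<xi>])
      show "(\<lambda>i. rep (X k) \<xi> i - rep (X (m + N)) \<xi> i) \<in> l2 I" for m
        by (intro l2_diff rep_l2 carr X \<xi>)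
      show "l2_norm I (\<lambda>i. rep (X k) \<xi> i - rep (X (m + N)) \<xi> i) \<le> ?C" for m
        using order_trans[OF rep_diff_bound[OF carr[OF X] carr[OF X] \<xi>] mult_right_mono[OF less_imp_le[OF N[OF k]] l2_norm_nonneg]]
        by simp
      show "rep (X k) \<xi> i - lim_rep X \<xi> i = 0" if "i \<notin> I" for i
        using l2_support[OF rep_l2[OF carr[OF X] \<xi>] that] l2_support[OF lim_rep_l2(1)[OF X \<xi>] that] by simp
    qed simp
    also have "?C < \<epsilon>"
      using \<open>0 < \<epsilon>\<close> add_nonneg_pos[OF l2_norm_nonneg zero_less_one, of I \<xi>] by (simp add: divide_simps)
    finally show ?thesis .
  qed
  then show "\<exists>N. \<forall>k\<ge>N. norm (l2_norm I (\<lambda>i. rep (X k) \<xi> i - lim_rep X \<xi> i) - 0) < \<epsilon>" by auto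
qed

lemma lim_rep_null:
  assumes XY: "(X, Y) \<in> null_rel (free_alg E) U" and \<xi>: "\<xi> \<in> l2 I"
  shows "lim_rep X \<xi> = lim_rep Y \<xi>"
proof
  fix i
  note n = null_relD[OF cs XY]
  have "(\<lambda>k. rep (X k) \<xi> i - rep (Y k) \<xi> i) \<longlonglongrightarrow> 0"
  proof (rule Lim_null_comparison)
    show "\<forall>\<^sub>F k in sequentially. norm (rep (X k) \<xi> i - rep (Y k) \<xi> i) \<le> U (\<lambda>W. X k W - Y k W) * l2_norm I \<xi>"
      using order_trans[OF cmod_le_l2_norm[OF l2_diff[OF rep_l2[OF carr[OF n(1)] \<xi>] rep_l2[OF carr[OF n(2)] \<xi>]]]
        rep_diff_bound[OF carr[OF n(1)] carr[OF n(2)] \<xi>]] by simp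
    show "(\<lambda>k. U (\<lambda>W. X k W - Y k W) * l2_norm I \<xi>) \<longlonglongrightarrow> 0"
      using tendsto_mult_right[OF n(3)] by simp
  qed
  moreover have "(\<lambda>k. rep (X k) \<xi> i - rep (Y k) \<xi> i) \<longlonglongrightarrow> lim_rep X \<xi> i - lim_rep Y \<xi> i"
    by (intro tendsto_intros lim_rep_tendsto n \<xi>)
  ultimately show "lim_rep X \<xi> i = lim_rep Y \<xi> i"
    using LIMSEQ_unique by fastforce
qed

lemma lim_rep_inner:
  assumes X: "X \<in> CE" and \<xi>: "\<xi> \<in> l2 I" and \<eta>: "\<eta> \<in> l2 I"
  shows "(\<lambda>k. l2_inner I \<xi> (rep (X k) \<eta>)) \<longlonglongrightarrow> l2_inner I \<xi> (lim_rep X \<eta>)"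
proof -
  have "(\<lambda>k. l2_inner I \<xi> (rep (X k) \<eta>) - l2_inner I \<xi> (lim_rep X \<eta>)) \<longlonglongrightarrow> 0"
  proof (rule Lim_null_comparison)
    show "\<forall>\<^sub>F k in sequentially. norm (l2_inner I \<xi> (rep (X k) \<eta>) - l2_inner I \<xi> (lim_rep X \<eta>))
        \<le> l2_norm I \<xi> * l2_norm I (\<lambda>i. rep (X k) \<eta> i - lim_rep X \<eta> i)"
    proof (intro always_eventually allI)
      fix k
      note r = rep_l2[OF carr[OF X] \<eta>, of k] lim_rep_l2(1)[OF X \<eta>]
      have "l2_inner I \<xi> (\<lambda>i. rep (X k) \<eta> i - lim_rep X \<eta> i) = l2_inner I \<xi> (rep (X k) \<eta>) - l2_inner I \<xi> (lim_rep X \<eta>)"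
        using l2_inner_sum_right[OF \<xi>, of "UNIV" "\<lambda>b. if b then rep (X k) \<eta> else lim_rep X \<eta>" "\<lambda>b. if b then 1 else -1"] r
        by (simp add: UNIV_bool)
      then show "norm (l2_inner I \<xi> (rep (X k) \<eta>) - l2_inner I \<xi> (lim_rep X \<eta>))
          \<le> l2_norm I \<xi> * l2_norm I (\<lambda>i. rep (X k) \<eta> i - lim_rep X \<eta> i)"
        using l2_cauchy_schwarz[OF \<xi> l2_diff[OF r]] by simp
    qed
    show "(\<lambda>k. l2_norm I \<xi> * l2_norm I (\<lambda>i. rep (X k) \<eta> i - lim_rep X \<eta> i)) \<longlonglongrightarrow> 0"
      using tendsto_mult_left[OF lim_rep_norm_tendsto[OF X \<eta>]] by simp
  qed
  then show ?thesis by (simp add: LIM_zero_iff)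
qed

lemma lim_rep_mult:
  assumes X: "X \<in> CE" and Y: "Y \<in> CE" and \<xi>: "\<xi> \<in> l2 I"
  shows "lim_rep (\<lambda>k. sa_mult (free_alg E) (X k) (Y k)) \<xi> = lim_rep X (lim_rep Y \<xi>)"
proof
  fix i
  let ?\<eta> = "lim_rep Y \<xi>"
  have \<eta>: "?\<eta> \<in> l2 I" by (rule lim_rep_l2[OF Y \<xi>])
  obtain B where B: "\<And>k. U (X k) \<le> B" "0 \<le> B" using cauchy_seqs_bounded[OF cs X] by blast
  have "(\<lambda>k. rep (X k) (rep (Y k) \<xi>) i - rep (X k) ?\<eta> i) \<longlonglongrightarrow> 0"
  proof (rule Lim_null_comparison)
    show "\<forall>\<^sub>F k in sequentially. norm (rep (X k) (rep (Y k) \<xi>) i - rep (X k) ?\<eta> i)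
        \<le> B * l2_norm I (\<lambda>i. rep (Y k) \<xi> i - ?\<eta> i)"
    proof (intro always_eventually allI)
      fix k
      have d: "(\<lambda>i. rep (Y k) \<xi> i - ?\<eta> i) \<in> l2 I" by (intro l2_diff rep_l2 carr Y \<xi> \<eta>)
      have "rep (X k) (rep (Y k) \<xi>) i - rep (X k) ?\<eta> i = rep (X k) (\<lambda>i. rep (Y k) \<xi> i - ?\<eta> i) i"
        using free_rep_sum_vector[of E I u "X k" "\<lambda>b. if b then 1 else -1" "\<lambda>b. if b then rep (Y k) \<xi> else ?\<eta>" UNIV]
        by (simp add: UNIV_bool fun_eq_iff)
      then have "norm (rep (X k) (rep (Y k) \<xi>) i - rep (X k) ?\<eta> i) \<le> U (X k) * l2_norm I (\<lambda>i. rep (Y k) \<xi> i - ?\<eta> i)"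
        using order_trans[OF cmod_le_l2_norm[OF rep_l2[OF carr[OF X] d]] rep_contractive[OF carr[OF X] d]] by simp
      also have "\<dots> \<le> B * l2_norm I (\<lambda>i. rep (Y k) \<xi> i - ?\<eta> i)" using B by (intro mult_right_mono) auto
      finally show "norm (rep (X k) (rep (Y k) \<xi>) i - rep (X k) ?\<eta> i) \<le> B * l2_norm I (\<lambda>i. rep (Y k) \<xi> i - ?\<eta> i)" .
    qed
    show "(\<lambda>k. B * l2_norm I (\<lambda>i. rep (Y k) \<xi> i - ?\<eta> i)) \<longlonglongrightarrow> 0"
      using tendsto_mult_left[OF lim_rep_norm_tendsto[OF Y \<xi>]] by simp
  qed
  from tendsto_add[OF this lim_rep_tendsto[OF X \<eta>, of i]]
  have "(\<lambda>k. rep (sa_mult (free_alg E) (X k) (Y k)) \<xi> i) \<longlonglongrightarrow> lim_rep X ?\<eta> i"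
    by (simp add: rep_mult carr X Y)
  then show "lim_rep (\<lambda>k. sa_mult (free_alg E) (X k) (Y k)) \<xi> i = lim_rep X ?\<eta> i"
    using lim_rep_tendsto[OF cauchy_seqs_mult[OF cs X Y] \<xi>] LIMSEQ_unique by blast
qed

lemma lim_rep_add:
  assumes X: "X \<in> CE" and Y: "Y \<in> CE" and \<xi>: "\<xi> \<in> l2 I"
  shows "lim_rep (\<lambda>k. sa_add (free_alg E) (X k) (Y k)) \<xi> = (\<lambda>i. lim_rep X \<xi> i + lim_rep Y \<xi> i)"
proof
  fix i
  have "(\<lambda>k. rep (sa_add (free_alg E) (X k) (Y k)) \<xi> i) \<longlonglongrightarrow> lim_rep X \<xi> i + lim_rep Y \<xi> i"
    using tendsto_add[OF lim_rep_tendsto[OF X \<xi>] lim_rep_tendsto[OF Y \<xi>]] by (simp add: free_rep_add carr X Y)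
  then show "lim_rep (\<lambda>k. sa_add (free_alg E) (X k) (Y k)) \<xi> i = lim_rep X \<xi> i + lim_rep Y \<xi> i"
    using lim_rep_tendsto[OF cauchy_seqs_add[OF cs X Y] \<xi>] LIMSEQ_unique by blast
qed

lemma lim_rep_scale:
  assumes X: "X \<in> CE" and \<xi>: "\<xi> \<in> l2 I"
  shows "lim_rep (\<lambda>k. sa_scale (free_alg E) c (X k)) \<xi> = (\<lambda>i. c * lim_rep X \<xi> i)"
proof
  fix i
  have "(\<lambda>k. rep (sa_scale (free_alg E) c (X k)) \<xi> i) \<longlonglongrightarrow> c * lim_rep X \<xi> i"
    using tendsto_mult_left[OF lim_rep_tendsto[OF X \<xi>]] by (simp add: free_rep_scale carr X)
  then show "lim_rep (\<lambda>k. sa_scale (free_alg E) c (X k)) \<xi> i = c * lim_rep X \<xi> i"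
    using lim_rep_tendsto[OF cauchy_seqs_scale[OF cs X] \<xi>] LIMSEQ_unique by blast
qed

lemma lim_rep_adjoint:
  assumes X: "X \<in> CE" and \<xi>: "\<xi> \<in> l2 I" and \<eta>: "\<eta> \<in> l2 I"
  shows "l2_inner I (lim_rep (\<lambda>k. sa_star (free_alg E) (X k)) \<xi>) \<eta> = l2_inner I \<xi> (lim_rep X \<eta>)"
proof -
  have "(\<lambda>k. cnj (l2_inner I \<eta> (rep (sa_star (free_alg E) (X k)) \<xi>))) \<longlonglongrightarrow>
      cnj (l2_inner I \<eta> (lim_rep (\<lambda>k. sa_star (free_alg E) (X k)) \<xi>))"
    by (intro tendsto_cnj lim_rep_inner cauchy_seqs_star[OF cs X] \<eta> \<xi>)
  then have "(\<lambda>k. l2_inner I \<xi> (rep (X k) \<eta>)) \<longlonglongrightarrow> l2_inner I (lim_rep (\<lambda>k. sa_star (free_alg E) (X k)) \<xi>) \<eta>"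
    by (simp add: l2_inner_cnj rep_adjoint carr X \<xi> \<eta>)
  then show ?thesis using lim_rep_inner[OF X \<xi> \<eta>] LIMSEQ_unique by blast
qed

definition path_hom where
  "path_hom = (\<lambda>a\<in>sa_carrier (graph_cstar E). \<lambda>\<xi>\<in>l2 I. lim_rep (class_rep a) \<xi>)"

lemma path_hom_class:
  assumes X: "X \<in> CE" and \<xi>: "\<xi> \<in> l2 I" shows "path_hom (cls X) \<xi> = lim_rep X \<xi>"
  using seq_class_in[OF cs X] \<xi> lim_rep_null[OF class_rep_null[OF cs X] \<xi>]
  by (simp add: path_hom_def graph_cstar_def)

lemma graph_cstar_cases:
  assumes "a \<in> sa_carrier (graph_cstar E)" obtains X where "X \<in> CE" "a = cls X"
  using assms completion_cases[OF cs] by (auto simp: graph_cstar_def)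

lemma cls_in: "X \<in> CE \<Longrightarrow> cls X \<in> sa_carrier (graph_cstar E)"
  using seq_class_in[OF cs] by (simp add: graph_cstar_def)

lemma path_hom_star_representation: "star_representation (graph_cstar E) I path_hom"
  unfolding star_representation_def
proof (intro conjI ballI allI)
  let ?A = "sa_carrier (graph_cstar E)"
  show "path_hom \<in> ?A \<rightarrow>\<^sub>E bounded_ops I"
  proof
    fix a assume a: "a \<in> ?A"
    obtain X where X: "X \<in> CE" and aX: "a = cls X" by (rule graph_cstar_cases[OF a])
    have "path_hom a \<in> l2 I \<rightarrow>\<^sub>E l2 I"
    proof (rule PiE_I)
      show "path_hom a f \<in> l2 I" if "f \<in> l2 I" for f
        using lim_rep_l2(1)[OF X that] by (simp add: aX path_hom_class[OF X that])
    qed (simp add: path_hom_def a)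
    moreover have "lim_rep X (\<lambda>i. f i + g i) = (\<lambda>i. lim_rep X f i + lim_rep X g i)" if "f \<in> l2 I" "g \<in> l2 I" for f g
    proof
      fix i
      have "(\<lambda>k. rep (X k) (\<lambda>i. f i + g i) i) \<longlonglongrightarrow> lim_rep X f i + lim_rep X g i"
        using tendsto_add[OF lim_rep_tendsto[OF X that(1)] lim_rep_tendsto[OF X that(2)]] by (simp add: free_rep_add_vector)
      then show "lim_rep X (\<lambda>i. f i + g i) i = lim_rep X f i + lim_rep X g i"
        using lim_rep_tendsto[OF X l2_add(1)[OF that]] LIMSEQ_unique by blast
    qed
    moreover have "lim_rep X (\<lambda>i. c * f i) = (\<lambda>i. c * lim_rep X f i)" if "f \<in> l2 I" for c f
    proof
      fix i
      have "(\<lambda>k. rep (X k) (\<lambda>i. c * f i) i) \<longlonglongrightarrow> c * lim_rep X f i"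
        using tendsto_mult_left[OF lim_rep_tendsto[OF X that]] by (simp add: free_rep_scale_vector)
      then show "lim_rep X (\<lambda>i. c * f i) i = c * lim_rep X f i"
        using lim_rep_tendsto[OF X l2_scale(1)[OF that]] LIMSEQ_unique by blast
    qed
    moreover have "\<exists>C. \<forall>f\<in>l2 I. l2_norm I (path_hom a f) \<le> C * l2_norm I f"
      using lim_rep_l2(2)[OF X] by (auto simp: aX path_hom_class[OF X])
    ultimately show "path_hom a \<in> bounded_ops I"
      unfolding bounded_ops_def by (simp add: aX path_hom_class[OF X] l2_add l2_scale)
  qed (simp add: path_hom_def)
  fix a assume a: "a \<in> ?A"
  obtain X where X: "X \<in> CE" and aX: "a = cls X" by (rule graph_cstar_cases[OF a])
  fix f assume f: "f \<in> l2 I"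
  show "path_hom (sa_scale (graph_cstar E) c a) f = (\<lambda>i. c * path_hom a f i)" for c
    unfolding aX graph_cstar_def completion_scale[OF cs X] path_hom_class[OF X f]
      path_hom_class[OF cauchy_seqs_scale[OF cs X] f] lim_rep_scale[OF X f] ..
  show "l2_norm I (path_hom a f) \<le> sa_norm (graph_cstar E) a * l2_norm I f"
    unfolding aX path_hom_class[OF X f] by (rule lim_rep_l2[OF X f])
  show "l2_inner I (path_hom (sa_star (graph_cstar E) a) f) g = l2_inner I f (path_hom a g)" if "g \<in> l2 I" for g
    using lim_rep_adjoint[OF X f that] 
    unfolding aX graph_cstar_def completion_star[OF cs X] path_hom_class[OF X that]
      path_hom_class[OF cauchy_seqs_star[OF cs X] f] .
  fix b assume b: "b \<in> ?A"
  obtain Y where Y: "Y \<in> CE" and bY: "b = cls Y" by (rule graph_cstar_cases[OF b])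
  show "path_hom (sa_add (graph_cstar E) a b) f = (\<lambda>i. path_hom a f i + path_hom b f i)"
    unfolding aX bY graph_cstar_def completion_add[OF cs X Y] path_hom_class[OF X f] path_hom_class[OF Y f]
      path_hom_class[OF cauchy_seqs_add[OF cs X Y] f] lim_rep_add[OF X Y f] ..
  show "path_hom (sa_mult (graph_cstar E) a b) f = path_hom a (path_hom b f)"
    unfolding aX bY graph_cstar_def completion_mult[OF cs X Y] path_hom_class[OF Y f]
      path_hom_class[OF X lim_rep_l2(1)[OF Y f]]
      path_hom_class[OF cauchy_seqs_mult[OF cs X Y] f] lim_rep_mult[OF X Y f] ..
qed

text \<open>A representation with the prescribed values on the generators is determined on their adjoints
  as well: the matrix coefficients of an adjoint are the conjugates of those of the operator.\<close>

lemma letter_determined: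
  assumes \<pi>: "star_representation (graph_cstar E) I \<pi>" and g: "(g, False) \<in> letters E"
    and \<delta>: "\<And>y. y \<in> I \<Longrightarrow> \<pi> (cls (\<lambda>_. monomial [(g, False)])) (l2_delta y) = rep (monomial [(g, False)]) (l2_delta y)"
    and \<xi>: "\<xi> \<in> l2 I"
  shows "\<pi> (cls (\<lambda>_. monomial [(g, b)])) \<xi> = rep (monomial [(g, b)]) \<xi>"
proof -
  let ?m = "monomial [(g, False)]" and ?n = "monomial [(g, True)]"
  have g': "(g, True) \<in> letters E" using g by (cases g) auto
  have m: "?m \<in> free_carrier E" "?n \<in> free_carrier E" using g g' by auto
  note mC = cauchy_seqs_const[OF cs m(1)] and nC = cauchy_seqs_const[OF cs m(2)]
  have adj: "adj_word [(g, False)] = [(g, True)]" by (simp add: adj_word_def)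
  have star: "sa_star (graph_cstar E) (cls (\<lambda>_. ?m)) = cls (\<lambda>_. ?n)"
    unfolding graph_cstar_def completion_star[OF cs mC] monomial_star adj ..
  have in_l2: "\<pi> (cls (\<lambda>_. h)) \<zeta> \<in> l2 I" if "h \<in> free_carrier E" "\<zeta> \<in> l2 I" for h \<zeta>
    by (rule star_representationD(6)[OF \<pi> cls_in[OF cauchy_seqs_const[OF cs that(1)]] that(2)])
  have pa: "l2_inner I (\<pi> (cls (\<lambda>_. ?n)) \<zeta>) \<eta> = l2_inner I \<zeta> (\<pi> (cls (\<lambda>_. ?m)) \<eta>)"
    if "\<zeta> \<in> l2 I" "\<eta> \<in> l2 I" for \<zeta> \<eta>
    using star_representationD(4)[OF \<pi> cls_in[OF mC] that] by (simp only: star)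
  have ra: "l2_inner I (rep ?n \<zeta>) \<eta> = l2_inner I \<zeta> (rep ?m \<eta>)" for \<zeta> \<eta>
    using monomial_rep_adjoint[of "[(g, False)]" \<zeta> \<eta>] g by (simp add: adj)
  have n: "\<pi> (cls (\<lambda>_. ?n)) \<zeta> = rep ?n \<zeta>" if \<zeta>: "\<zeta> \<in> l2 I" for \<zeta>
  proof
    fix y
    show "\<pi> (cls (\<lambda>_. ?n)) \<zeta> y = rep ?n \<zeta> y"
    proof (cases "y \<in> I")
      case True
      note d = l2_delta_in[OF True]
      have "\<pi> (cls (\<lambda>_. ?n)) \<zeta> y = cnj (l2_inner I (\<pi> (cls (\<lambda>_. ?n)) \<zeta>) (l2_delta y))"
        by (simp add: l2_inner_cnj l2_inner_delta[OF True])
      also have "\<dots> = cnj (l2_inner I (rep ?n \<zeta>) (l2_delta y))"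
        unfolding pa[OF \<zeta> d] ra \<delta>[OF True] ..
      finally show ?thesis by (simp add: l2_inner_cnj l2_inner_delta[OF True])
    qed (use l2_support[OF in_l2[OF m(2) \<zeta>]] l2_support[OF rep_l2[OF m(2) \<zeta>]] in simp)
  qed
  have "\<pi> (cls (\<lambda>_. ?m)) \<xi> = rep ?m \<xi>"
  proof
    fix y
    show "\<pi> (cls (\<lambda>_. ?m)) \<xi> y = rep ?m \<xi> y"
    proof (cases "y \<in> I")
      case True
      note d = l2_delta_in[OF True]
      have "l2_inner I (l2_delta y) (\<pi> (cls (\<lambda>_. ?m)) \<xi>) = l2_inner I (l2_delta y) (rep ?m \<xi>)"
        unfolding pa[OF d \<xi>, symmetric] ra[symmetric] n[OF d] ..
      then show ?thesis by (simp add: l2_inner_delta[OF True])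
    qed (use l2_support[OF in_l2[OF m(1) \<xi>]] l2_support[OF rep_l2[OF m(1) \<xi>]] in simp)
  qed
  then show ?thesis using n[OF \<xi>] by (cases b) auto
qed

text \<open>From the letters, the values propagate to words by multiplicativity, to the free star-algebra by
  linearity, and to the completion by contractivity.\<close>

lemma representation_determined:
  assumes \<pi>: "star_representation (graph_cstar E) I \<pi>"
    and \<delta>: "\<And>g y. (g, False) \<in> letters E \<Longrightarrow> y \<in> I \<Longrightarrow>
      \<pi> (cls (\<lambda>_. monomial [(g, False)])) (l2_delta y) = rep (monomial [(g, False)]) (l2_delta y)"
  shows "\<pi> = path_hom"
proof -
  have letter: "\<pi> (cls (\<lambda>_. monomial [l])) \<xi> = rep (monomial [l]) \<xi>" if "l \<in> letters E" "\<xi> \<in> l2 I" for l \<xi>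
  proof -
    obtain g b where l: "l = (g, b)" by (cases l)
    have g: "(g, False) \<in> letters E" using that l by (cases g) auto
    show ?thesis unfolding l by (rule letter_determined[OF \<pi> g \<delta>[OF g] that(2)])
  qed
  have hom: "\<pi> (sa_add (graph_cstar E) a b) \<xi> = (\<lambda>i. \<pi> a \<xi> i + \<pi> b \<xi> i)"
    "\<pi> (sa_mult (graph_cstar E) a b) \<xi> = \<pi> a (\<pi> b \<xi>)"
    "\<pi> (sa_scale (graph_cstar E) c a) \<xi> = (\<lambda>i. c * \<pi> a \<xi> i)"
    "l2_norm I (\<pi> a \<xi>) \<le> sa_norm (graph_cstar E) a * l2_norm I \<xi>" "\<pi> a \<xi> \<in> l2 I"
    if "a \<in> sa_carrier (graph_cstar E)" "b \<in> sa_carrier (graph_cstar E)" "\<xi> \<in> l2 I" for a b c \<xi>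
    using star_representationD[OF \<pi> that(1,3)] that(2) by blast+
  have word: "\<pi> (cls (\<lambda>_. monomial W)) \<xi> = rep (monomial W) \<xi>"
    if "W \<noteq> []" "W \<in> lists (letters E)" "\<xi> \<in> l2 I" for W \<xi>
    using that
  proof (induction W rule: list_nonempty_induct)
    case (cons l W)
    have l: "monomial [l] \<in> free_carrier E" and W: "monomial W \<in> free_carrier E"
      using cons by (auto intro: monomial_in)
    note lC = cauchy_seqs_const[OF cs l] and WC = cauchy_seqs_const[OF cs W]
    have "cls (\<lambda>_. monomial (l # W)) = sa_mult (graph_cstar E) (cls (\<lambda>_. monomial [l])) (cls (\<lambda>_. monomial W))"
      unfolding graph_cstar_def completion_mult[OF cs lC WC] monomial_mult by simp
    then have "\<pi> (cls (\<lambda>_. monomial (l # W))) \<xi> = \<pi> (cls (\<lambda>_. monomial [l])) (\<pi> (cls (\<lambda>_. monomial W)) \<xi>)"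
      using hom(2)[OF cls_in[OF lC] cls_in[OF WC] cons.prems(2)] by simp
    also have "\<dots> = rep (monomial [l]) (rep (monomial W) \<xi>)"
      using cons letter rep_l2[OF W cons.prems(2)] by simp
    also have "\<dots> = rep (monomial (l # W)) \<xi>"
      using rep_mult[OF l W, of \<xi>] by (simp add: monomial_mult)
    finally show ?case .
  qed (use letter in simp)
  have sum: "\<pi> (cls (\<lambda>_ V. \<Sum>W\<in>A. c W * monomial W V)) \<xi> = rep (\<lambda>V. \<Sum>W\<in>A. c W * monomial W V) \<xi>"
    if "finite A" "A \<subseteq> lists (letters E) - {[]}" "\<xi> \<in> l2 I" for A c \<xi>
    using that
  proof (induction A rule: finite_induct)
    case empty
    have z: "cls (\<lambda>_ V. 0) = sa_scale (graph_cstar E) 0 (cls (\<lambda>_ V. 0))"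
      unfolding graph_cstar_def completion_scale[OF cs cauchy_seqs_const[OF cs free_carrier_0]] by simp
    have "\<pi> (cls (\<lambda>_ V. 0)) \<xi> = (\<lambda>i. 0)"
      using hom(3)[OF cls_in cls_in empty(2), OF cauchy_seqs_const[OF cs free_carrier_0] cauchy_seqs_const[OF cs free_carrier_0], of 0]
      by (subst z) simp
    then show ?case by (simp add: free_rep_def)
  next
    case (insert W A)
    let ?f = "\<lambda>V. \<Sum>W\<in>A. c W * monomial W V"
    have W: "monomial W \<in> free_carrier E" using insert by (auto intro: monomial_in)
    have f: "?f \<in> free_carrier E"
      using insert by (intro free_carrier_sum free_carrier_scale monomial_in) auto
    note WC = cauchy_seqs_const[OF cs W] and fC = cauchy_seqs_const[OF cs f]
    note cWC = cauchy_seqs_scale[OF cs WC, of "c W"]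
    have eq: "cls (\<lambda>_ V. \<Sum>W\<in>insert W A. c W * monomial W V) =
        sa_add (graph_cstar E) (sa_scale (graph_cstar E) (c W) (cls (\<lambda>_. monomial W))) (cls (\<lambda>_. ?f))"
      unfolding graph_cstar_def completion_scale[OF cs WC] completion_add[OF cs cWC fC] using insert by simp
    have cW_in: "sa_scale (graph_cstar E) (c W) (cls (\<lambda>_. monomial W)) \<in> sa_carrier (graph_cstar E)"
      using cls_in[OF cWC] unfolding graph_cstar_def completion_scale[OF cs WC] .
    have "\<pi> (cls (\<lambda>_ V. \<Sum>W\<in>insert W A. c W * monomial W V)) \<xi> = (\<lambda>i. c W * rep (monomial W) \<xi> i + rep ?f \<xi> i)"
      unfolding eq hom(1)[OF cW_in cls_in[OF fC] insert.prems(2)] hom(3)[OF cls_in[OF WC] cls_in[OF WC] insert.prems(2)]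
      using insert word[of W \<xi>] by simp
    also have "\<dots> = rep (\<lambda>V. \<Sum>W\<in>insert W A. c W * monomial W V) \<xi>"
      using insert W f by (simp add: fun_eq_iff free_rep_add free_rep_scale)
    finally show ?case .
  qed
  have const: "\<pi> (cls (\<lambda>_. f)) \<xi> = rep f \<xi>" if "f \<in> free_carrier E" "\<xi> \<in> l2 I" for f \<xi>
    using sum[of "{W. f W \<noteq> 0}" \<xi> f] that free_expand[of "{W. f W \<noteq> 0}" f]
    by (simp add: free_carrier_iff)
  have eq: "\<pi> a \<xi> = path_hom a \<xi>" if a: "a \<in> sa_carrier (graph_cstar E)" and \<xi>: "\<xi> \<in> l2 I" for a \<xi>
  proof
    fix i
    obtain X where X: "X \<in> CE" and aX: "a = cls X" by (rule graph_cstar_cases[OF a])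
    have "(\<lambda>k. rep (X k) \<xi> i) \<longlonglongrightarrow> \<pi> a \<xi> i"
    proof (rule LIMSEQ_I)
      fix \<epsilon> :: real assume "0 < \<epsilon>"
      then have e: "0 < \<epsilon> / (l2_norm I \<xi> + 1)" using l2_norm_nonneg[of I \<xi>] by (intro divide_pos_pos) linarith+
      then obtain N where N: "\<And>j k. j \<ge> N \<Longrightarrow> k \<ge> N \<Longrightarrow> U (\<lambda>W. X j W - X k W) < \<epsilon> / (l2_norm I \<xi> + 1)"
        using cauchy_seqs_small[OF cs X] by blast
      have "norm (rep (X k) \<xi> i - \<pi> a \<xi> i) < \<epsilon>" if k: "k \<ge> N" for k
      proof -
        note kC = cauchy_seqs_const[OF cs carr[OF X, of k]]
        note kC' = cauchy_seqs_scale[OF cs kC, of "-1"]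
        let ?b = "sa_add (graph_cstar E) a (sa_scale (graph_cstar E) (-1) (cls (\<lambda>_. X k)))"
        have b: "?b = cls (\<lambda>j W. X j W - X k W)"
          unfolding aX graph_cstar_def completion_scale[OF cs kC] completion_add[OF cs X kC'] by simp
        have bC: "(\<lambda>j W. X j W - X k W) \<in> CE"
          using cauchy_seqs_add[OF cs X kC'] by simp
        have m_in: "sa_scale (graph_cstar E) (-1) (cls (\<lambda>_. X k)) \<in> sa_carrier (graph_cstar E)"
          using cls_in[OF kC'] unfolding graph_cstar_def completion_scale[OF cs kC] .
        have "\<pi> ?b \<xi> = (\<lambda>i. \<pi> a \<xi> i - rep (X k) \<xi> i)"
          unfolding hom(1)[OF a m_in \<xi>] hom(3)[OF cls_in[OF kC] cls_in[OF kC] \<xi>] const[OF carr[OF X] \<xi>] by simp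
        moreover have "cmod (\<pi> ?b \<xi> i) \<le> sa_norm (graph_cstar E) ?b * l2_norm I \<xi>"
          using cmod_le_l2_norm[OF hom(5)[OF cls_in[OF bC] cls_in[OF bC] \<xi>]] hom(4)[OF cls_in[OF bC] cls_in[OF bC] \<xi>]
            order_trans unfolding b by blast
        moreover have "sa_norm (graph_cstar E) ?b \<le> \<epsilon> / (l2_norm I \<xi> + 1)"
        proof (rule LIMSEQ_le_const2)
          show "(\<lambda>j. U (\<lambda>W. X j W - X k W)) \<longlonglongrightarrow> sa_norm (graph_cstar E) ?b"
            unfolding b unfolding graph_cstar_def by (rule completion_norm[OF cs bC])
          show "\<exists>M. \<forall>j\<ge>M. U (\<lambda>W. X j W - X k W) \<le> \<epsilon> / (l2_norm I \<xi> + 1)"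
            using N[OF _ k] less_imp_le by blast
        qed
        ultimately have "cmod (rep (X k) \<xi> i - \<pi> a \<xi> i) \<le> \<epsilon> / (l2_norm I \<xi> + 1) * l2_norm I \<xi>"
          by (metis (no_types, lifting) l2_norm_nonneg mult_right_mono norm_minus_commute order_trans)
        also have "\<dots> < \<epsilon>"
          using \<open>0 < \<epsilon>\<close> add_nonneg_pos[OF l2_norm_nonneg zero_less_one, of I \<xi>] by (simp add: divide_simps)
        finally show ?thesis .
      qed
      then show "\<exists>N. \<forall>k\<ge>N. norm (rep (X k) \<xi> i - \<pi> a \<xi> i) < \<epsilon>" by blast
    qed
    then show "\<pi> a \<xi> i = path_hom a \<xi> i"
      using lim_rep_tendsto[OF X \<xi>] LIMSEQ_unique unfolding aX path_hom_class[OF X \<xi>] by blast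
  qed
  show ?thesis
  proof (rule PiE_ext)
    show P: "\<pi> \<in> sa_carrier (graph_cstar E) \<rightarrow>\<^sub>E bounded_ops I"
      and H: "path_hom \<in> sa_carrier (graph_cstar E) \<rightarrow>\<^sub>E bounded_ops I"
      using \<pi> path_hom_star_representation by (auto simp only: star_representation_def)
    fix a assume a: "a \<in> sa_carrier (graph_cstar E)"
    show "\<pi> a = path_hom a"
    proof (rule PiE_ext)
      show "\<pi> a \<in> l2 I \<rightarrow>\<^sub>E l2 I" "path_hom a \<in> l2 I \<rightarrow>\<^sub>E l2 I"
        using PiE_mem[OF P a] PiE_mem[OF H a] unfolding bounded_ops_def by blast+
    qed (rule eq[OF a])
  qed
qed

lemma rep_vertex_delta:
  assumes "y \<in> I"
  shows "rep (monomial [(Vert v, False)]) (l2_delta y) = (if path_range E y = v then l2_delta y else (\<lambda>_. 0))"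
proof
  fix i
  show "rep (monomial [(Vert v, False)]) (l2_delta y) i = (if path_range E y = v then l2_delta y else (\<lambda>_. 0)) i"
    using assms by (cases "i = y") (auto simp: free_rep_monomial partial_shift_def l2_delta_def)
qed

lemma rep_edge_delta:
  assumes y: "y \<in> I" and e: "e \<in> arcs E"
  shows "rep (monomial [(Edge e, False)]) (l2_delta y) =
    (if path_range E y = tail E e then (\<lambda>i. u * l2_delta (path_cons e y) i) else (\<lambda>_. 0))"
proof
  fix i
  have cons: "i = path_cons e y \<longleftrightarrow> i 0 = e \<and> (\<lambda>n. i (Suc n)) = y"
    using path_cons_shift[of i] by auto
  have "path_range E y = tail E e" if "i \<in> I" "i = path_cons e y"
  proof -
    have "tail E (i 0) = head E (i (Suc 0))" using shift_tail_class_paths[OF that(1)] by (simp add: infinite_paths_def)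
    then show ?thesis by (simp add: that(2) path_range_def)
  qed
  moreover have "path_cons e y \<in> I" if "path_range E y = tail E e"
    using shift_tail_class_shift[OF y infinite_path_cons[OF shift_tail_class_paths[OF y] e that], of 1 0] by simp
  ultimately show "rep (monomial [(Edge e, False)]) (l2_delta y) i =
    (if path_range E y = tail E e then (\<lambda>i. u * l2_delta (path_cons e y) i) else (\<lambda>_. 0)) i"
    using cons by (auto simp: free_rep_monomial partial_shift_def l2_delta_def)
qed

lemma path_rep_eq: "path_rep E x u = path_hom"
proof -
  have gen: "gen_p E v = cls (\<lambda>_. monomial [(Vert v, False)])" "gen_s E e = cls (\<lambda>_. monomial [(Edge e, False)])" for v e
    by (simp_all add: gen_p_def gen_s_def embed_def free_gen_monomial)
  have hom: "path_hom (cls (\<lambda>_. monomial [l])) (l2_delta y) = rep (monomial [l]) (l2_delta y)"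
    if "l \<in> letters E" "y \<in> I" for l y
  proof -
    have C: "(\<lambda>_. monomial [l]) \<in> CE" using that by (intro cauchy_seqs_const[OF cs] monomial_in) auto
    show ?thesis
      unfolding path_hom_class[OF C l2_delta_in[OF that(2)]] by (simp add: lim_rep_def)
  qed
  show ?thesis
    unfolding path_rep_def
  proof (rule the_equality)
    show "star_representation (graph_cstar E) I path_hom \<and>
      (\<forall>v\<in>verts E. \<forall>y\<in>I. path_hom (gen_p E v) (l2_delta y) = (if path_range E y = v then l2_delta y else (\<lambda>_. 0))) \<and>
      (\<forall>e\<in>arcs E. \<forall>y\<in>I. path_hom (gen_s E e) (l2_delta y) =
        (if path_range E y = tail E e then (\<lambda>i. u * l2_delta (path_cons e y) i) else (\<lambda>_. 0)))"
      using path_hom_star_representation by (simp add: gen hom rep_vertex_delta rep_edge_delta)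
    fix \<pi>
    assume \<pi>: "star_representation (graph_cstar E) I \<pi> \<and>
      (\<forall>v\<in>verts E. \<forall>y\<in>I. \<pi> (gen_p E v) (l2_delta y) = (if path_range E y = v then l2_delta y else (\<lambda>_. 0))) \<and>
      (\<forall>e\<in>arcs E. \<forall>y\<in>I. \<pi> (gen_s E e) (l2_delta y) =
        (if path_range E y = tail E e then (\<lambda>i. u * l2_delta (path_cons e y) i) else (\<lambda>_. 0)))"
    show "\<pi> = path_hom"
    proof (rule representation_determined)
      fix g :: "('v, 'e) generator" and y
      assume "(g, False) \<in> letters E" "y \<in> I"
      then show "\<pi> (cls (\<lambda>_. monomial [(g, False)])) (l2_delta y) = rep (monomial [(g, False)]) (l2_delta y)"
        using \<pi> by (cases g) (simp_all add: gen rep_vertex_delta rep_edge_delta)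
    qed (use \<pi> in blast)
  qed
qed

text \<open>The vectors \<open>\<delta>\<^sub>z\<close> suffice because the coefficient of \<open>\<pi>(a) \<xi>\<close> at \<open>y\<close> is the inner product of
  \<open>\<pi>(a\<^sup>*) \<delta>\<^sub>y\<close> with \<open>\<xi>\<close>.\<close>

lemma kernel_iff:
  assumes X: "X \<in> CE"
  shows "cls X \<in> rep_kernel (graph_cstar E) I (path_rep E x u) \<longleftrightarrow>
    (\<forall>y\<in>I. \<forall>z\<in>I. (\<lambda>k. rep (X k) (l2_delta z) y) \<longlonglongrightarrow> 0)"
proof -
  have "(\<forall>\<xi>\<in>l2 I. lim_rep X \<xi> = (\<lambda>_. 0)) \<longleftrightarrow> (\<forall>y\<in>I. \<forall>z\<in>I. lim_rep X (l2_delta z) y = 0)"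
  proof (intro iffI ballI)
    assume 0: "\<forall>y\<in>I. \<forall>z\<in>I. lim_rep X (l2_delta z) y = 0"
    fix \<xi> assume \<xi>: "\<xi> \<in> l2 I"
    show "lim_rep X \<xi> = (\<lambda>_. 0)"
    proof
      fix y
      show "lim_rep X \<xi> y = 0"
      proof (cases "y \<in> I")
        case True
        let ?\<eta> = "lim_rep (\<lambda>k. sa_star (free_alg E) (X k)) (l2_delta y)"
        have "?\<eta> z = 0" if "z \<in> I" for z
        proof -
          have "cnj (?\<eta> z) = l2_inner I ?\<eta> (l2_delta z)"
            by (subst l2_inner_cnj[symmetric]) (simp add: l2_inner_delta[OF that])
          also have "\<dots> = lim_rep X (l2_delta z) y"
            unfolding lim_rep_adjoint[OF X l2_delta_in[OF True] l2_delta_in[OF that]] l2_inner_delta[OF True] ..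
          finally show ?thesis using 0 True that by simp
        qed
        then have "l2_inner I ?\<eta> \<xi> = 0" unfolding l2_inner_def by (intro infsum_0) (simp only: complex_cnj_zero mult_zero_left)
        then show ?thesis
          unfolding lim_rep_adjoint[OF X l2_delta_in[OF True] \<xi>] l2_inner_delta[OF True] .
      qed (use l2_support[OF lim_rep_l2(1)[OF X \<xi>]] in simp)
    qed
  qed (use l2_delta_in in fastforce)
  moreover have "lim_rep X (l2_delta z) y = 0 \<longleftrightarrow> (\<lambda>k. rep (X k) (l2_delta z) y) \<longlonglongrightarrow> 0" if "z \<in> I" for y z
    using lim_rep_tendsto[OF X l2_delta_in[OF that]] LIMSEQ_unique by metis
  ultimately show ?thesis
    using cls_in[OF X] by (simp add: rep_kernel_def path_rep_eq path_hom_class[OF X])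
qed

end

section \<open>Maximal tails and their cycles\<close>

lemma graph_path_nth:
  assumes "graph_path E v \<mu> w"
  shows "i < length \<mu> \<Longrightarrow> \<mu> ! i \<in> arcs E"
    and "Suc i < length \<mu> \<Longrightarrow> tail E (\<mu> ! i) = head E (\<mu> ! Suc i)"
    and "\<mu> \<noteq> [] \<Longrightarrow> head E (\<mu> ! 0) = v"
    and "\<mu> \<noteq> [] \<Longrightarrow> tail E (\<mu> ! (length \<mu> - 1)) = w"
proof -
  have "(\<forall>i<length \<mu>. \<mu> ! i \<in> arcs E) \<and> (\<forall>i. Suc i < length \<mu> \<longrightarrow> tail E (\<mu> ! i) = head E (\<mu> ! Suc i)) \<and>
    (\<mu> \<noteq> [] \<longrightarrow> head E (\<mu> ! 0) = v \<and> tail E (\<mu> ! (length \<mu> - 1)) = w)"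
    using assms
  proof (induction \<mu> arbitrary: v)
    case (Cons e \<mu>)
    then have IH: "\<forall>i<length \<mu>. \<mu> ! i \<in> arcs E" "\<forall>i. Suc i < length \<mu> \<longrightarrow> tail E (\<mu> ! i) = head E (\<mu> ! Suc i)"
      "\<mu> \<noteq> [] \<longrightarrow> head E (\<mu> ! 0) = tail E e \<and> tail E (\<mu> ! (length \<mu> - 1)) = w" by auto
    have "tail E ((e # \<mu>) ! i) = head E ((e # \<mu>) ! Suc i)" if "Suc i < length (e # \<mu>)" for i
      using IH that by (cases i) auto
    moreover have "(e # \<mu>) ! i \<in> arcs E" if "i < length (e # \<mu>)" for i
      using IH Cons.prems that by (cases i) auto
    moreover have "tail E ((e # \<mu>) ! (length (e # \<mu>) - 1)) = w"
      using IH Cons.prems by (cases \<mu>) auto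
    ultimately show ?case using Cons.prems by auto
  qed simp
  then show "i < length \<mu> \<Longrightarrow> \<mu> ! i \<in> arcs E"
    "Suc i < length \<mu> \<Longrightarrow> tail E (\<mu> ! i) = head E (\<mu> ! Suc i)"
    "\<mu> \<noteq> [] \<Longrightarrow> head E (\<mu> ! 0) = v" "\<mu> \<noteq> [] \<Longrightarrow> tail E (\<mu> ! (length \<mu> - 1)) = w" by auto
qed

lemma graph_path_append:
  "graph_path E v \<mu> t \<Longrightarrow> graph_path E t \<nu> w \<Longrightarrow> graph_path E v (\<mu> @ \<nu>) w"
  by (induction \<mu> arbitrary: v) auto

lemma graph_path_segment:
  assumes y: "y \<in> infinite_paths E" and wf: "wf_digraph E"
  shows "graph_path E (head E (y 0)) (map y [0..<n]) (head E (y n))"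
proof (induction n)
  case 0
  then show ?case using y wf by (simp add: infinite_paths_def wf_digraph_def)
next
  case (Suc n)
  have "graph_path E (head E (y n)) [y n] (head E (y (Suc n)))"
    using y wf by (auto simp: infinite_paths_def wf_digraph_def)
  from graph_path_append[OF Suc this] show ?case by simp
qed

lemma maximal_tail_backward:
  assumes T: "maximal_tail E T" and y: "y \<in> infinite_paths E" and "head E (y n) \<in> T" "m \<le> n"
  shows "head E (y m) \<in> T"
  using assms(4,3)
proof (induction m rule: inc_induct)
  case (step m)
  then have "tail E (y m) \<in> T" using y by (simp add: infinite_paths_def)
  then show ?case using T y by (auto simp: maximal_tail_def infinite_paths_def)
qed

lemma class_vertices_path:
  assumes "y \<in> shift_tail_class E x" shows "head E (y n) \<in> class_vertices E x"
proof -
  have "(\<lambda>i. y (i + n)) \<in> shift_tail_class E x"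
    using shift_tail_class_shift[OF assms infinite_path_shift[OF shift_tail_class_paths[OF assms]], of 0 n] by simp
  moreover have "path_range E (\<lambda>i. y (i + n)) = head E (y n)" by (simp add: path_range_def)
  ultimately show ?thesis unfolding class_vertices_def by (metis image_eqI)
qed

lemma shift_tail_class_prepend:
  assumes "y \<in> shift_tail_class E x" "graph_path E v \<mu> (path_range E y)"
  obtains z where "z \<in> shift_tail_class E x" "path_range E z = v"
proof -
  have "\<exists>z\<in>shift_tail_class E x. path_range E z = v"
    using assms(2)
  proof (induction \<mu> arbitrary: v)
    case Nil
    then show ?case using assms(1) by auto
  next
    case (Cons e \<mu>)
    then obtain z where z: "z \<in> shift_tail_class E x" "path_range E z = tail E e" by auto
    have e: "e \<in> arcs E" "head E e = v" using Cons.prems by auto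
    have "path_cons e z \<in> shift_tail_class E x"
      using shift_tail_class_shift[OF z(1) infinite_path_cons[OF shift_tail_class_paths[OF z(1)] e(1) z(2)], of 1 0] by simp
    then show ?case using e(2) by (intro bexI[of _ "path_cons e z"]) (simp_all add: path_range_def)
  qed
  then show ?thesis using that by blast
qed

text \<open>Enumerate \<open>T\<close> and build an infinite path in stages; at stage \<open>n\<close>, directedness (T3) lets the
  path be continued to a vertex that the \<open>n\<close>-th element of \<open>T\<close> reaches as well.\<close>

lemma maximal_tail_eq_class_vertices:
  assumes E: "row_finite_no_sources E" and T: "maximal_tail E T"
  obtains x where "x \<in> infinite_paths E" "class_vertices E x = T"
proof -
  have T0: "T \<subseteq> verts E" "T \<noteq> {}" using T by (auto simp: maximal_tail_def)
  have wf: "wf_digraph E" using E by (simp add: row_finite_no_sources_def)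
  have "countable T"
    using E T0(1) countable_subset by (auto simp: row_finite_no_sources_def)
  then have rng: "range (from_nat_into T) = T" using T0(2) by (simp add: range_from_nat_into)
  have nin: "from_nat_into T n \<in> T" for n using rng by blast
  obtain v0 where v0: "v0 \<in> T" using T0(2) by blast
  let ?P = "\<lambda>n (L, t). graph_path E v0 L t \<and> t \<in> T \<and> n \<le> length L"
  let ?Q = "\<lambda>n (L, t) (L', t'). \<exists>\<kappa>. \<kappa> \<noteq> [] \<and> L' = L @ \<kappa> \<and> graph_path E t \<kappa> t' \<and> (\<exists>\<nu>. graph_path E (from_nat_into T n) \<nu> t')"
  have "\<exists>f. \<forall>n. ?P n (f n) \<and> ?Q n (f n) (f (Suc n))"
  proof (rule dependent_nat_choice)
    show "\<exists>a. ?P 0 a" using v0 T0(1) by (intro exI[of _ "([], v0)"]) auto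
    fix a n assume a: "?P n a"
    obtain L t where Lt: "a = (L, t)" by (cases a)
    have t: "graph_path E v0 L t" "t \<in> T" "n \<le> length L" using a Lt by auto
    obtain \<mu> \<nu> s where s: "graph_path E t \<mu> s" "graph_path E (from_nat_into T n) \<nu> s" "s \<in> T"
      using T t(2) nin[of n] unfolding maximal_tail_def by meson
    obtain e where e: "e \<in> arcs E" "head E e = s" "tail E e \<in> T"
      using T s(3) unfolding maximal_tail_def by meson
    have ep: "graph_path E s [e] (tail E e)" using e T0(1) by auto
    let ?\<kappa> = "\<mu> @ [e]"
    have 1: "graph_path E t ?\<kappa> (tail E e)" by (rule graph_path_append[OF s(1) ep])
    have "?P (Suc n) (L @ ?\<kappa>, tail E e)" using graph_path_append[OF t(1) 1] t e by simp
    moreover have "?Q n a (L @ ?\<kappa>, tail E e)"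
      unfolding Lt prod.case
      by (rule exI[of _ ?\<kappa>]) (use 1 graph_path_append[OF s(2) ep] in blast)
    ultimately show "\<exists>b. ?P (Suc n) b \<and> ?Q n a b" by blast
  qed
  then obtain f where f: "\<forall>n. ?P n (f n) \<and> ?Q n (f n) (f (Suc n))" by (rule exE)
  define L t where "L n = fst (f n)" and "t n = snd (f n)" for n
  have L: "graph_path E v0 (L n) (t n)" "t n \<in> T" "n \<le> length (L n)" for n
    using spec[OF f, of n] by (simp_all add: L_def t_def case_prod_unfold)
  have Q: "\<exists>\<kappa>. \<kappa> \<noteq> [] \<and> L (Suc n) = L n @ \<kappa> \<and> graph_path E (t n) \<kappa> (t (Suc n))"
    and reach: "\<exists>\<nu>. graph_path E (from_nat_into T n) \<nu> (t (Suc n))" for n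
    using spec[OF f, of n] by (auto simp: L_def t_def case_prod_unfold)
  have prefix: "\<exists>\<rho>. L n = L m @ \<rho>" if "m \<le> n" for m n
    using that
  proof (induction n rule: dec_induct)
    case (step n)
    then show ?case using Q[of n] by auto
  qed simp
  define x where "x i = L (Suc i) ! i" for i
  have x: "x i = L m ! i" if "i < length (L m)" for i m
  proof (cases "m \<le> Suc i")
    case True
    then obtain \<rho> where "L (Suc i) = L m @ \<rho>" using prefix by blast
    then show ?thesis using that by (simp add: x_def nth_append)
  next
    case False
    then obtain \<rho> where "L m = L (Suc i) @ \<rho>" using prefix[of "Suc i" m] by auto
    moreover have "i < length (L (Suc i))" using L(3)[of "Suc i"] by simp
    ultimately show ?thesis by (simp add: x_def nth_append)
  qed
  have xp: "x \<in> infinite_paths E"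
    unfolding infinite_paths_def
  proof clarify
    fix i
    have "Suc i < length (L (Suc (Suc i)))" using L(3)[of "Suc (Suc i)"] by simp
    then show "x i \<in> arcs E \<and> tail E (x i) = head E (x (Suc i))"
      using graph_path_nth(1,2)[OF L(1)[of "Suc (Suc i)"], of i] x[of i "Suc (Suc i)"] x[of "Suc i" "Suc (Suc i)"] by simp
  qed
  have xt: "head E (x (length (L n))) = t n" for n
  proof -
    obtain \<kappa> where \<kappa>: "\<kappa> \<noteq> []" "L (Suc n) = L n @ \<kappa>" "graph_path E (t n) \<kappa> (t (Suc n))" using Q by blast
    then have "x (length (L n)) = \<kappa> ! 0" using x[of "length (L n)" "Suc n"] by (simp add: nth_append)
    then show ?thesis using graph_path_nth(3)[OF \<kappa>(3,1)] by simp
  qed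
  have xT: "head E (x i) \<in> T" for i
    using maximal_tail_backward[OF T xp, of "length (L i)" i] xt[of i] L(2,3)[of i] by simp
  have "class_vertices E x = T"
  proof
    show "class_vertices E x \<subseteq> T"
    proof
      fix v assume "v \<in> class_vertices E x"
      then obtain y where y: "y \<in> shift_tail_class E x" "v = path_range E y" by (auto simp: class_vertices_def)
      then obtain m n where mn: "\<And>i. x (i + m) = y (i + n)" by (auto simp: shift_tail_class_def)
      have "head E (y n) \<in> T" using xT[of m] mn[of 0] by simp
      then show "v \<in> T"
        using maximal_tail_backward[OF T shift_tail_class_paths[OF y(1)], of n 0] y(2) by (simp add: path_range_def)
    qed
    show "T \<subseteq> class_vertices E x"
    proof
      fix v assume "v \<in> T"
      then obtain n where n: "v = from_nat_into T n" using rng by blast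
      obtain \<nu> where \<nu>: "graph_path E v \<nu> (t (Suc n))" using reach[of n] n by blast
      let ?l = "length (L (Suc n))"
      let ?y = "\<lambda>i. x (i + ?l)"
      have "?y \<in> shift_tail_class E x"
        using shift_tail_class_shift[OF shift_tail_class_self[OF xp] infinite_path_shift[OF xp], of 0 ?l] by simp
      moreover have "path_range E ?y = t (Suc n)" using xt[of "Suc n"] by (simp add: path_range_def)
      ultimately obtain z where "z \<in> shift_tail_class E x" "path_range E z = v"
        using shift_tail_class_prepend \<nu> by metis
      then show "v \<in> class_vertices E x" by (auto simp: class_vertices_def)
    qed
  qed
  then show ?thesis using that xp by blast
qed

subsection \<open>Cycles without entrance\<close>

definition cycle_path :: "'e list \<Rightarrow> nat \<Rightarrow> 'e" where
  "cycle_path \<mu> = (\<lambda>i. \<mu> ! (i mod length \<mu>))"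

lemma cycle_path_period: "cycle_path \<mu> (i + length \<mu>) = cycle_path \<mu> i"
  by (simp add: cycle_path_def)

lemma cycle_path_in_set: "\<mu> \<noteq> [] \<Longrightarrow> cycle_path \<mu> i \<in> set \<mu>"
  by (simp add: cycle_path_def)

lemma set_cycle_path: "e \<in> set \<mu> \<Longrightarrow> \<exists>i. e = cycle_path \<mu> i"
  by (metis cycle_path_def in_set_conv_nth mod_less)

lemma cycle_path_infinite:
  assumes "graph_cycle E \<mu>" shows "cycle_path \<mu> \<in> infinite_paths E"
proof -
  obtain v where v: "graph_path E v \<mu> v" and ne: "\<mu> \<noteq> []" using assms by (auto simp: graph_cycle_def)
  have "cycle_path \<mu> i \<in> arcs E \<and> tail E (cycle_path \<mu> i) = head E (cycle_path \<mu> (Suc i))" for i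
  proof (cases "Suc (i mod length \<mu>) = length \<mu>")
    case True
    then have "Suc i mod length \<mu> = 0" "i mod length \<mu> = length \<mu> - 1" by (auto simp: mod_Suc)
    then show ?thesis
      using graph_path_nth(1,3,4)[OF v] ne by (simp add: cycle_path_def)
  next
    case False
    have "i mod length \<mu> < length \<mu>" using ne by simp
    with False have "Suc (i mod length \<mu>) < length \<mu>" by linarith
    then show ?thesis
      using graph_path_nth(1,2)[OF v, of "i mod length \<mu>"] ne False by (simp add: cycle_path_def mod_Suc)
  qed
  then show ?thesis by (simp add: infinite_paths_def)
qed

text \<open>Distinctness is given for the sources of the edges; the range of an edge of the cycle is the
  source of the preceding one.\<close>

lemma cycle_path_head_eq_iff:
  assumes "graph_cycle E \<mu>"
  shows "head E (cycle_path \<mu> i) = head E (cycle_path \<mu> j) \<longleftrightarrow> i mod length \<mu> = j mod length \<mu>"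
proof
  assume eq: "head E (cycle_path \<mu> i) = head E (cycle_path \<mu> j)"
  let ?n = "length \<mu>"
  have ne: "\<mu> \<noteq> []" and dist: "distinct (map (tail E) \<mu>)" using assms by (auto simp: graph_cycle_def)
  have prev: "head E (cycle_path \<mu> k) = tail E (\<mu> ! ((k + ?n - 1) mod ?n))" for k
  proof -
    have "head E (cycle_path \<mu> (Suc (k + ?n - 1))) = tail E (cycle_path \<mu> (k + ?n - 1))"
      using cycle_path_infinite[OF assms] by (simp add: infinite_paths_def)
    moreover have "Suc (k + ?n - 1) = k + ?n" using ne by (simp add: Suc_leI)
    ultimately show ?thesis by (simp add: cycle_path_period) (simp add: cycle_path_def)
  qed
  have "(i + ?n - 1) mod ?n = (j + ?n - 1) mod ?n"
    using eq ne nth_eq_iff_index_eq[OF dist, of "(i + ?n - 1) mod ?n" "(j + ?n - 1) mod ?n"] by (simp add: prev)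
  then have "((i + ?n - 1) + 1) mod ?n = ((j + ?n - 1) + 1) mod ?n" by (metis mod_add_left_eq)
  then show "i mod ?n = j mod ?n" using ne by (simp add: Suc_leI)
qed (simp add: cycle_path_def)

lemma cycle_path_in_tail:
  assumes T: "maximal_tail E T" and \<mu>: "graph_cycle E \<mu>" and "head E (cycle_path \<mu> k) \<in> T"
  shows "head E (cycle_path \<mu> i) \<in> T"
proof -
  have "length \<mu> \<noteq> 0" using \<mu> by (auto simp: graph_cycle_def)
  then have "i \<le> k + i * length \<mu>" by (cases "length \<mu>") auto
  moreover have "cycle_path \<mu> (k + i * length \<mu>) = cycle_path \<mu> k" by (simp add: cycle_path_def)
  ultimately show ?thesis
    using maximal_tail_backward[OF T cycle_path_infinite[OF \<mu>], of "k + i * length \<mu>" i] assms(3) by simp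
qed

lemma cycle_no_entranceD:
  assumes "cycle_no_entrance E A \<mu>"
  shows "graph_cycle E \<mu>" "\<mu> \<noteq> []" "head E (cycle_path \<mu> i) \<in> A"
    and "f \<in> arcs E \<Longrightarrow> head E f = head E (cycle_path \<mu> i) \<Longrightarrow> tail E f \<in> A \<Longrightarrow> f = cycle_path \<mu> i"
proof -
  show c: "graph_cycle E \<mu>" and ne: "\<mu> \<noteq> []" using assms by (auto simp: cycle_no_entrance_def graph_cycle_def)
  show "head E (cycle_path \<mu> i) \<in> A"
    using assms cycle_path_in_set[OF ne, of i] by (auto simp: cycle_no_entrance_def)
  show "f = cycle_path \<mu> i" if "f \<in> arcs E" "head E f = head E (cycle_path \<mu> i)" "tail E f \<in> A"
  proof -
    have "{f\<in>arcs E. head E f = head E (cycle_path \<mu> i) \<and> tail E f \<in> A} = {cycle_path \<mu> i}"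
      using assms cycle_path_in_set[OF ne, of i] unfolding cycle_no_entrance_def by blast
    then show ?thesis using that by blast
  qed
qed

lemma cycle_no_entranceI:
  assumes \<mu>: "graph_cycle E \<mu>" and A: "\<And>i. head E (cycle_path \<mu> i) \<in> A"
    and f: "\<And>f i. f \<in> arcs E \<Longrightarrow> head E f = head E (cycle_path \<mu> i) \<Longrightarrow> tail E f \<in> A \<Longrightarrow> f = cycle_path \<mu> i"
  shows "cycle_no_entrance E A \<mu>"
  unfolding cycle_no_entrance_def
proof (intro conjI ballI)
  show "head E ` set \<mu> \<subseteq> A" using A set_cycle_path by fastforce
  fix e assume "e \<in> set \<mu>"
  then obtain i where e: "e = cycle_path \<mu> i" using set_cycle_path by metis
  have "cycle_path \<mu> i \<in> arcs E" "tail E (cycle_path \<mu> i) \<in> A"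
    using cycle_path_infinite[OF \<mu>] A[of "Suc i"] by (auto simp: infinite_paths_def)
  then show "{f\<in>arcs E. head E f = head E e \<and> tail E f \<in> A} = {e}"
    using f[of _ i] unfolding e by blast
qed (rule \<mu>)

text \<open>Within \<open>A\<close>, each vertex of the cycle determines the edge that follows it.\<close>

lemma no_entrance_path_unique:
  assumes \<mu>: "cycle_no_entrance E A \<mu>" and y: "y \<in> infinite_paths E" "\<And>i. head E (y i) \<in> A"
    and "head E (y 0) = head E (cycle_path \<mu> k)"
  shows "y i = cycle_path \<mu> (i + k)"
proof -
  have next_tail: "tail E (y j) \<in> A" "y j \<in> arcs E" "tail E (y j) = head E (y (Suc j))" for j
    using y by (auto simp: infinite_paths_def)
  have "head E (y i) = head E (cycle_path \<mu> (i + k))"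
  proof (induction i)
    case (Suc i)
    then have "y i = cycle_path \<mu> (i + k)" using cycle_no_entranceD(4)[OF \<mu>] next_tail by blast
    then have "head E (y (Suc i)) = tail E (cycle_path \<mu> (i + k))" using next_tail(3)[of i] by simp
    then show ?case using cycle_path_infinite[OF cycle_no_entranceD(1)[OF \<mu>]] by (simp add: infinite_paths_def)
  qed (simp add: assms(4))
  then show ?thesis using cycle_no_entranceD(4)[OF \<mu>] next_tail by blast
qed

lemma no_entrance_subset:
  assumes \<mu>: "cycle_no_entrance E A \<mu>" and T: "maximal_tail E T" "T \<subseteq> A" and "head E (cycle_path \<mu> k) \<in> T"
  shows "cycle_no_entrance E T \<mu>"
  using cycle_no_entranceD[OF \<mu>] cycle_path_in_tail[OF T(1) _ assms(4)] T(2)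
  by (intro cycle_no_entranceI) blast+

text \<open>A closed path at \<open>v\<close> lies in every maximal tail containing \<open>v\<close>. There it must follow the cycle
  at \<open>v\<close> that has no entrance in this tail, so that all these cycles coincide.\<close>

lemma no_entrance_Union:
  assumes T: "\<And>T. T \<in> \<T> \<Longrightarrow> maximal_tail E T"
    and cyc: "\<And>T. T \<in> \<T> \<Longrightarrow> v \<in> T \<Longrightarrow> \<exists>\<nu>. cycle_no_entrance E T \<nu> \<and> head E (cycle_path \<nu> 0) = v"
    and T1: "T1 \<in> \<T>" and \<mu>: "cycle_no_entrance E T1 \<mu>" "head E (cycle_path \<mu> 0) = v"
  shows "cycle_no_entrance E (\<Union>\<T>) \<mu>"
proof (rule cycle_no_entranceI)
  note \<mu>D = cycle_no_entranceD[OF \<mu>(1)]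
  show "graph_cycle E \<mu>" by (rule \<mu>D)
  show "head E (cycle_path \<mu> i) \<in> \<Union>\<T>" for i using \<mu>D(3) T1 by blast
  fix f i assume f: "f \<in> arcs E" "head E f = head E (cycle_path \<mu> i)" "tail E f \<in> \<Union>\<T>"
  then obtain T2 where T2: "T2 \<in> \<T>" "tail E f \<in> T2" by blast
  have "head E f \<in> T2" using T[OF T2(1)] f(1) T2(2) by (auto simp: maximal_tail_def)
  then have in2: "head E (cycle_path \<mu> j) \<in> T2" for j
    using cycle_path_in_tail[OF T[OF T2(1)] \<mu>D(1)] f(2) by metis
  then obtain \<nu> where \<nu>: "cycle_no_entrance E T2 \<nu>" "head E (cycle_path \<nu> 0) = v"
    using cyc[OF T2(1)] \<mu>(2) by metis
  have eq: "cycle_path \<mu> j = cycle_path \<nu> j" for j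
    using no_entrance_path_unique[OF \<nu>(1) cycle_path_infinite[OF \<mu>D(1)] in2, of 0 j] \<mu>(2) \<nu>(2) by simp
  show "f = cycle_path \<mu> i"
    using cycle_no_entranceD(4)[OF \<nu>(1) f(1), of i] f(2) T2(2) by (simp add: eq)
qed

lemma class_no_entrance_path:
  assumes y: "y \<in> shift_tail_class E x" and T: "class_vertices E x = T" and \<mu>: "cycle_no_entrance E T \<mu>"
    and "head E (y 0) = head E (cycle_path \<mu> k)"
  shows "y i = cycle_path \<mu> (i + k)"
  using no_entrance_path_unique[OF \<mu> shift_tail_class_paths[OF y] _ assms(4)] class_vertices_path[OF y] T by simp

lemma class_eventually_cycle:
  assumes "class_vertices E x = T" "cycle_no_entrance E T \<mu>"
  obtains a b where "\<And>i. x (i + a) = cycle_path \<mu> (i + b)"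
proof -
  have "head E (cycle_path \<mu> 0) \<in> class_vertices E x" using cycle_no_entranceD(3)[OF assms(2)] assms(1) by simp
  then obtain y where y: "y \<in> shift_tail_class E x" "head E (y 0) = head E (cycle_path \<mu> 0)"
    by (auto simp: class_vertices_def path_range_def)
  then obtain a b where "\<And>i. x (i + a) = y (i + b)" by (auto simp: shift_tail_class_def)
  then have "x (i + a) = cycle_path \<mu> (i + b)" for i
    using class_no_entrance_path[OF y(1) assms y(2), of "i + b"] by simp
  then show ?thesis by (rule that)
qed

text \<open>The length of a cycle without entrance can be read off from any path representing the tail, as
  the eventual period of its vertices. This makes the period of a cyclic tail well defined.\<close>

lemma class_cycle_period:
  assumes x: "class_vertices E x = T" and \<mu>: "cycle_no_entrance E T \<mu>"
    and y: "\<And>i. x (i + a) = y (i + b)"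
  obtains N where "\<And>i q. N \<le> i \<Longrightarrow> head E (y (i + q)) = head E (y i) \<longleftrightarrow> length \<mu> dvd q"
proof -
  obtain c d where cd: "\<And>i. x (i + c) = cycle_path \<mu> (i + d)" by (rule class_eventually_cycle[OF x \<mu>]) blast
  have "y (i + (b + c)) = cycle_path \<mu> (i + (a + d))" for i
    using y[of "i + c"] cd[of "i + a"] by (simp add: ac_simps)
  note yc = this
  have "head E (y (i + q)) = head E (y i) \<longleftrightarrow> length \<mu> dvd q" if i: "b + c \<le> i" for i q
  proof -
    obtain j where j: "i = j + (b + c)" using le_Suc_ex[OF i] by (auto simp: add.commute)
    have "head E (y (i + q)) = head E (y i) \<longleftrightarrow> head E (cycle_path \<mu> (j + (a + d) + q)) = head E (cycle_path \<mu> (j + (a + d)))"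
      using yc[of j] yc[of "j + q"] by (simp add: j ac_simps)
    also have "\<dots> \<longleftrightarrow> (j + (a + d) + q) mod length \<mu> = (j + (a + d)) mod length \<mu>"
      by (rule cycle_path_head_eq_iff[OF cycle_no_entranceD(1)[OF \<mu>]])
    also have "\<dots> \<longleftrightarrow> length \<mu> dvd q"
      by (metis add.commute add_diff_cancel_left' le_add1 mod_eq_dvd_iff_nat)
    finally show ?thesis .
  qed
  then show ?thesis using that by blast
qed

lemma Per_eq_length:
  assumes E: "row_finite_no_sources E" and T: "maximal_tail E T" and \<mu>: "cycle_no_entrance E T \<mu>"
  shows "Per E T = length \<mu>"
proof -
  obtain x where x: "class_vertices E x = T" by (rule maximal_tail_eq_class_vertices[OF E T])
  have "length \<nu> = length \<mu>" if \<nu>: "cycle_no_entrance E T \<nu>" for \<nu>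
  proof -
    obtain M where M: "\<And>i q. M \<le> i \<Longrightarrow> head E (x (i + q)) = head E (x i) \<longleftrightarrow> length \<mu> dvd q"
      by (rule class_cycle_period[OF x \<mu>, of 0 x 0]) auto
    obtain N where N: "\<And>i q. N \<le> i \<Longrightarrow> head E (x (i + q)) = head E (x i) \<longleftrightarrow> length \<nu> dvd q"
      by (rule class_cycle_period[OF x \<nu>, of 0 x 0]) auto
    have "length \<mu> dvd q \<longleftrightarrow> length \<nu> dvd q" for q
      using M[of "max M N" q] N[of "max M N" q] by simp
    from this[of "length \<mu>"] this[of "length \<nu>"] show ?thesis by (simp add: dvd_antisym)
  qed
  then have "(THE n. \<exists>\<mu>. cycle_no_entrance E T \<mu> \<and> n = length \<mu>) = length \<mu>"
    using \<mu> by (intro the_equality) blast+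
  moreover have "cyclic_tail E T" using T \<mu> by (auto simp: cyclic_tail_def)
  ultimately show ?thesis by (simp add: Per_def)
qed

text \<open>If every path of the class starting at \<open>v\<close> is periodic with a bounded period, then \<open>P = M!\<close> is
  a period of all of them. A second edge entering such a path could be taken after \<open>P\<close> more steps,
  which would break the period; so the path is the power of a cycle without entrance.\<close>

lemma bounded_periods_imp_cycle:
  assumes E: "row_finite_no_sources E" and x: "class_vertices E x = T" and v: "v \<in> T"
    and per: "\<And>y. y \<in> shift_tail_class E x \<Longrightarrow> path_range E y = v \<Longrightarrow> \<exists>q\<in>{1..M}. \<forall>i. y (i + q) = y i"
  obtains \<mu> where "cycle_no_entrance E T \<mu>" "head E (cycle_path \<mu> 0) = v"
proof -
  have wf: "wf_digraph E" using E by (simp add: row_finite_no_sources_def)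
  define P where "P = (fact M :: nat)"
  have P0: "0 < P" by (simp add: P_def)
  have perP: "y (i + P) = y i" if y: "y \<in> shift_tail_class E x" "path_range E y = v" for y i
  proof -
    obtain q where q: "1 \<le> q" "q \<le> M" "\<And>i. y (i + q) = y i" using per[OF y] by auto
    have "q dvd P" unfolding P_def using q by (intro dvd_fact)
    then obtain k where k: "P = q * k" by blast
    have "y (i + q * k) = y i" for k
    proof (induction k)
      case (Suc k)
      have "i + q * Suc k = (i + q * k) + q" by simp
      then show ?case using q(3)[of "i + q * k"] Suc by metis
    qed simp
    then show ?thesis by (simp add: k)
  qed
  obtain y where y: "y \<in> shift_tail_class E x" "path_range E y = v"
    using v x by (auto simp: class_vertices_def)
  have yp: "y \<in> infinite_paths E" using y(1) by (rule shift_tail_class_paths)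
  have yT: "head E (y i) \<in> T" for i using class_vertices_path[OF y(1)] x by simp
  have unique: "f = y i" if f: "f \<in> arcs E" "head E f = head E (y i)" "tail E f \<in> T" for f i
  proof -
    obtain z where z: "z \<in> shift_tail_class E x" "path_range E z = tail E f"
      using f(3) x by (auto simp: class_vertices_def)
    let ?c = "path_cons f z" and ?n = "i + P"
    have cp: "?c \<in> infinite_paths E" by (rule infinite_path_cons[OF shift_tail_class_paths[OF z(1)] f(1) z(2)])
    have cn: "path_range E ?c = head E (y ?n)" using f(2) perP[OF y] by (simp add: path_range_def)
    have "graft y ?n ?c \<in> shift_tail_class E x"
    proof (rule shift_tail_class_shift[OF z(1) infinite_path_graft[OF yp cp cn]])
      show "graft y ?n ?c (j + Suc ?n) = z (j + 0)" for j
        by (simp add: graft_def Suc_diff_le)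
    qed
    moreover have "path_range E (graft y ?n ?c) = v" using path_range_graft[of E ?c y ?n, OF cn] y(2) by simp
    ultimately have "graft y ?n ?c (i + P) = graft y ?n ?c i" by (rule perP)
    then show ?thesis using P0 by (simp add: graft_def)
  qed
  have det: "y (i + k) = y (j + k)" if "head E (y i) = head E (y j)" for i j k
  proof (induction k)
    case 0
    have "y j \<in> arcs E" "tail E (y j) \<in> T" using yp yT[of "Suc j"] by (auto simp: infinite_paths_def)
    then show ?case using unique[of "y j" i] that by simp
  next
    case (Suc k)
    have "tail E (y (i + k)) = head E (y (i + Suc k))" "tail E (y (j + k)) = head E (y (j + Suc k))"
      "y (j + Suc k) \<in> arcs E" "tail E (y (j + Suc k)) \<in> T"
      using yp yT[of "Suc (j + Suc k)"] by (auto simp: infinite_paths_def)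
    then show ?case using unique[of "y (j + Suc k)" "i + Suc k"] Suc by simp
  qed
  define q where "q = (LEAST q. 0 < q \<and> head E (y q) = head E (y 0))"
  have "0 < P \<and> head E (y P) = head E (y 0)" using P0 perP[OF y, of 0] by simp
  then have q: "0 < q" "head E (y q) = head E (y 0)" unfolding q_def by (metis (mono_tags, lifting) LeastI)+
  have least: "q \<le> r" if "0 < r" "head E (y r) = head E (y 0)" for r
    unfolding q_def using that by (intro Least_le) simp
  let ?\<mu> = "map y [0..<q]"
  have cyc: "cycle_path ?\<mu> i = y i" for i
  proof -
    have "y (k + q * m) = y k" for k m
    proof (induction m)
      case (Suc m)
      then show ?case using det[OF q(2), of "k + q * m"] by (simp add: algebra_simps)
    qed simp
    from this[of "i mod q" "i div q"] show ?thesis using q(1) by (simp add: cycle_path_def)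
  qed
  have "graph_cycle E ?\<mu>"
    unfolding graph_cycle_def
  proof (intro conjI)
    show "?\<mu> \<noteq> []" using q(1) by simp
    show "\<exists>v. graph_path E v ?\<mu> v" using graph_path_segment[OF yp wf, of q] q(2) by auto
    have "tail E (y i) \<noteq> tail E (y j)" if "i < j" "j < q" for i j
    proof
      assume "tail E (y i) = tail E (y j)"
      then have "head E (y (Suc i)) = head E (y (Suc j))" using yp by (simp add: infinite_paths_def)
      then have "y (Suc i + (q - Suc j)) = y q" using det[of "Suc i" "Suc j" "q - Suc j"] that by simp
      then have "q \<le> Suc i + (q - Suc j)" using q(2) by (intro least) auto
      then show False using that by simp
    qed
    note tails = this
    have "inj_on (tail E \<circ> y) {0..<q}"
    proof (rule inj_onI)
      fix i j assume "i \<in> {0..<q}" "j \<in> {0..<q}" "(tail E \<circ> y) i = (tail E \<circ> y) j"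
      then show "i = j" using tails[of i j] tails[of j i] by (cases i j rule: linorder_cases) auto
    qed
    then show "distinct (map (tail E) ?\<mu>)" by (simp add: distinct_map)
  qed
  then have "cycle_no_entrance E T ?\<mu>"
    by (rule cycle_no_entranceI) (use yT unique in \<open>auto simp: cyc\<close>)
  then show ?thesis using that y(2) by (simp add: cyc path_range_def)
qed

section \<open>Matrix coefficients and their transfer between tails\<close>

definition matrix_coeff ::
    "('v, 'e) pre_digraph \<Rightarrow> complex \<Rightarrow> ('v, 'e) free_elem \<Rightarrow> (nat \<Rightarrow> 'e) \<Rightarrow> (nat \<Rightarrow> 'e) \<Rightarrow> complex" where
  "matrix_coeff E u f y z =
    (\<Sum>W | f W \<noteq> 0. f W * (if word_act E W y = Some z then u powi word_degree W else 0))"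

lemma l2_norm_delta_le: "y \<in> J \<Longrightarrow> l2_norm J (l2_delta y) \<le> 1"
  using l2_finite_support(2)[of "{y}" J "l2_delta y"] by (simp add: l2_delta_def)

lemma abs_word_degree_le: "\<bar>word_degree W\<bar> \<le> int (length W)"
proof (induction W)
  case (Cons l W)
  have "\<bar>letter_degree l\<bar> \<le> 1" by (cases "l" rule: letter_degree.cases) auto
  then show ?case using Cons by simp
qed simp

lemma minimal_period:
  fixes \<tau> :: "nat \<Rightarrow> 'a"
  obtains p where "\<And>i. \<tau> (i + p) = \<tau> i" "\<And>q. (\<And>i. \<tau> (i + q) = \<tau> i) \<Longrightarrow> p dvd q"
proof (cases "\<exists>p>0. \<forall>i. \<tau> (i + p) = \<tau> i")
  case False
  then show ?thesis using that[of 0] by (metis add.right_neutral dvd_0_right gr0I)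
next
  case True
  define p where "p = (LEAST p. 0 < p \<and> (\<forall>i. \<tau> (i + p) = \<tau> i))"
  have p: "0 < p" "\<And>i. \<tau> (i + p) = \<tau> i" using LeastI_ex[OF True] by (auto simp: p_def)
  have least: "p \<le> r" if "0 < r" "\<And>i. \<tau> (i + r) = \<tau> i" for r
    unfolding p_def using that by (intro Least_le) simp
  have mult: "\<tau> (i + k * p) = \<tau> i" for i k
  proof (induction k)
    case (Suc k)
    have "i + Suc k * p = (i + k * p) + p" by simp
    then show ?case using p(2)[of "i + k * p"] Suc by metis
  qed simp
  have "p dvd q" if q: "\<And>i. \<tau> (i + q) = \<tau> i" for q
  proof (rule ccontr)
    assume "\<not> p dvd q"
    then have pos: "0 < q mod p" by (simp add: dvd_eq_mod_eq_0)
    have "\<tau> (i + q mod p) = \<tau> i" for i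
      using mult[of "i + q mod p" "q div p"] q[of i] by (simp add: add.assoc)
    then have "p \<le> q mod p" using pos by (intro least)
    then show False using mod_less_divisor[OF p(1), of q] by simp
  qed
  then show ?thesis using that p by blast
qed

text \<open>A word that maps one path of a class to another can only shift by the difference of the
  offsets of their common tail, up to periods of this tail.\<close>

lemma word_act_lag:
  assumes y1: "y1 \<in> infinite_paths E" and W: "W \<in> lists (letters E)" "length W \<le> n1"
    and act: "word_act E W y1 = Some y2"
    and common: "\<And>i. y2 (i + n2) = y1 (i + n1)"
    and dvd: "\<And>q. (\<And>i. y1 (i + n1 + q) = y1 (i + n1)) \<Longrightarrow> p dvd q"
  obtains k where "word_degree W = int n1 - int n2 - k * int p"
    "\<bar>k\<bar> \<le> int (if p = 0 then 0 else 2 * n1 + n2)"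
proof -
  obtain m where m: "int m = int n1 - word_degree W" "\<And>i. y2 (i + m) = y1 (i + n1)"
    by (rule word_act_graft[OF y1 W(1) act W(2), of "\<lambda>i. y1 (i + n1)"]) (auto simp: path_range_def)
  have "\<bar>word_degree W\<bar> \<le> int n1" using abs_word_degree_le[of W] W(2) by simp
  then have mle: "m \<le> 2 * n1" using m(1) by linarith
  define q where "q = (if n2 \<le> m then m - n2 else n2 - m)"
  have "y1 (i + n1 + q) = y1 (i + n1)" for i
  proof (cases "n2 \<le> m")
    case True
    then have "y2 (i + q + n2) = y2 (i + m)" by (simp add: q_def)
    then show ?thesis using common[of "i + q"] m(2)[of i] by (simp add: ac_simps)
  next
    case False
    then have "y2 (i + q + m) = y2 (i + n2)" by (simp add: q_def)
    then show ?thesis using common[of i] m(2)[of "i + q"] by (simp add: ac_simps)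
  qed
  then obtain k' where k': "q = p * k'" using dvd by blast
  define k where "k = (if p = 0 then 0 else if n2 \<le> m then int k' else - int k')"
  have "word_degree W = int n1 - int n2 - k * int p"
    using m(1) k' by (cases "n2 \<le> m"; cases "p = 0") (auto simp: k_def q_def of_nat_mult[symmetric] of_nat_diff mult.commute simp del: of_nat_mult)
  moreover have "\<bar>k\<bar> \<le> int (if p = 0 then 0 else 2 * n1 + n2)"
  proof (cases "p = 0")
    case False
    then have "k' \<le> q" by (simp add: k')
    also have "q \<le> 2 * n1 + n2" using mle by (auto simp: q_def)
    finally show ?thesis using False by (auto simp: k_def)
  qed (simp add: k_def)
  ultimately show ?thesis using that by blast
qed

context path_space
begin

lemma rep_delta_matrix_coeff: "y \<in> I \<Longrightarrow> rep f (l2_delta z) y = matrix_coeff E u f y z"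
  unfolding free_rep_def matrix_coeff_def
  by (intro sum.cong) (auto simp: partial_shift_def l2_delta_def split: option.splits)

text \<open>An element near the kernel acts with small norm; this is how vanishing of \<open>a\<close> in one
  representation yields estimates for its approximants.\<close>

lemma kernel_small:
  assumes X: "X \<in> CE" and ker: "cls X \<in> rep_kernel (graph_cstar E) I (path_rep E x u)"
    and small: "\<And>k. n \<le> k \<Longrightarrow> U (\<lambda>W. X n W - X k W) \<le> \<epsilon>" and \<eta>: "\<eta> \<in> l2 I"
  shows "l2_norm I (rep (X n) \<eta>) \<le> \<epsilon> * l2_norm I \<eta>"
proof (rule l2_limit(2))
  have "path_hom (cls X) \<eta> = (\<lambda>_. 0)" using ker \<eta> by (simp add: rep_kernel_def path_rep_eq)
  then have "(\<lambda>k. rep (X k) \<eta> i) \<longlonglongrightarrow> 0" for i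
    using lim_rep_tendsto[OF X \<eta>, of i] by (simp add: path_hom_class[OF X \<eta>])
  then have "(\<lambda>k. rep (X n) \<eta> i - rep (X (k + n)) \<eta> i) \<longlonglongrightarrow> rep (X n) \<eta> i - 0" for i
    by (intro tendsto_intros LIMSEQ_ignore_initial_segment)
  then show "(\<lambda>k. rep (X n) \<eta> i - rep (X (k + n)) \<eta> i) \<longlonglongrightarrow> rep (X n) \<eta> i" for i by simp
  show "(\<lambda>i. rep (X n) \<eta> i - rep (X (k + n)) \<eta> i) \<in> l2 I" for k
    by (intro l2_diff rep_l2 carr X \<eta>)
  show "l2_norm I (\<lambda>i. rep (X n) \<eta> i - rep (X (k + n)) \<eta> i) \<le> \<epsilon> * l2_norm I \<eta>" for k
    using order_trans[OF rep_diff_bound[OF carr[OF X] carr[OF X] \<eta>] mult_right_mono[OF small l2_norm_nonneg]] by simp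
  show "rep (X n) \<eta> i = 0" if "i \<notin> I" for i
    using l2_support[OF rep_l2[OF carr[OF X] \<eta>] that] .
qed simp

text \<open>If the common tail of \<open>y1\<close> and \<open>y2\<close> is replaced by a path \<open>t\<close> without short periods, then
  different lags become visible as different basis vectors. Placing \<open>t\<close> after several periods of the
  old tail and weighting the resulting vectors by powers of \<open>(u/v)\<^sup>p\<close> recombines the lags with the
  phases belonging to \<open>v\<close>; since lags are bounded by \<open>K\<close>, a block of \<open>J\<close> output vectors only sees
  \<open>J + 2K\<close> input vectors, so that no lag is lost at the ends of the block.\<close>

lemma matrix_coeff_transfer:
  assumes f: "f \<in> free_carrier E" and len: "\<And>W. f W \<noteq> 0 \<Longrightarrow> length W \<le> n1"
    and y1: "y1 \<in> infinite_paths E" and y2: "y2 \<in> infinite_paths E"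
    and common: "\<And>i. y2 (i + n2) = y1 (i + n1)"
    and p: "\<And>i. y1 (i + n1 + p) = y1 (i + n1)"
    and dvd: "\<And>q. (\<And>i. y1 (i + n1 + q) = y1 (i + n1)) \<Longrightarrow> p dvd q"
    and v: "cmod v = 1"
    and t: "t \<in> I" "path_range E t = head E (y1 n1)"
    and noper: "\<And>q. 0 < q \<Longrightarrow> q \<le> 2 * n1 + n2 + (4 * (2 * n1 + n2) + 1) * p \<Longrightarrow> \<exists>i. t (i + q) \<noteq> t i"
    and bound: "\<And>\<eta>. \<eta> \<in> l2 I \<Longrightarrow> l2_norm I (rep f \<eta>) \<le> \<epsilon> * l2_norm I \<eta>" and \<epsilon>: "0 \<le> \<epsilon>"
  shows "cmod (matrix_coeff E v f y1 y2) \<le> 2 * \<epsilon>"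
proof -
  \<comment> \<open>For an aperiodic tail (\<open>p = 0\<close>) only one lag occurs and a single vector suffices: \<open>K = 0\<close>, \<open>J = R = 1\<close>.
    Otherwise \<open>J \<ge> 2K\<close> keeps the ratio \<open>R / J\<close> bounded by 2.\<close>
  define K where "K = (if p = 0 then 0 else 2 * n1 + n2)"
  define J where "J = max 1 (2 * K)"
  define R where "R = J + 2 * K"
  define M where "M = 2 * n1 + n2 + (4 * (2 * n1 + n2) + 1) * p"
  have J: "0 < J" "R \<le> 2 * J" by (auto simp: J_def R_def)
  have "R \<le> 4 * (2 * n1 + n2) + 1" by (auto simp: R_def J_def K_def)
  then have "R * p \<le> (4 * (2 * n1 + n2) + 1) * p" by (rule mult_right_mono) simp
  then have RM: "2 * n1 + n2 + R * p \<le> M" by (simp add: M_def)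
  \<comment> \<open>Two different positions of \<open>t\<close> in the same path would give \<open>t\<close> a short period.\<close>
  have offset: "m = m'" if "\<And>a. s (a + m) = t a" "\<And>a. s (a + m') = t a" "m \<le> M" "m' \<le> M" for s m m'
  proof -
    have aux: False if s: "\<And>a. s (a + m) = t a" "\<And>a. s (a + m') = t a" and lt: "m < m'" "m' \<le> M" for s m m'
    proof -
      have "t (a + (m' - m)) = t a" for a
        using s(1)[of "a + (m' - m)"] s(2)[of a] lt by simp
      moreover have "\<exists>i. t (i + (m' - m)) \<noteq> t i" using lt by (intro noper) (simp_all add: M_def)
      ultimately show False by blast
    qed
    show ?thesis using aux[of s m m'] aux[of s m' m] that by (metis linorder_neqE_nat)
  qed
  have tp: "t \<in> infinite_paths E" by (rule shift_tail_class_paths[OF t(1)])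
  have per: "y1 (i + n1 + k * p) = y1 (i + n1)" for i k
  proof (induction k)
    case (Suc k)
    have "i + n1 + Suc k * p = (i + k * p) + n1 + p" by simp
    then show ?case using p[of "i + k * p"] Suc by (simp add: ac_simps)
  qed simp
  define z1 where "z1 i = graft y1 (n1 + i * p) t" for i
  define z2 where "z2 j = graft y2 (n2 + j * p) t" for j
  have tr1: "path_range E t = head E (y1 (n1 + i * p))" for i
    using t(2) per[of 0 i] by simp
  have tr2: "path_range E t = head E (y2 (n2 + j * p))" for j
    using t(2) per[of 0 j] common[of "j * p"] by (simp add: ac_simps)
  have z1I: "z1 i \<in> I" for i unfolding z1_def
    by (rule shift_tail_class_shift[OF t(1) infinite_path_graft[OF y1 tp tr1], where m="n1 + i * p" and n=0]) simp
  have z2I: "z2 j \<in> I" for j unfolding z2_def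
    by (rule shift_tail_class_shift[OF t(1) infinite_path_graft[OF y2 tp tr2], where m="n2 + j * p" and n=0]) simp
  have z1_tail: "z1 i (a + (n1 + i * p)) = t a" and z2_tail: "z2 j (a + (n2 + j * p)) = t a" for i j a
    unfolding z1_def z2_def by (rule graft_shift)+
  have pK: "p \<noteq> 0 \<or> R = 1" by (auto simp: R_def J_def K_def)
  have inj2: "inj_on z2 {..<R}"
  proof (rule inj_onI)
    fix i j assume ij: "i \<in> {..<R}" "j \<in> {..<R}" "z2 i = z2 j"
    have le: "i * p \<le> R * p" "j * p \<le> R * p" using ij by auto
    have "n2 + i * p = n2 + j * p"
    proof (rule offset[OF z2_tail])
      show "z2 i (a + (n2 + j * p)) = t a" for a unfolding ij(3) by (rule z2_tail)
      show "n2 + i * p \<le> M" "n2 + j * p \<le> M" using le RM by linarith+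
    qed
    then show "i = j" using pK ij by auto
  qed
  have inj1: "inj_on z1 {K..<K + J}"
  proof (rule inj_onI)
    fix i j assume ij: "i \<in> {K..<K + J}" "j \<in> {K..<K + J}" "z1 i = z1 j"
    have "i < R" "j < R" using ij by (auto simp: R_def)
    then have le: "i * p \<le> R * p" "j * p \<le> R * p" by auto
    have "n1 + i * p = n1 + j * p"
    proof (rule offset[OF z1_tail])
      show "z1 i (a + (n1 + j * p)) = t a" for a unfolding ij(3) by (rule z1_tail)
      show "n1 + i * p \<le> M" "n1 + j * p \<le> M" using le RM by linarith+
    qed
    then show "i = j" using pK \<open>i < R\<close> \<open>j < R\<close> by auto
  qed
  define \<beta> where "\<beta> = u / v"
  have v0: "v \<noteq> 0" using v by auto
  have \<beta>: "cmod \<beta> = 1" "\<beta> \<noteq> 0" using u_nonzero v0 v unit by (auto simp: \<beta>_def norm_divide)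
  define \<eta> where "\<eta> s = (\<Sum>j<R. \<beta> powi (int p * int j) * l2_delta (z2 j) s)" for s
  have \<eta>z: "\<eta> (z2 j) = \<beta> powi (int p * int j)" if "j < R" for j
  proof -
    have "\<eta> (z2 j) = (\<Sum>i<R. if i = j then \<beta> powi (int p * int i) else 0)"
      unfolding \<eta>_def using inj_onD[OF inj2] that by (intro sum.cong) (auto simp: l2_delta_def)
    then show ?thesis using that by simp
  qed
  have \<eta>0: "\<eta> s = 0" if "s \<notin> z2 ` {..<R}" for s
    unfolding \<eta>_def using that by (intro sum.neutral) (auto simp: l2_delta_def)
  have sub: "z2 ` {..<R} \<subseteq> I" using z2I by auto
  have \<eta>_l2: "\<eta> \<in> l2 I" using l2_finite_support(1)[OF _ sub \<eta>0] by simp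
  have "l2_norm I \<eta> \<le> L2_set (\<lambda>s. cmod (\<eta> s)) (z2 ` {..<R})"
    using l2_finite_support(2)[OF _ sub \<eta>0] by simp
  also have "\<dots> = sqrt (\<Sum>j<R. (cmod (\<eta> (z2 j)))\<^sup>2)"
    by (simp add: L2_set_def sum.reindex[OF inj2])
  also have "\<dots> = sqrt (real R)"
    by (simp add: \<eta>z \<beta> norm_power_int)
  finally have \<eta>_norm: "l2_norm I \<eta> \<le> sqrt (real R)" .
  have block: "rep f \<eta> (z1 i) = \<beta> powi (int n1 - int n2 + int p * int i) * matrix_coeff E v f y1 y2"
    if i: "i \<in> {K..<K + J}" for i
  proof -
    have iR: "i < R" using i by (auto simp: R_def)
    have summand: "partial_shift I (u powi word_degree W) (word_act E W) \<eta> (z1 i) =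
        \<beta> powi (int n1 - int n2 + int p * int i) * (if word_act E W y1 = Some y2 then v powi word_degree W else 0)"
      if fW: "f W \<noteq> 0" for W
    proof (cases "word_act E W y1 = Some y2")
      case True
      have W: "W \<in> lists (letters E)" "length W \<le> n1" using f fW len by (auto simp: free_carrier_iff)
      obtain k where k: "word_degree W = int n1 - int n2 - k * int p" "\<bar>k\<bar> \<le> int K"
        using word_act_lag[OF y1 W True common dvd] unfolding K_def by blast
      define j where "j = nat (int i + k)"
      have ij: "int j = int i + k" "j < R" using i k(2) by (auto simp: j_def R_def)
      have "length W \<le> n1 + i * p" using W(2) by simp
      then obtain m where m: "int m = int (n1 + i * p) - word_degree W"
        "word_act E W (graft y1 (n1 + i * p) t) = Some (graft y2 m t)"
        using word_act_graft[OF y1 W(1) True _ tr1, of i] by metis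
      have "int m = int (n2 + j * p)"
        unfolding m(1) k(1) by (simp add: ij algebra_simps)
      then have "m = n2 + j * p" by linarith
      then have "word_act E W (z1 i) = Some (z2 j)" using m(2) by (simp add: z1_def z2_def)
      then have "partial_shift I (u powi word_degree W) (word_act E W) \<eta> (z1 i)
          = u powi word_degree W * \<beta> powi (int p * int j)"
        using z1I \<eta>z[OF ij(2)] by (simp add: partial_shift_def)
      also have "\<dots> = \<beta> powi (word_degree W + int p * int j) * v powi word_degree W"
        using \<beta>(2) v0 by (simp add: power_int_add) (simp add: \<beta>_def power_int_divide_distrib)
      also have "word_degree W + int p * int j = int n1 - int n2 + int p * int i"
        by (simp add: k(1) ij(1) algebra_simps)
      finally show ?thesis using True by simp
    next
      case False
      have W: "W \<in> lists (letters E)" "length W \<le> n1" using f fW len by (auto simp: free_carrier_iff)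
      have "\<eta> s = 0" if act: "word_act E W (z1 i) = Some s" for s
      proof (rule ccontr)
        assume "\<eta> s \<noteq> 0"
        then obtain j where j: "j < R" "s = z2 j" using \<eta>0 by blast
        let ?\<tau> = "\<lambda>a. y1 (a + n1)"
        have "path_range E ?\<tau> = head E (z1 i (n1 + i * p))"
          using t(2) graft_shift[of y1 "n1 + i * p" t 0] by (simp add: z1_def path_range_def)
        moreover have "length W \<le> n1 + i * p" using W(2) by simp
        ultimately obtain m where m: "int m = int (n1 + i * p) - word_degree W"
          "\<And>a. s (a + m) = z1 i (a + (n1 + i * p))"
          "word_act E W (graft (z1 i) (n1 + i * p) ?\<tau>) = Some (graft s m ?\<tau>)"
          using word_act_graft[OF shift_tail_class_paths[OF z1I] W(1) act] by metis
        have "\<bar>word_degree W\<bar> \<le> int n1" using abs_word_degree_le[of W] W(2) by simp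
        then have mle: "m \<le> n1 + i * p + n1" using m(1) by linarith
        have le: "i * p \<le> R * p" "j * p \<le> R * p" using iR j(1) by auto
        have "m = n2 + j * p"
        proof (rule offset[of s])
          show "s (a + m) = t a" for a unfolding m(2) by (rule z1_tail)
          show "s (a + (n2 + j * p)) = t a" for a unfolding j(2) by (rule z2_tail)
          show "m \<le> M" "n2 + j * p \<le> M" using le mle RM by linarith+
        qed
        then have "graft s m ?\<tau> = graft y2 (n2 + j * p) (\<lambda>a. y2 (a + (n2 + j * p)))"
          using per[of _ j] common[of "_ + j * p"] by (simp add: j(2) z2_def ac_simps)
        then have g2: "graft s m ?\<tau> = y2" by simp
        have "graft (z1 i) (n1 + i * p) ?\<tau> = graft y1 (n1 + i * p) (\<lambda>a. y1 (a + (n1 + i * p)))"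
          using per[of _ i] by (simp add: z1_def ac_simps)
        then have "graft (z1 i) (n1 + i * p) ?\<tau> = y1" by simp
        then show False using m(3) g2 False by simp
      qed
      then show ?thesis using False by (auto simp: partial_shift_def split: option.splits)
    qed
    have "rep f \<eta> (z1 i) = (\<Sum>W | f W \<noteq> 0. f W * (\<beta> powi (int n1 - int n2 + int p * int i) *
        (if word_act E W y1 = Some y2 then v powi word_degree W else 0)))"
      unfolding free_rep_def
    proof (rule sum.cong[OF refl])
      fix W assume "W \<in> {W. f W \<noteq> 0}"
      then have "f W \<noteq> 0" by simp
      from summand[OF this] show "f W * partial_shift I (u powi word_degree W) (word_act E W) \<eta> (z1 i) =
        f W * (\<beta> powi (int n1 - int n2 + int p * int i) * (if word_act E W y1 = Some y2 then v powi word_degree W else 0))"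
        by (rule arg_cong)
    qed
    then show ?thesis unfolding matrix_coeff_def sum_distrib_left by (simp add: mult.left_commute)
  qed
  have "sqrt (real J) * cmod (matrix_coeff E v f y1 y2) = sqrt (\<Sum>i\<in>{K..<K + J}. (cmod (rep f \<eta> (z1 i)))\<^sup>2)"
    by (simp add: block norm_mult norm_power_int \<beta> real_sqrt_mult)
  also have "\<dots> = L2_set (\<lambda>s. cmod (rep f \<eta> s)) (z1 ` {K..<K + J})"
    by (simp add: L2_set_def sum.reindex[OF inj1])
  also have "\<dots> \<le> l2_norm I (rep f \<eta>)"
    using z1I by (intro L2_set_le_l2_norm rep_l2[OF f \<eta>_l2]) auto
  also have "\<dots> \<le> \<epsilon> * l2_norm I \<eta>" by (rule bound[OF \<eta>_l2])
  also have "\<dots> \<le> \<epsilon> * (2 * sqrt (real J))"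
  proof (intro mult_left_mono \<epsilon> order_trans[OF \<eta>_norm])
    have "real R \<le> 4 * real J" using J by simp
    then have "sqrt (real R) \<le> sqrt (4 * real J)" by (rule real_sqrt_le_mono)
    then show "sqrt (real R) \<le> 2 * sqrt (real J)" by (simp add: real_sqrt_mult)
  qed
  finally have "sqrt (real J) * cmod (matrix_coeff E v f y1 y2) \<le> sqrt (real J) * (2 * \<epsilon>)" by (simp add: ac_simps)
  then show ?thesis using J(1) by simp
qed

end

text \<open>The ideal is defined through an arbitrary choice of a path and a scalar; everything that follows
  works for whichever pair was chosen.\<close>

lemma tail_ideal_representation:
  assumes E: "row_finite_no_sources E" and Tz: "(T, z) \<in> tail_pairs E"
  obtains x u where "path_space E x u" "class_vertices E x = T" "u ^ Per E T = z"
    "tail_ideal E T z = rep_kernel (graph_cstar E) (shift_tail_class E x) (path_rep E x u)"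
proof -
  let ?R = "\<lambda>(x, u). x \<in> infinite_paths E \<and> u \<in> sphere 0 1 \<and> class_vertices E x = T \<and> u ^ Per E T = z"
  have T: "maximal_tail E T" and "\<exists>u. u \<in> sphere 0 1 \<and> z = u ^ Per E T" using Tz by (auto simp: tail_pairs_def)
  then obtain u :: complex where u: "u \<in> sphere 0 1" "u ^ Per E T = z" by blast
  obtain x where x: "x \<in> infinite_paths E" "class_vertices E x = T" by (rule maximal_tail_eq_class_vertices[OF E T])
  define xu where "xu = (SOME xu. ?R xu)"
  have xu: "?R xu" unfolding xu_def using u x by (intro someI[of ?R "(x, u)"]) simp
  have ideal: "tail_ideal E T z = (let (x, u) = xu in rep_kernel (graph_cstar E) (shift_tail_class E x) (path_rep E x u))"
    by (simp add: tail_ideal_def xu_def)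
  obtain x' u' where x'u': "xu = (x', u')" by (cases xu)
  have "path_space E x' u'" using xu E by (simp add: path_space_def x'u')
  then show ?thesis using that[of x' u'] xu ideal by (simp add: x'u')
qed

section \<open>Sufficiency of the two conditions\<close>

text \<open>In the cyclic case only powers of \<open>u\<^sup>p\<close> occur in the matrix coefficients, up to a common phase;
  so their absolute values depend continuously on \<open>z = u\<^sup>p\<close>.\<close>

lemma matrix_coeff_closure:
  assumes f: "f \<in> free_carrier E" and len: "\<And>W. f W \<noteq> 0 \<Longrightarrow> length W \<le> n1"
    and y1: "y1 \<in> infinite_paths E"
    and common: "\<And>i. y2 (i + n2) = y1 (i + n1)" and p: "0 < p"
    and dvd: "\<And>q. (\<And>i. y1 (i + n1 + q) = y1 (i + n1)) \<Longrightarrow> p dvd q"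
    and v: "cmod v = 1" and closure: "v ^ p \<in> closure Z"
    and bound: "\<And>z. z \<in> Z \<Longrightarrow> \<exists>u. cmod u = 1 \<and> u ^ p = z \<and> cmod (matrix_coeff E u f y1 y2) \<le> \<epsilon>"
  shows "cmod (matrix_coeff E v f y1 y2) \<le> \<epsilon>"
proof -
  define k where "k W = (int n1 - int n2 - word_degree W) div int p" for W :: "('a, 'b) letter list"
  define G where "G z = (\<Sum>W | f W \<noteq> 0. f W * (if word_act E W y1 = Some y2 then z powi (- k W) else 0))" for z :: complex
  have coeff: "cmod (matrix_coeff E u f y1 y2) = cmod (G (u ^ p))" if u: "cmod u = 1" for u
  proof -
    have u0: "u \<noteq> 0" using u by auto
    have summand: "f W * (if word_act E W y1 = Some y2 then u powi word_degree W else 0) =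
        u powi (int n1 - int n2) * (f W * (if word_act E W y1 = Some y2 then (u ^ p) powi (- k W) else 0))"
      if fW: "f W \<noteq> 0" for W
    proof (cases "word_act E W y1 = Some y2")
      case True
      have W: "W \<in> lists (letters E)" "length W \<le> n1" using f fW len by (auto simp: free_carrier_iff)
      obtain l where l: "word_degree W = int n1 - int n2 - l * int p"
        using word_act_lag[OF y1 W True common dvd] by blast
      then have kl: "k W = l" using p by (simp add: k_def)
      have "u powi word_degree W = u powi (int n1 - int n2) * u powi (int p * (- k W))"
        using u0 by (subst power_int_add[symmetric]) (auto simp: l kl mult.commute)
      then show ?thesis using True by (simp add: power_int_power)
    qed simp
    have "matrix_coeff E u f y1 y2 = u powi (int n1 - int n2) * G (u ^ p)"
      unfolding matrix_coeff_def G_def sum_distrib_left by (intro sum.cong refl summand) simp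
    then show ?thesis using u by (simp add: norm_mult norm_power_int)
  qed
  obtain s where s: "\<And>m. s m \<in> Z" "s \<longlonglongrightarrow> v ^ p" using closure by (auto simp: closure_sequential)
  have vp: "v ^ p \<noteq> 0" using v by auto
  have "(\<lambda>m. f W * (if word_act E W y1 = Some y2 then s m powi (- k W) else 0)) \<longlonglongrightarrow>
      f W * (if word_act E W y1 = Some y2 then (v ^ p) powi (- k W) else 0)" for W
    by (cases "word_act E W y1 = Some y2") (use vp s(2) in \<open>auto intro!: tendsto_intros\<close>)
  then have "(\<lambda>m. cmod (G (s m))) \<longlonglongrightarrow> cmod (G (v ^ p))"
    unfolding G_def by (intro tendsto_norm tendsto_sum)
  moreover have "cmod (G (s m)) \<le> \<epsilon>" for m
    using bound[OF s(1)[of m]] coeff by metis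
  ultimately have "cmod (G (v ^ p)) \<le> \<epsilon>"
    by (intro LIMSEQ_le_const2) auto
  then show ?thesis using coeff[OF v] by simp
qed

text \<open>Replacing the tail \<open>\<tau>\<close> of the two paths by paths without short periods from the tails in \<open>X\<close>
  works unless, for some \<open>M\<close>, all paths of these tails with range \<open>v = r(\<tau>)\<close> have a period at most
  \<open>M\<close>. In that case all tails in \<open>X\<close> through \<open>v\<close> contain the same cycle at \<open>v\<close> without entrance.\<close>

lemma tail_ideal_inclusion_if:
  assumes E: "row_finite_no_sources E" and X: "X \<subseteq> tail_pairs E" and Sw: "(S, w) \<in> tail_pairs E"
    and cover: "S \<subseteq> (\<Union>(T, z)\<in>X. T)"
    and closure: "\<And>\<mu>. cycle_no_entrance E S \<mu> \<Longrightarrow> cycle_no_entrance E (\<Union>(T, z)\<in>X. T) \<mu> \<Longrightarrow> w \<in> closure {z. (S, z) \<in> X}"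
  shows "sa_carrier (graph_cstar E) \<inter> (\<Inter>(T, z)\<in>X. tail_ideal E T z) \<subseteq> tail_ideal E S w"
proof
  fix a assume a: "a \<in> sa_carrier (graph_cstar E) \<inter> (\<Inter>(T, z)\<in>X. tail_ideal E T z)"
  obtain x u where ps: "path_space E x u" and xS: "class_vertices E x = S" and uw: "u ^ Per E S = w"
    and ideal: "tail_ideal E S w = rep_kernel (graph_cstar E) (shift_tail_class E x) (path_rep E x u)"
    by (rule tail_ideal_representation[OF E Sw])
  interpret path_space E x u by (rule ps)
  have S: "maximal_tail E S" using Sw by (auto simp: tail_pairs_def)
  obtain A where A: "A \<in> CE" and aA: "a = cls A" using graph_cstar_cases a by blast
  have ker: "cls A \<in> tail_ideal E T z" if "(T, z) \<in> X" for T z using a that by (auto simp: aA)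
  show "a \<in> tail_ideal E S w"
    unfolding ideal aA kernel_iff[OF A]
  proof (intro ballI LIMSEQ_I)
    fix y1 y2 and \<epsilon> :: real assume yI: "y1 \<in> I" "y2 \<in> I" and \<epsilon>: "0 < \<epsilon>"
    note yp = shift_tail_class_paths[OF yI(1)] shift_tail_class_paths[OF yI(2)]
    obtain m1 m2 where m: "\<And>i. y2 (i + m2) = y1 (i + m1)"
    proof -
      obtain a1 b1 where 1: "\<And>i. x (i + a1) = y1 (i + b1)" using yI(1) by (auto simp: shift_tail_class_def)
      obtain a2 b2 where 2: "\<And>i. x (i + a2) = y2 (i + b2)" using yI(2) by (auto simp: shift_tail_class_def)
      have "y2 (i + (a1 + b2)) = y1 (i + (a2 + b1))" for i
        using 1[of "i + a2"] 2[of "i + a1"] by (simp add: ac_simps)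
      then show ?thesis using that by blast
    qed
    obtain N where N: "\<And>j k. j \<ge> N \<Longrightarrow> k \<ge> N \<Longrightarrow> U (\<lambda>W. A j W - A k W) < \<epsilon> / 4"
      using cauchy_seqs_small[OF cs A, of "\<epsilon> / 4"] \<epsilon> by auto
    have "cmod (rep (A n) (l2_delta y2) y1) \<le> \<epsilon> / 2" if n: "N \<le> n" for n
    proof -
      let ?f = "A n"
      have f: "?f \<in> free_carrier E" by (rule carr[OF A])
      have small: "l2_norm (shift_tail_class E x') (free_rep E (shift_tail_class E x') u' ?f \<eta>)
            \<le> \<epsilon> / 4 * l2_norm (shift_tail_class E x') \<eta>"
        if "path_space E x' u'" "(T, z) \<in> X" "\<eta> \<in> l2 (shift_tail_class E x')"
          "tail_ideal E T z = rep_kernel (graph_cstar E) (shift_tail_class E x') (path_rep E x' u')" for x' u' T z \<eta>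
        using path_space.kernel_small[OF that(1) A _ _ that(3), of n "\<epsilon> / 4"] ker[OF that(2)] N[OF n] n
        by (simp add: that(4) less_imp_le)
      define l where "l = Max (insert 0 (length ` {W. ?f W \<noteq> 0}))"
      have l: "length W \<le> l" if "?f W \<noteq> 0" for W
        unfolding l_def using f that by (intro Max_ge) (auto simp: free_carrier_iff)
      \<comment> \<open>Lengthening both initial segments by \<open>l\<close> keeps the words of \<open>f\<close> away from the common tail.\<close>
      define n1 where "n1 = m1 + l"
      define n2 where "n2 = m2 + l"
      have len: "length W \<le> n1" if "?f W \<noteq> 0" for W using l[OF that] by (simp add: n1_def)
      have common: "y2 (i + n2) = y1 (i + n1)" for i using m[of "i + l"] by (simp add: n1_def n2_def ac_simps)
      define v where "v = head E (y1 n1)"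
      have vS: "v \<in> S" using class_vertices_path[OF yI(1), of n1] xS by (simp add: v_def)
      have coeff: "rep ?f (l2_delta y2) y1 = matrix_coeff E u ?f y1 y2" by (rule rep_delta_matrix_coeff[OF yI(1)])
      define aperiodic where "aperiodic M \<longleftrightarrow> (\<exists>T z x' u' t. (T, z) \<in> X \<and> path_space E x' u' \<and> class_vertices E x' = T \<and>
          tail_ideal E T z = rep_kernel (graph_cstar E) (shift_tail_class E x') (path_rep E x' u') \<and>
          t \<in> shift_tail_class E x' \<and> path_range E t = v \<and> (\<forall>q. 0 < q \<longrightarrow> q \<le> M \<longrightarrow> (\<exists>i. t (i + q) \<noteq> t i)))" for M
      show ?thesis
      proof (cases "\<forall>M. aperiodic M")
        case True
        obtain p where p: "\<And>i. y1 (i + p + n1) = y1 (i + n1)"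
          "\<And>q. (\<And>i. y1 (i + q + n1) = y1 (i + n1)) \<Longrightarrow> p dvd q"
          by (rule minimal_period[of "\<lambda>i. y1 (i + n1)"]) blast
        let ?M = "2 * n1 + n2 + (4 * (2 * n1 + n2) + 1) * p"
        obtain T z x' u' t where T: "(T, z) \<in> X" "path_space E x' u'"
            "tail_ideal E T z = rep_kernel (graph_cstar E) (shift_tail_class E x') (path_rep E x' u')"
          and t: "t \<in> shift_tail_class E x'" "path_range E t = v"
            "\<And>q. 0 < q \<Longrightarrow> q \<le> ?M \<Longrightarrow> \<exists>i. t (i + q) \<noteq> t i"
          using spec[OF True, of ?M] unfolding aperiodic_def by blast
        have "cmod (matrix_coeff E u ?f y1 y2) \<le> 2 * (\<epsilon> / 4)"
        proof (rule path_space.matrix_coeff_transfer[OF T(2) f len yp common _ _ unit t(1) _ t(3)])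
          show "y1 (i + n1 + p) = y1 (i + n1)" for i using p(1)[of i] by (simp add: ac_simps)
          show "p dvd q" if "\<And>i. y1 (i + n1 + q) = y1 (i + n1)" for q
            using that by (intro p(2)) (simp add: ac_simps)
          show "path_range E t = head E (y1 n1)" using t(2) by (simp add: v_def)
          show "l2_norm (shift_tail_class E x') (free_rep E (shift_tail_class E x') u' ?f \<eta>)
            \<le> \<epsilon> / 4 * l2_norm (shift_tail_class E x') \<eta>" if "\<eta> \<in> l2 (shift_tail_class E x')" for \<eta>
            by (rule small[OF T(2,1) that T(3)])
        qed (use \<epsilon> in auto)
        then show ?thesis by (simp add: coeff)
      next
        case False
        then obtain M where M: "\<not> aperiodic M" by blast
        have cyc: "\<exists>\<nu>. cycle_no_entrance E T \<nu> \<and> head E (cycle_path \<nu> 0) = v" if T: "T \<in> fst ` X" "v \<in> T" for T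
        proof -
          obtain z where Tz: "(T, z) \<in> X" using T(1) by auto
          obtain x' u' where x': "path_space E x' u'" "class_vertices E x' = T"
            "tail_ideal E T z = rep_kernel (graph_cstar E) (shift_tail_class E x') (path_rep E x' u')"
            using tail_ideal_representation[OF E] X Tz by blast
          have "\<exists>q\<in>{1..M}. \<forall>i. t (i + q) = t i" if "t \<in> shift_tail_class E x'" "path_range E t = v" for t
          proof -
            have "\<not> (\<forall>q. 0 < q \<longrightarrow> q \<le> M \<longrightarrow> (\<exists>i. t (i + q) \<noteq> t i))"
              using M Tz x' that unfolding aperiodic_def by blast
            then show ?thesis by (auto simp: Suc_le_eq)
          qed
          from bounded_periods_imp_cycle[OF E x'(2) T(2) this] show ?thesis by blast
        qed
        have un: "(\<Union>(T, z)\<in>X. T) = \<Union>(fst ` X)" by auto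
        obtain T1 where T1: "T1 \<in> fst ` X" "v \<in> T1" using cover[unfolded un] vS by blast
        obtain \<mu> where \<mu>: "cycle_no_entrance E T1 \<mu>" "head E (cycle_path \<mu> 0) = v" using cyc[OF T1] by blast
        have "maximal_tail E T" if "T \<in> fst ` X" for T using that X by (auto simp: tail_pairs_def)
        then have \<mu>U: "cycle_no_entrance E (\<Union>(T, z)\<in>X. T) \<mu>"
          unfolding un by (rule no_entrance_Union[OF _ cyc T1(1) \<mu>])
        have \<mu>S: "cycle_no_entrance E S \<mu>"
          by (rule no_entrance_subset[OF \<mu>U S cover, of 0]) (simp add: \<mu>(2) vS)
        have \<mu>c: "graph_cycle E \<mu>" "\<mu> \<noteq> []" using cycle_no_entranceD[OF \<mu>S] by auto
        have Per: "Per E S = length \<mu>" by (rule Per_eq_length[OF E S \<mu>S])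
        let ?\<tau> = "\<lambda>i. y1 (i + n1)"
        have "?\<tau> \<in> I"
          using shift_tail_class_shift[OF yI(1) infinite_path_shift[OF yp(1)], of 0 n1] by simp
        then have \<tau>: "y1 (i + n1) = cycle_path \<mu> i" for i
          using class_no_entrance_path[OF _ xS \<mu>S, of ?\<tau> 0 i] \<mu>(2) by (simp add: v_def)
        have "cmod (matrix_coeff E u ?f y1 y2) \<le> \<epsilon> / 4"
        proof (rule matrix_coeff_closure[OF f len yp(1) common _ _ unit])
          show "0 < length \<mu>" using \<mu>c by simp
          show "length \<mu> dvd q" if q: "\<And>i. y1 (i + n1 + q) = y1 (i + n1)" for q
          proof -
            have "head E (cycle_path \<mu> q) = head E (cycle_path \<mu> 0)" using q[of 0] \<tau>[of q] \<tau>[of 0] by (simp add: ac_simps)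
            then show ?thesis by (simp add: cycle_path_head_eq_iff[OF \<mu>c(1)] dvd_eq_mod_eq_0)
          qed
          show "u ^ length \<mu> \<in> closure {z. (S, z) \<in> X}" using closure[OF \<mu>S \<mu>U] uw by (simp add: Per)
          fix z assume z: "z \<in> {z. (S, z) \<in> X}"
          obtain x' u' where x': "path_space E x' u'" "class_vertices E x' = S" "u' ^ Per E S = z"
            "tail_ideal E S z = rep_kernel (graph_cstar E) (shift_tail_class E x') (path_rep E x' u')"
            using tail_ideal_representation[OF E] X z by blast
          obtain t where t: "t \<in> shift_tail_class E x'" "path_range E t = v"
            using vS x'(2) by (auto simp: class_vertices_def)
          have tc: "t i = cycle_path \<mu> i" for i
            using class_no_entrance_path[OF t(1) x'(2) \<mu>S, of 0 i] t(2) \<mu>(2) by (simp add: path_range_def)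
          have y': "y1 \<in> shift_tail_class E x'" "y2 \<in> shift_tail_class E x'"
            using shift_tail_class_shift[OF t(1) yp(1), of n1 0] shift_tail_class_shift[OF t(1) yp(2), of n2 0]
            by (simp_all add: common \<tau> tc)
          let ?I = "shift_tail_class E x'"
          have d: "l2_delta y2 \<in> l2 ?I" by (rule l2_delta_in[OF y'(2)])
          have "cmod (matrix_coeff E u' ?f y1 y2) = cmod (free_rep E ?I u' ?f (l2_delta y2) y1)"
            by (simp add: path_space.rep_delta_matrix_coeff[OF x'(1) y'(1)])
          also have "\<dots> \<le> l2_norm ?I (free_rep E ?I u' ?f (l2_delta y2))"
            by (rule cmod_le_l2_norm[OF path_space.rep_l2[OF x'(1) f d]])
          also have "\<dots> \<le> \<epsilon> / 4 * l2_norm ?I (l2_delta y2)"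
            using z by (intro small[OF x'(1) _ d x'(4)]) simp
          also have "\<dots> \<le> \<epsilon> / 4 * 1"
            using \<epsilon> by (intro mult_left_mono l2_norm_delta_le[OF y'(2)]) simp
          finally show "\<exists>u'. cmod u' = 1 \<and> u' ^ length \<mu> = z \<and> cmod (matrix_coeff E u' ?f y1 y2) \<le> \<epsilon> / 4"
            using x'(3) path_space.unit[OF x'(1)] by (auto simp: Per)
        qed
        then show ?thesis using \<epsilon> by (simp add: coeff)
      qed
    qed
    moreover have "\<epsilon> / 2 < \<epsilon>" using \<epsilon> by simp
    ultimately show "\<exists>no. \<forall>n\<ge>no. norm (rep (A n) (l2_delta y2) y1 - 0) < \<epsilon>"
      by (metis diff_zero order_le_less_trans)
  qed
qed

section \<open>Necessity of the two conditions\<close>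

subsection \<open>Square roots in the completion\<close>

text \<open>The iteration \<open>q \<mapsto> (b + q\<^sup>2) / 2\<close> converges to \<open>1 - sqrt (1 - b)\<close> when \<open>\<parallel>b\<parallel> \<le> 1\<close>. Since it has
  nonnegative coefficients, its increments are dominated by those for the scalar \<open>b = 1\<close>.\<close>

primrec sqrt_iter :: "('v, 'e) pre_digraph \<Rightarrow> ('v, 'e) free_elem \<Rightarrow> nat \<Rightarrow> ('v, 'e) free_elem" where
  "sqrt_iter E b 0 = (\<lambda>_. 0)"
| "sqrt_iter E b (Suc k) = (\<lambda>W. 1/2 * (b W + sa_mult (free_alg E) (sqrt_iter E b k) (sqrt_iter E b k) W))"

primrec real_sqrt_iter :: "real \<Rightarrow> nat \<Rightarrow> real" where
  "real_sqrt_iter \<beta> 0 = 0"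
| "real_sqrt_iter \<beta> (Suc k) = (\<beta> + (real_sqrt_iter \<beta> k)\<^sup>2) / 2"

lemma real_sqrt_iter_bounds:
  assumes r: "0 \<le> r" "r \<le> 1"
  shows "0 \<le> real_sqrt_iter (1 - r\<^sup>2) k" "real_sqrt_iter (1 - r\<^sup>2) k \<le> 1 - r"
    "real_sqrt_iter (1 - r\<^sup>2) k \<le> real_sqrt_iter (1 - r\<^sup>2) (Suc k)"
proof -
  let ?s = "real_sqrt_iter (1 - r\<^sup>2)"
  have r2: "r\<^sup>2 \<le> 1" using r by (simp add: power_le_one)
  have b: "0 \<le> ?s k \<and> ?s k \<le> 1 - r" for k
  proof (induction k)
    case (Suc k)
    have "(?s k)\<^sup>2 \<le> (1 - r)\<^sup>2" using Suc by (intro power_mono) auto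
    then have "(?s k)\<^sup>2 \<le> 1 - 2 * r + r\<^sup>2" by (simp add: power2_diff)
    moreover have "0 \<le> (1 - a + c) / 2 \<and> (1 - a + c) / 2 \<le> 1 - r" if "c \<le> 1 - 2 * r + a" "0 \<le> c" "a \<le> 1" for a c
      using that by simp
    ultimately show ?case using r2 unfolding real_sqrt_iter.simps by (meson zero_le_power2)
  qed (use r in simp)
  have m: "?s k \<le> ?s (Suc k)" for k
  proof (induction k)
    case 0
    then show ?case using r2 by simp
  next
    case (Suc k)
    then have "(?s k)\<^sup>2 \<le> (?s (Suc k))\<^sup>2" using b[of k] by (intro power_mono) auto
    then show ?case by simp
  qed
  show "0 \<le> ?s k" "?s k \<le> 1 - r" "?s k \<le> ?s (Suc k)" using b m by auto
qed

lemma real_sqrt_iter_tendsto: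
  assumes r: "0 \<le> r" "r \<le> 1"
  shows "real_sqrt_iter (1 - r\<^sup>2) \<longlonglongrightarrow> 1 - r"
proof -
  let ?s = "real_sqrt_iter (1 - r\<^sup>2)"
  note b = real_sqrt_iter_bounds[OF r]
  have "incseq ?s" by (rule incseq_SucI) (rule b)
  then obtain l where l: "?s \<longlonglongrightarrow> l" using incseq_convergent[of ?s "1 - r"] b(2) by blast
  have l1: "l \<le> 1 - r" by (rule LIMSEQ_le_const2[OF l]) (use b(2) in blast)
  have "(\<lambda>k. ?s (Suc k)) \<longlonglongrightarrow> (1 - r\<^sup>2 + l\<^sup>2) / 2" by (simp, intro tendsto_intros l) simp
  then have "l = (1 - r\<^sup>2 + l\<^sup>2) / 2" using LIMSEQ_Suc[OF l] LIMSEQ_unique by blast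
  moreover have "2 * l = 1 - a + c" if "l = (1 - a + c) / 2" for a c using that by simp
  ultimately have "2 * l = 1 - r\<^sup>2 + l\<^sup>2" by blast
  moreover have "(1 - l)\<^sup>2 = 1 - 2 * l + l\<^sup>2" by (simp add: power2_diff)
  ultimately have "(1 - l)\<^sup>2 = r\<^sup>2" by linarith
  then have "1 - l = r" by (rule power2_eq_imp_eq) (use l1 r in linarith)+
  then have "l = 1 - r" by linarith
  then show ?thesis using l by blast
qed

lemma sqrt_iter_carrier: "b \<in> free_carrier E \<Longrightarrow> sqrt_iter E b k \<in> free_carrier E"
  by (induction k) (simp_all only: sqrt_iter.simps free_carrier_0 free_carrier_scale free_carrier_add free_carrier_mult)

lemma sqrt_iter_cauchy:
  assumes \<rho>: "cstar_seminorm (free_alg E) \<rho>" and b: "b \<in> free_carrier E" "\<rho> b \<le> 1"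
  shows "sqrt_iter E b \<in> cauchy_seqs (free_alg E) \<rho>"
proof -
  let ?q = "sqrt_iter E b" and ?t = "real_sqrt_iter 1"
  note [simp] = sqrt_iter_carrier[OF b(1)]
  have t: "0 \<le> ?t k" "?t k \<le> ?t (Suc k)" for k
    using real_sqrt_iter_bounds[of 0 k] by simp_all
  have norm: "\<rho> (?q k) \<le> ?t k" for k
  proof (induction k)
    case (Suc k)
    have "\<rho> (?q (Suc k)) = 1/2 * \<rho> (\<lambda>W. b W + sa_mult (free_alg E) (?q k) (?q k) W)"
      using b by (subst sqrt_iter.simps, subst seminorm_scale[OF \<rho>]) simp_all
    also have "\<dots> \<le> 1/2 * (\<rho> b + \<rho> (?q k) * \<rho> (?q k))"
      using seminorm_add[OF \<rho> b(1), of "sa_mult (free_alg E) (?q k) (?q k)"] seminorm_mult[OF \<rho>, of "?q k" "?q k"] by simp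
    also have "\<rho> (?q k) * \<rho> (?q k) \<le> (?t k)\<^sup>2"
      using Suc seminorm_nonneg[OF \<rho>, of "?q k"] by (simp add: power2_eq_square mult_mono t)
    finally show ?case using b(2) by simp
  qed (simp add: seminorm_0[OF \<rho>])
  have inc: "\<rho> (\<lambda>W. ?q (Suc k) W - ?q k W) \<le> ?t (Suc k) - ?t k" for k
  proof (induction k)
    case 0
    have "(\<lambda>W. ?q (Suc 0) W - ?q 0 W) = (\<lambda>W. 1/2 * b W)"
      by (simp add: free_mult)
    then show ?case using seminorm_scale[OF \<rho> b(1), of "1/2"] b(2) by simp
  next
    case (Suc k)
    let ?d = "\<rho> (\<lambda>W. ?q (Suc k) W - ?q k W)"
    have "(\<lambda>W. ?q (Suc (Suc k)) W - ?q (Suc k) W) =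
        (\<lambda>W. 1/2 * (sa_mult (free_alg E) (?q (Suc k)) (?q (Suc k)) W - sa_mult (free_alg E) (?q k) (?q k) W))"
      by (subst sqrt_iter.simps(2)[of E b "Suc k"], subst sqrt_iter.simps(2)[of E b k]) (simp add: algebra_simps)
    then have "\<rho> (\<lambda>W. ?q (Suc (Suc k)) W - ?q (Suc k) W) =
        1/2 * \<rho> (\<lambda>W. sa_mult (free_alg E) (?q (Suc k)) (?q (Suc k)) W - sa_mult (free_alg E) (?q k) (?q k) W)"
      by (simp only:, subst seminorm_scale[OF \<rho>]) (simp_all del: sqrt_iter.simps)
    also have "\<dots> \<le> 1/2 * (\<rho> (?q (Suc k)) * ?d + ?d * \<rho> (?q k))"
      using seminorm_mult_diff[OF \<rho>, of "?q (Suc k)" "?q (Suc k)" "?q k" "?q k"] by (simp del: sqrt_iter.simps)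
    also have "\<dots> \<le> 1/2 * (?t (Suc k) * (?t (Suc k) - ?t k) + (?t (Suc k) - ?t k) * ?t k)"
      using norm[of k] norm[of "Suc k"] Suc t[of k] t[of "Suc k"]
        seminorm_nonneg[OF \<rho>, of "?q k"] seminorm_nonneg[OF \<rho>, of "?q (Suc k)"]
        seminorm_nonneg[OF \<rho>, of "\<lambda>W. ?q (Suc k) W - ?q k W"]
      by (intro mult_left_mono add_mono mult_mono) (simp_all del: sqrt_iter.simps real_sqrt_iter.simps)
    also have "\<dots> = ?t (Suc (Suc k)) - ?t (Suc k)"
    proof -
      have "1/2 * (c * (c - a) + (c - a) * a) = (1 + c\<^sup>2) / 2 - (1 + a\<^sup>2) / 2" for a c :: real
        by (simp add: power2_eq_square field_simps)
      then show ?thesis by (simp only: real_sqrt_iter.simps(2)[of 1 "Suc k"] real_sqrt_iter.simps(2)[of 1 k, symmetric])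
    qed
    finally show ?case .
  qed
  have diff: "\<rho> (\<lambda>W. ?q j W - ?q k W) \<le> ?t j - ?t k" if "k \<le> j" for j k
    using that
  proof (induction j rule: dec_induct)
    case (step j)
    then show ?case
      using inc[of j] seminorm_triangle[OF \<rho>, of "?q (Suc j)" "?q j" "?q k"] by (simp del: sqrt_iter.simps real_sqrt_iter.simps)
  qed (simp add: seminorm_0[OF \<rho>])
  have sym: "\<rho> (\<lambda>W. ?q j W - ?q k W) \<le> \<bar>?t j - ?t k\<bar>" for j k
    using diff[of k j] diff[of j k] seminorm_minus_commute[OF \<rho>, of "?q j" "?q k"] by (cases "k \<le> j") auto
  have "Cauchy ?t" using real_sqrt_iter_tendsto[of 0] by (simp add: LIMSEQ_imp_Cauchy)
  then have "\<exists>N. \<forall>j\<ge>N. \<forall>k\<ge>N. \<rho> (\<lambda>W. ?q j W - ?q k W) < \<epsilon>" if "0 < \<epsilon>" for \<epsilon>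
    using that sym order_le_less_trans unfolding Cauchy_def dist_real_def by meson
  then show ?thesis by (simp add: cauchy_seqs_def)
qed

subsection \<open>Elements supported near one point of the spectrum of a cycle\<close>

definition cycle_word :: "'e list \<Rightarrow> ('v, 'e) letter list" where
  "cycle_word \<mu> = map (\<lambda>e. (Edge e, False)) \<mu>"

text \<open>With \<open>z\<close> the value of the cycle in a representation, \<open>cycle_real d\<close> takes the value \<open>Re (d z)\<close>
  and \<open>cycle_defect v d\<close> the value \<open>1 - (Re (d z))\<^sup>2\<close>. The latter is written without the products
  of the cycle with its adjoint, so that its coefficients have absolute sum 1 when \<open>cmod d \<le> 1\<close>.\<close>

definition cycle_real :: "'e list \<Rightarrow> complex \<Rightarrow> ('v, 'e) free_elem" where
  "cycle_real \<mu> d = (\<lambda>W. d / 2 * monomial (cycle_word \<mu>) W + cnj d / 2 * monomial (adj_word (cycle_word \<mu>)) W)"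

definition cycle_defect :: "'v \<Rightarrow> 'e list \<Rightarrow> complex \<Rightarrow> ('v, 'e) free_elem" where
  "cycle_defect v \<mu> d = (\<lambda>W. complex_of_real (1 - (cmod d)\<^sup>2 / 2) * monomial [(Vert v, False)] W
     - (d\<^sup>2 / 4 * monomial (cycle_word \<mu> @ cycle_word \<mu>) W
        + cnj (d\<^sup>2) / 4 * monomial (adj_word (cycle_word \<mu>) @ adj_word (cycle_word \<mu>)) W))"

text \<open>In the limit this becomes \<open>\<bar>Re (d z)\<bar> + Re (d z)\<close>, which vanishes on a half circle.\<close>

definition half_circle :: "('v, 'e) pre_digraph \<Rightarrow> 'v \<Rightarrow> 'e list \<Rightarrow> complex \<Rightarrow> nat \<Rightarrow> ('v, 'e) free_elem" where
  "half_circle E v \<mu> d k =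
    (\<lambda>W. (monomial [(Vert v, False)] W - sqrt_iter E (cycle_defect v \<mu> d) k W) + cycle_real \<mu> d W)"

definition arc_element ::
    "('v, 'e) pre_digraph \<Rightarrow> 'v \<Rightarrow> 'e list \<Rightarrow> complex \<Rightarrow> complex \<Rightarrow> nat \<Rightarrow> ('v, 'e) free_elem" where
  "arc_element E v \<mu> d1 d2 k = sa_mult (free_alg E) (monomial [(Vert v, False)])
     (sa_mult (free_alg E) (half_circle E v \<mu> d1 k)
       (sa_mult (free_alg E) (half_circle E v \<mu> d2 k) (monomial [(Vert v, False)])))"

lemma cycle_word_props:
  assumes "graph_cycle E \<mu>"
  shows "cycle_word \<mu> \<in> lists (letters E)" "cycle_word \<mu> \<noteq> []" "word_degree (cycle_word \<mu>) = int (length \<mu>)"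
proof -
  obtain v where "graph_path E v \<mu> v" "\<mu> \<noteq> []" using assms by (auto simp: graph_cycle_def)
  then have "set \<mu> \<subseteq> arcs E" using graph_path_nth(1) by (metis in_set_conv_nth subsetI)
  then show "cycle_word \<mu> \<in> lists (letters E)" by (auto simp: cycle_word_def subset_iff)
  show "cycle_word \<mu> \<noteq> []" using \<open>\<mu> \<noteq> []\<close> by (simp add: cycle_word_def)
  show "word_degree (cycle_word \<mu>) = int (length \<mu>)" by (induction \<mu>) (simp_all add: cycle_word_def)
qed

lemma word_act_segment:
  "word_act E (cycle_word (map y [0..<k])) y = Some (\<lambda>i. y (i + k))"
  unfolding cycle_word_def by (induction k) (simp_all add: word_act_append)

lemma word_act_cycle_word: "word_act E (cycle_word \<mu>) (cycle_path \<mu>) = Some (cycle_path \<mu>)"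
proof -
  have "map (cycle_path \<mu>) [0..<length \<mu>] = \<mu>" by (rule nth_equalityI) (simp_all add: cycle_path_def)
  then show ?thesis using word_act_segment[of E "cycle_path \<mu>" "length \<mu>"] by (simp add: cycle_path_period)
qed

context
  fixes E :: "('v, 'e) pre_digraph" and v \<mu>
  assumes E: "row_finite_no_sources E" and \<mu>: "graph_cycle E \<mu>" and v: "v \<in> verts E"
begin

lemma wf_E: "wf_digraph E"
  using E by (simp add: row_finite_no_sources_def)

lemma cycle_monomials [simp]:
  "monomial [(Vert v, False)] \<in> free_carrier E"
  "monomial (cycle_word \<mu>) \<in> free_carrier E" "monomial (adj_word (cycle_word \<mu>)) \<in> free_carrier E"
  "monomial (cycle_word \<mu> @ cycle_word \<mu>) \<in> free_carrier E"
  "monomial (adj_word (cycle_word \<mu>) @ adj_word (cycle_word \<mu>)) \<in> free_carrier E"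
  using cycle_word_props(1,2)[OF \<mu>] v
  by (intro monomial_in; simp del: in_lists_conv_set add: append_in_lists_conv)+

lemma cycle_elements [simp]: "cycle_real \<mu> d \<in> free_carrier E" "cycle_defect v \<mu> d \<in> free_carrier E"
  unfolding cycle_real_def cycle_defect_def
  by (intro free_carrier_add free_carrier_diff free_carrier_scale cycle_monomials)+

lemma half_circle_carrier [simp]: "half_circle E v \<mu> d k \<in> free_carrier E"
  unfolding half_circle_def by (intro free_carrier_add free_carrier_diff cycle_monomials sqrt_iter_carrier cycle_elements)

lemma cycle_defect_bound:
  assumes d: "cmod d \<le> 1" shows "universal_seminorm E (cycle_defect v \<mu> d) \<le> 1"
proof -
  let ?U = "universal_seminorm E" and ?m = "cycle_word \<mu> :: ('v, 'e) letter list"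
  note gs = graph_seminorm_universal[OF wf_E]
  have cs: "cstar_seminorm (free_alg E) ?U" using gs by (simp add: graph_seminorm_def)
  have mon: "?U (monomial W) \<le> 1" if "W \<in> lists (letters E)" "W \<noteq> []" for W
    by (rule graph_seminorm_monomial[OF wf_E gs that])
  have sc: "?U (\<lambda>W. c * monomial V W) \<le> cmod c" if "V \<in> lists (letters E)" "V \<noteq> []" for c V
    using seminorm_scale[OF cs monomial_in[OF that], of c] mult_left_mono[OF mon[OF that], of "cmod c"] by simp
  note cw = cycle_word_props[OF \<mu>]
  have d2: "(cmod d)\<^sup>2 \<le> 1" using d by (simp add: power_le_one)
  have "?U (cycle_defect v \<mu> d) \<le> ?U (\<lambda>W. complex_of_real (1 - (cmod d)\<^sup>2 / 2) * monomial [(Vert v, False)] W)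
     + ?U (\<lambda>W. d\<^sup>2 / 4 * monomial (?m @ ?m) W + cnj (d\<^sup>2) / 4 * monomial (adj_word ?m @ adj_word ?m) W)"
    unfolding cycle_defect_def
    by (intro seminorm_diff[OF cs] free_carrier_add free_carrier_scale cycle_monomials)
  also have "?U (\<lambda>W. complex_of_real (1 - (cmod d)\<^sup>2 / 2) * monomial [(Vert v, False)] W) \<le> 1 - (cmod d)\<^sup>2 / 2"
    using sc[of "[(Vert v, False)]" "complex_of_real (1 - (cmod d)\<^sup>2 / 2)"] v d2
    by (simp add: norm_of_real del: of_real_diff of_real_divide)
  also have "?U (\<lambda>W. d\<^sup>2 / 4 * monomial (?m @ ?m) W + cnj (d\<^sup>2) / 4 * monomial (adj_word ?m @ adj_word ?m) W)
     \<le> ?U (\<lambda>W. d\<^sup>2 / 4 * monomial (?m @ ?m) W) + ?U (\<lambda>W. cnj (d\<^sup>2) / 4 * monomial (adj_word ?m @ adj_word ?m) W)"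
    by (intro seminorm_add[OF cs] free_carrier_scale cycle_monomials)
  also have "\<dots> \<le> cmod (d\<^sup>2 / 4) + cmod (cnj (d\<^sup>2) / 4)"
    using cw by (intro add_mono sc) (simp_all del: in_lists_conv_set add: append_in_lists_conv)
  also have "\<dots> = (cmod d)\<^sup>2 / 2"
    by (simp add: norm_divide norm_power)
  finally show ?thesis by simp
qed

lemma half_circle_cauchy:
  assumes d: "cmod d \<le> 1"
  shows "half_circle E v \<mu> d \<in> cauchy_seqs (free_alg E) (universal_seminorm E)"
proof -
  have cs: "cstar_seminorm (free_alg E) (universal_seminorm E)"
    using graph_seminorm_universal[OF wf_E] by (simp add: graph_seminorm_def)
  note q = sqrt_iter_cauchy[OF cs cycle_elements(2) cycle_defect_bound[OF d]]
  note q' = cauchy_seqs_scale[OF cs q, of "-1"]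
  note p = cauchy_seqs_add[OF cs cauchy_seqs_const[OF cs cycle_monomials(1)] q']
  have eq: "(\<lambda>k. sa_add (free_alg E) (sa_add (free_alg E) (monomial [(Vert v, False)])
      (sa_scale (free_alg E) (-1) (sqrt_iter E (cycle_defect v \<mu> d) k))) (cycle_real \<mu> d)) = half_circle E v \<mu> d"
    by (simp add: half_circle_def fun_eq_iff)
  from cauchy_seqs_add[OF cs p cauchy_seqs_const[OF cs cycle_elements(1)[of d]]] show ?thesis
    unfolding eq .
qed

lemma arc_element_cauchy:
  assumes d: "cmod d1 \<le> 1" "cmod d2 \<le> 1"
  shows "arc_element E v \<mu> d1 d2 \<in> cauchy_seqs (free_alg E) (universal_seminorm E)"
proof -
  have cs: "cstar_seminorm (free_alg E) (universal_seminorm E)"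
    using graph_seminorm_universal[OF wf_E] by (simp add: graph_seminorm_def)
  note p = cauchy_seqs_const[OF cs cycle_monomials(1)]
  show ?thesis
    unfolding arc_element_def
    by (intro cauchy_seqs_mult[OF cs] p half_circle_cauchy d)
qed

end

context path_space
begin

lemma monomial_eigenvector:
  assumes y: "y \<in> I" and W: "W \<in> lists (letters E)" "word_act E W y = Some y"
  shows "rep (monomial W) (l2_delta y) = (\<lambda>i. u powi word_degree W * l2_delta y i)"
proof
  fix i
  show "rep (monomial W) (l2_delta y) i = u powi word_degree W * l2_delta y i"
  proof (cases "i = y")
    case True
    then show ?thesis using y W by (simp add: free_rep_monomial partial_shift_def)
  next
    case False
    then have "word_act E W i \<noteq> Some y" if "i \<in> I" using word_act_inj[OF W(1) that y _ W(2)] by blast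
    then show ?thesis using False by (auto simp: free_rep_monomial partial_shift_def l2_delta_def split: option.splits)
  qed
qed

text \<open>The path \<open>\<mu>\<mu>\<mu>\<dots>\<close> spans an invariant line on which the cycle acts as multiplication by \<open>z\<close>.\<close>

lemma arc_element_eigenvector:
  assumes \<mu>: "graph_cycle E \<mu>" and y: "cycle_path \<mu> \<in> I" and v: "v = head E (cycle_path \<mu> 0)"
    and d: "cmod d1 \<le> 1" "cmod d2 \<le> 1" and z: "z = u ^ length \<mu>"
  obtains c where "\<And>k. rep (arc_element E v \<mu> d1 d2 k) (l2_delta (cycle_path \<mu>)) = (\<lambda>i. c k * l2_delta (cycle_path \<mu>) i)"
    "c \<longlonglongrightarrow> complex_of_real ((\<bar>Re (d1 * z)\<bar> + Re (d1 * z)) * (\<bar>Re (d2 * z)\<bar> + Re (d2 * z)))"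
proof -
  let ?y = "cycle_path \<mu>" and ?m = "cycle_word \<mu> :: ('v, 'e) letter list"
  let ?\<delta> = "l2_delta ?y"
  have yp: "?y \<in> infinite_paths E" by (rule shift_tail_class_paths[OF y])
  have vE: "v \<in> verts E" using yp wf by (simp add: v infinite_paths_def wf_digraph_def)
  note [simp] = cycle_monomials[OF graph \<mu> vE] cycle_elements[OF graph \<mu> vE] half_circle_carrier[OF graph \<mu> vE]
    sqrt_iter_carrier[OF cycle_elements(2)[OF graph \<mu> vE]]
  note cw = cycle_word_props[OF \<mu>]
  have z1: "cmod z = 1" by (simp add: z norm_power unit)
  have z_inv: "u powi - int (length \<mu>) = cnj z"
    using cnj_power[of "int (length \<mu>)"] by (simp add: z)
  have act: "word_act E ?m ?y = Some ?y" "word_act E (adj_word ?m) ?y = Some ?y"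
    using word_act_cycle_word word_act_adj[OF yp cw(1) word_act_cycle_word] by auto
  have ev: "rep (monomial [(Vert v, False)]) ?\<delta> = ?\<delta>"
    "rep (monomial ?m) ?\<delta> = (\<lambda>i. z * ?\<delta> i)"
    "rep (monomial (adj_word ?m)) ?\<delta> = (\<lambda>i. cnj z * ?\<delta> i)"
    "rep (monomial (?m @ ?m)) ?\<delta> = (\<lambda>i. z\<^sup>2 * ?\<delta> i)"
    "rep (monomial (adj_word ?m @ adj_word ?m)) ?\<delta> = (\<lambda>i. (cnj z)\<^sup>2 * ?\<delta> i)"
  proof -
    show "rep (monomial [(Vert v, False)]) ?\<delta> = ?\<delta>"
      using rep_vertex_delta[OF y, of v] by (simp add: v path_range_def)
    show 2: "rep (monomial ?m) ?\<delta> = (\<lambda>i. z * ?\<delta> i)"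
      using monomial_eigenvector[OF y cw(1) act(1)] by (simp add: cw(3) z)
    show 3: "rep (monomial (adj_word ?m)) ?\<delta> = (\<lambda>i. cnj z * ?\<delta> i)"
      using monomial_eigenvector[OF y _ act(2)] cw(1) by (simp add: cw(3) z_inv del: in_lists_conv_set)
    show "rep (monomial (?m @ ?m)) ?\<delta> = (\<lambda>i. z\<^sup>2 * ?\<delta> i)"
      using rep_mult[of "monomial ?m" "monomial ?m" ?\<delta>]
      by (simp add: monomial_mult 2 free_rep_scale_vector power2_eq_square mult.assoc)
    show "rep (monomial (adj_word ?m @ adj_word ?m)) ?\<delta> = (\<lambda>i. (cnj z)\<^sup>2 * ?\<delta> i)"
      using rep_mult[of "monomial (adj_word ?m)" "monomial (adj_word ?m)" ?\<delta>]
      by (simp add: monomial_mult 3 free_rep_scale_vector power2_eq_square mult.assoc)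
  qed
  have re: "rep (cycle_real \<mu> d) ?\<delta> = (\<lambda>i. complex_of_real (Re (d * z)) * ?\<delta> i)" for d
  proof -
    have sum: "d / 2 * z + cnj d / 2 * cnj z = complex_of_real (Re (d * z))"
      by (simp add: complex_eq_iff field_simps)
    have "rep (cycle_real \<mu> d) ?\<delta> i = d / 2 * (z * ?\<delta> i) + cnj d / 2 * (cnj z * ?\<delta> i)" for i
    proof -
      have "rep (cycle_real \<mu> d) ?\<delta> i = rep (\<lambda>W. d / 2 * monomial ?m W) ?\<delta> i
          + rep (\<lambda>W. cnj d / 2 * monomial (adj_word ?m) W) ?\<delta> i"
        unfolding cycle_real_def
        by (intro free_rep_add free_carrier_scale cycle_monomials[OF graph \<mu> vE])
      then show ?thesis
        by (simp only: free_rep_scale[OF cycle_monomials(2)[OF graph \<mu> vE]]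
            free_rep_scale[OF cycle_monomials(3)[OF graph \<mu> vE]] ev)
    qed
    then have "rep (cycle_real \<mu> d) ?\<delta> i = (d / 2 * z + cnj d / 2 * cnj z) * ?\<delta> i" for i
      by (simp only: distrib_right mult.assoc)
    then show ?thesis unfolding sum by (rule ext)
  qed
  have defect: "rep (cycle_defect v \<mu> d) ?\<delta> = (\<lambda>i. complex_of_real (1 - (Re (d * z))\<^sup>2) * ?\<delta> i)" for d
  proof -
    have dz: "(cmod d)\<^sup>2 = (Re (d * z))\<^sup>2 + (Im (d * z))\<^sup>2"
      using z1 by (metis cmod_power2 mult.right_neutral norm_mult)
    let ?c = "complex_of_real (1 - (cmod d)\<^sup>2 / 2)"
    have "?c - (d\<^sup>2 / 4 * z\<^sup>2 + cnj (d\<^sup>2) / 4 * (cnj z)\<^sup>2)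
        = complex_of_real (1 - (cmod d)\<^sup>2 / 2) - ((d * z)\<^sup>2 + cnj ((d * z)\<^sup>2)) / 4"
      by (simp add: power_mult_distrib add_divide_distrib)
    also have "\<dots> = complex_of_real (1 - (Re (d * z))\<^sup>2)"
      unfolding dz by (simp only: complex_add_cnj) (simp add: complex_eq_iff power2_eq_square field_simps)
    finally have sum: "?c - (d\<^sup>2 / 4 * z\<^sup>2 + cnj (d\<^sup>2) / 4 * (cnj z)\<^sup>2) = complex_of_real (1 - (Re (d * z))\<^sup>2)" .
    have "rep (cycle_defect v \<mu> d) ?\<delta> i = (?c - (d\<^sup>2 / 4 * z\<^sup>2 + cnj (d\<^sup>2) / 4 * (cnj z)\<^sup>2)) * ?\<delta> i" for i
    proof -
      have "rep (cycle_defect v \<mu> d) ?\<delta> i = rep (\<lambda>W. ?c * monomial [(Vert v, False)] W) ?\<delta> i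
          - (rep (\<lambda>W. d\<^sup>2 / 4 * monomial (?m @ ?m) W) ?\<delta> i
            + rep (\<lambda>W. cnj (d\<^sup>2) / 4 * monomial (adj_word ?m @ adj_word ?m) W) ?\<delta> i)"
        unfolding cycle_defect_def
        by (subst free_rep_diff, (intro free_carrier_add free_carrier_scale cycle_monomials[OF graph \<mu> vE])+,
            rule arg_cong2[where f="(-)", OF refl],
            intro free_rep_add free_carrier_scale cycle_monomials[OF graph \<mu> vE])
      then show ?thesis
        by (simp only: free_rep_scale[OF cycle_monomials(1)[OF graph \<mu> vE]]
            free_rep_scale[OF cycle_monomials(4)[OF graph \<mu> vE]]
            free_rep_scale[OF cycle_monomials(5)[OF graph \<mu> vE]] ev distrib_right left_diff_distrib mult.assoc)
    qed
    then show ?thesis unfolding sum by (rule ext)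
  qed
  define s where "s d k = real_sqrt_iter (1 - (Re (d * z))\<^sup>2) k" for d k
  have iter: "rep (sqrt_iter E (cycle_defect v \<mu> d) k) ?\<delta> = (\<lambda>i. complex_of_real (s d k) * ?\<delta> i)" for d k
  proof (induction k)
    case 0
    then show ?case by (simp add: s_def free_rep_def)
  next
    case (Suc k)
    let ?q = "sqrt_iter E (cycle_defect v \<mu> d) k"
    have "rep (sa_mult (free_alg E) ?q ?q) ?\<delta> = (\<lambda>i. complex_of_real ((s d k)\<^sup>2) * ?\<delta> i)"
      by (simp add: rep_mult Suc free_rep_scale_vector power2_eq_square mult.assoc)
    moreover have "rep (sqrt_iter E (cycle_defect v \<mu> d) (Suc k)) ?\<delta> i =
        1/2 * (rep (cycle_defect v \<mu> d) ?\<delta> i + rep (sa_mult (free_alg E) ?q ?q) ?\<delta> i)" for i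
      unfolding sqrt_iter.simps by (subst free_rep_scale, simp, subst free_rep_add) simp_all
    ultimately show ?case by (simp add: fun_eq_iff defect s_def field_simps)
  qed
  define h where "h d k = complex_of_real (1 - s d k + Re (d * z))" for d k
  have half: "rep (half_circle E v \<mu> d k) ?\<delta> = (\<lambda>i. h d k * ?\<delta> i)" for d k
    unfolding half_circle_def
    by (simp add: fun_eq_iff free_rep_add free_rep_diff ev re iter h_def algebra_simps)
  have hlim: "h d \<longlonglongrightarrow> complex_of_real (\<bar>Re (d * z)\<bar> + Re (d * z))" if d: "cmod d \<le> 1" for d
  proof -
    have "\<bar>Re (d * z)\<bar> \<le> cmod (d * z)" by (rule abs_Re_le_cmod)
    also have "\<dots> \<le> 1" using d z1 by (simp add: norm_mult)
    finally have "(\<lambda>k. s d k) \<longlonglongrightarrow> 1 - \<bar>Re (d * z)\<bar>"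
      using real_sqrt_iter_tendsto[of "\<bar>Re (d * z)\<bar>"] by (simp add: s_def)
    then have "(\<lambda>k. 1 - s d k + Re (d * z)) \<longlonglongrightarrow> 1 - (1 - \<bar>Re (d * z)\<bar>) + Re (d * z)"
      by (intro tendsto_intros)
    then have "h d \<longlonglongrightarrow> complex_of_real (1 - (1 - \<bar>Re (d * z)\<bar>) + Re (d * z))"
      unfolding h_def by (rule tendsto_of_real)
    then show ?thesis by simp
  qed
  show ?thesis
  proof (rule that)
    show "rep (arc_element E v \<mu> d1 d2 k) ?\<delta> = (\<lambda>i. (h d1 k * h d2 k) * ?\<delta> i)" for k
      unfolding arc_element_def
      by (simp add: rep_mult ev half free_rep_scale_vector) (simp add: mult.left_commute mult.commute mult.assoc)
    show "(\<lambda>k. h d1 k * h d2 k) \<longlonglongrightarrow> complex_of_real ((\<bar>Re (d1 * z)\<bar> + Re (d1 * z)) * (\<bar>Re (d2 * z)\<bar> + Re (d2 * z)))"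
      using tendsto_mult[OF hlim[OF d(1)] hlim[OF d(2)]] by simp
  qed
qed

text \<open>Compression by \<open>p\<^sub>v\<close> leaves only paths starting at \<open>v\<close>, of which there is just the cycle.\<close>

lemma arc_element_kernel_iff:
  assumes \<mu>: "cycle_no_entrance E (class_vertices E x) \<mu>" and v: "v = head E (cycle_path \<mu> 0)"
    and d: "cmod d1 \<le> 1" "cmod d2 \<le> 1" and z: "z = u ^ length \<mu>"
  shows "cls (arc_element E v \<mu> d1 d2) \<in> rep_kernel (graph_cstar E) I (path_rep E x u) \<longleftrightarrow>
    Re (d1 * z) \<le> 0 \<or> Re (d2 * z) \<le> 0"
proof -
  let ?y = "cycle_path \<mu>" and ?A = "arc_element E v \<mu> d1 d2"
  let ?c = "complex_of_real ((\<bar>Re (d1 * z)\<bar> + Re (d1 * z)) * (\<bar>Re (d2 * z)\<bar> + Re (d2 * z)))"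
  note \<mu>c = cycle_no_entranceD(1)[OF \<mu>]
  have start: "y = ?y" if "y \<in> I" "path_range E y = v" for y
    using class_no_entrance_path[OF that(1) refl \<mu>, of 0] that(2) by (auto simp: v path_range_def)
  obtain y where "y \<in> I" "path_range E y = v"
    using cycle_no_entranceD(3)[OF \<mu>, of 0] by (auto simp: v class_vertices_def)
  then have y: "?y \<in> I" using start by simp
  have vE: "v \<in> verts E" using shift_tail_class_paths[OF y] wf by (simp add: v infinite_paths_def wf_digraph_def)
  note A = arc_element_cauchy[OF graph \<mu>c vE d]
  obtain c where c: "\<And>k. rep (?A k) (l2_delta ?y) = (\<lambda>i. c k * l2_delta ?y i)" "c \<longlonglongrightarrow> ?c"
    by (rule arc_element_eigenvector[OF \<mu>c y v d z]) blast
  have zero: "rep (?A k) (l2_delta t) = (\<lambda>_. 0)" if "t \<in> I" "path_range E t \<noteq> v" for k t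
  proof -
    have 0: "rep f (\<lambda>_. 0) = (\<lambda>_. 0)" for f using free_rep_scale_vector[of E I u f 0 "\<lambda>_. 0"] by simp
    show ?thesis
      using that rep_vertex_delta[OF that(1), of v]
        cycle_monomials[OF graph \<mu>c vE] half_circle_carrier[OF graph \<mu>c vE]
      by (simp add: arc_element_def rep_mult 0)
  qed
  have "cls ?A \<in> rep_kernel (graph_cstar E) I (path_rep E x u) \<longleftrightarrow> ?c = 0"
    unfolding kernel_iff[OF A]
  proof
    assume "\<forall>y\<in>I. \<forall>z\<in>I. (\<lambda>k. rep (?A k) (l2_delta z) y) \<longlonglongrightarrow> 0"
    then have "(\<lambda>k. rep (?A k) (l2_delta ?y) ?y) \<longlonglongrightarrow> 0" using y by blast
    then have "c \<longlonglongrightarrow> 0" by (simp only: c) (simp add: l2_delta_def)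
    then show "?c = 0" using c(2) LIMSEQ_unique by blast
  next
    assume "?c = 0"
    then have c0: "c \<longlonglongrightarrow> 0" using c(2) by (simp only:)
    show "\<forall>y\<in>I. \<forall>z\<in>I. (\<lambda>k. rep (?A k) (l2_delta z) y) \<longlonglongrightarrow> 0"
    proof (intro ballI)
      fix s t assume "s \<in> I" "t \<in> I"
      show "(\<lambda>k. rep (?A k) (l2_delta t) s) \<longlonglongrightarrow> 0"
      proof (cases "path_range E t = v")
        case True
        then show ?thesis using start[OF \<open>t \<in> I\<close>] tendsto_mult_right[OF c0, of "l2_delta ?y s"] by (simp add: c)
      qed (simp add: zero \<open>t \<in> I\<close>)
    qed
  qed
  moreover have "?c = 0 \<longleftrightarrow> Re (d1 * z) \<le> 0 \<or> Re (d2 * z) \<le> 0"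
  proof -
    have "\<bar>r\<bar> + r = 0 \<longleftrightarrow> r \<le> 0" for r :: real by linarith
    then show ?thesis by (simp only: of_real_eq_0_iff mult_eq_0_iff)
  qed
  ultimately show ?thesis by simp
qed

lemma arc_element_kernel_outside:
  assumes \<mu>: "graph_cycle E \<mu>" and v: "v \<in> verts E" "v \<notin> class_vertices E x"
    and d: "cmod d1 \<le> 1" "cmod d2 \<le> 1"
  shows "cls (arc_element E v \<mu> d1 d2) \<in> rep_kernel (graph_cstar E) I (path_rep E x u)"
proof -
  have "path_range E t \<noteq> v" if "t \<in> I" for t using v(2) that by (auto simp: class_vertices_def)
  then have "rep (arc_element E v \<mu> d1 d2 k) \<xi> i = 0" for k \<xi> i
    using cycle_monomials[OF graph \<mu> v(1)] half_circle_carrier[OF graph \<mu> v(1)]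
    by (simp add: arc_element_def rep_mult) (auto simp: free_rep_monomial partial_shift_def)
  then show ?thesis unfolding kernel_iff[OF arc_element_cauchy[OF graph \<mu> v(1) d]] by simp
qed

lemma vertex_kernel_iff:
  assumes v: "v \<in> verts E"
  shows "cls (\<lambda>_. monomial [(Vert v, False)]) \<in> rep_kernel (graph_cstar E) I (path_rep E x u) \<longleftrightarrow> v \<notin> class_vertices E x"
proof -
  have "(\<lambda>_. monomial [(Vert v, False)]) \<in> CE" using v by (intro cauchy_seqs_const[OF cs]) auto
  note ker = kernel_iff[OF this]
  have "rep (monomial [(Vert v, False)]) (l2_delta z) y = (if path_range E z = v \<and> y = z then 1 else 0)"
    if "z \<in> I" for y z
    unfolding rep_vertex_delta[OF that] by (auto simp: l2_delta_def)
  then show ?thesis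
    unfolding ker by (auto simp: class_vertices_def LIMSEQ_const_iff)
qed

end

lemma shift_tail_class_common:
  assumes y: "y \<in> shift_tail_class E x" "y \<in> shift_tail_class E x'" and s: "s \<in> shift_tail_class E x"
  shows "s \<in> shift_tail_class E x'"
proof -
  obtain a b where ab: "\<And>i. x (i + a) = s (i + b)" using s by (auto simp: shift_tail_class_def)
  obtain c d where cd: "\<And>i. x (i + c) = y (i + d)" using y(1) by (auto simp: shift_tail_class_def)
  have "s (i + (b + c)) = y (i + (a + d))" for i
    using ab[of "i + c"] cd[of "i + a"] by (simp add: ac_simps)
  then show ?thesis by (rule shift_tail_class_shift[OF y(2) shift_tail_class_paths[OF s]])
qed

text \<open>The half planes \<open>Re (d\<^sub>1 z) > 0\<close> and \<open>Re (d\<^sub>2 z) > 0\<close> meet the circle in a small arc around \<open>w\<close>.\<close>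

lemma small_arc:
  fixes w :: complex
  assumes w: "cmod w = 1" and \<delta>: "0 < \<delta>"
  obtains d1 d2 where "cmod d1 \<le> 1" "cmod d2 \<le> 1" "0 < Re (d1 * w)" "0 < Re (d2 * w)"
    "\<And>z. cmod z = 1 \<Longrightarrow> \<delta> \<le> cmod (z - w) \<Longrightarrow> Re (d1 * z) \<le> 0 \<or> Re (d2 * z) \<le> 0"
proof -
  define t where "t = min 1 (\<delta> / 2)"
  have t: "0 < t" "t \<le> 1" "t \<le> \<delta> / 2" using \<delta> by (auto simp: t_def)
  have t2: "t\<^sup>2 \<le> 1" using t by (simp add: power_le_one)
  let ?d1 = "Complex t 1 / 2 * cnj w" and ?d2 = "Complex t (-1) / 2 * cnj w"
  have "sqrt (t\<^sup>2 + 1) \<le> 2" using t2 by (intro real_le_lsqrt) auto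
  then have "cmod (Complex t 1) \<le> 2" "cmod (Complex t (-1)) \<le> 2" by (simp_all add: cmod_def)
  then have norm: "cmod ?d1 \<le> 1" "cmod ?d2 \<le> 1"
    using w by (simp_all only: norm_mult norm_divide complex_mod_cnj norm_numeral mult_1_right)
  have ww: "cnj w * w = 1" using w by (metis complex_norm_square mult.commute of_real_1 one_power2)
  have pos: "0 < Re (?d1 * w)" "0 < Re (?d2 * w)"
    using t(1) by (simp_all add: mult.assoc ww)
  have "Re (?d1 * z) \<le> 0 \<or> Re (?d2 * z) \<le> 0" if z: "cmod z = 1" "\<delta> \<le> cmod (z - w)" for z
  proof (rule ccontr)
    assume neg: "\<not> (Re (?d1 * z) \<le> 0 \<or> Re (?d2 * z) \<le> 0)"
    define \<zeta> where "\<zeta> = cnj w * z"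
    have \<zeta>1: "cmod \<zeta> = 1" using w z by (simp add: \<zeta>_def norm_mult)
    have "\<zeta> - 1 = cnj w * (z - w)" by (simp add: \<zeta>_def right_diff_distrib ww)
    then have dist: "cmod (\<zeta> - 1) = cmod (z - w)" using w by (simp add: norm_mult)
    have "0 < Re (Complex t 1 / 2 * \<zeta>)" "0 < Re (Complex t (-1) / 2 * \<zeta>)"
      using neg by (simp_all add: \<zeta>_def mult.assoc not_le)
    then have b: "Im \<zeta> < t * Re \<zeta>" "- Im \<zeta> < t * Re \<zeta>" by (simp_all add: field_simps)
    then have "0 < t * Re \<zeta>" by linarith
    then have a: "0 < Re \<zeta>" using t(1) by (simp add: zero_less_mult_iff)
    have sq: "(Re \<zeta>)\<^sup>2 + (Im \<zeta>)\<^sup>2 = 1" using \<zeta>1 by (metis cmod_power2 one_power2)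
    have a1: "Re \<zeta> \<le> 1" using abs_Re_le_cmod[of \<zeta>] \<zeta>1 by simp
    have "t * Re \<zeta> \<le> t * 1" using a1 t(1) by (intro mult_left_mono) auto
    then have "\<bar>Im \<zeta>\<bar> \<le> t" using b by simp
    then have im: "(Im \<zeta>)\<^sup>2 \<le> t\<^sup>2" using t(1) by (metis abs_le_square_iff abs_of_pos)
    have "(cmod (\<zeta> - 1))\<^sup>2 = (Re \<zeta> - 1)\<^sup>2 + (Im \<zeta>)\<^sup>2" by (simp add: cmod_power2)
    also have "\<dots> = 2 - 2 * Re \<zeta>" using sq by (simp add: power2_eq_square algebra_simps)
    also have "\<dots> \<le> 2 * (1 - (Re \<zeta>)\<^sup>2)" using a a1 by (simp add: power2_eq_square mult_left_le)
    also have "\<dots> \<le> 2 * t\<^sup>2" using sq im by simp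
    also have "\<dots> \<le> 2 * (\<delta> / 2)\<^sup>2" using t by (intro mult_left_mono power_mono) auto
    also have "\<dots> < \<delta>\<^sup>2" using \<delta> by (simp add: power2_eq_square)
    finally have "cmod (\<zeta> - 1) < \<delta>" using \<delta> by (intro power2_less_imp_less[of "cmod (\<zeta> - 1)" \<delta>]) auto
    then show False using dist z(2) by simp
  qed
  then show ?thesis using that[OF norm pos] by blast
qed

lemma tail_ideal_inclusion_cover:
  assumes E: "row_finite_no_sources E" and X: "X \<subseteq> tail_pairs E" and Sw: "(S, w) \<in> tail_pairs E"
    and incl: "sa_carrier (graph_cstar E) \<inter> (\<Inter>(T, z)\<in>X. tail_ideal E T z) \<subseteq> tail_ideal E S w"
  shows "S \<subseteq> (\<Union>(T, z)\<in>X. T)"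
proof (rule ccontr)
  assume "\<not> S \<subseteq> (\<Union>(T, z)\<in>X. T)"
  then obtain v where v: "v \<in> S" "v \<notin> (\<Union>(T, z)\<in>X. T)" by blast
  have vE: "v \<in> verts E" using Sw v(1) by (auto simp: tail_pairs_def maximal_tail_def)
  let ?p = "seq_class (free_alg E) (universal_seminorm E) (\<lambda>_. monomial [(Vert v, False)])"
  obtain x u where x: "path_space E x u" "class_vertices E x = S"
    "tail_ideal E S w = rep_kernel (graph_cstar E) (shift_tail_class E x) (path_rep E x u)"
    by (rule tail_ideal_representation[OF E Sw])
  have "?p \<notin> tail_ideal E S w" using path_space.vertex_kernel_iff[OF x(1) vE] v(1) by (simp add: x)
  moreover have "?p \<in> tail_ideal E T z" if Tz: "(T, z) \<in> X" for T z
  proof -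
    obtain x' u' where x': "path_space E x' u'" "class_vertices E x' = T"
      "tail_ideal E T z = rep_kernel (graph_cstar E) (shift_tail_class E x') (path_rep E x' u')"
      using tail_ideal_representation[OF E] X Tz by blast
    have "v \<notin> T" using v(2) Tz by blast
    then show ?thesis using path_space.vertex_kernel_iff[OF x'(1) vE] by (simp add: x')
  qed
  moreover have "?p \<in> sa_carrier (graph_cstar E)"
  proof -
    have "(\<lambda>_. monomial [(Vert v, False)]) \<in> cauchy_seqs (free_alg E) (universal_seminorm E)"
      using vE by (intro cauchy_seqs_const[OF path_space.cs[OF x(1)]]) auto
    then show ?thesis by (rule path_space.cls_in[OF x(1)])
  qed
  ultimately show False using incl by blast
qed

lemma tail_ideal_inclusion_closure:
  assumes E: "row_finite_no_sources E" and X: "X \<subseteq> tail_pairs E" and Sw: "(S, w) \<in> tail_pairs E"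
    and incl: "sa_carrier (graph_cstar E) \<inter> (\<Inter>(T, z)\<in>X. tail_ideal E T z) \<subseteq> tail_ideal E S w"
    and \<mu>S: "cycle_no_entrance E S \<mu>" and \<mu>U: "cycle_no_entrance E (\<Union>(T, z)\<in>X. T) \<mu>"
  shows "w \<in> closure {z. (S, z) \<in> X}"
proof (rule ccontr)
  assume "w \<notin> closure {z. (S, z) \<in> X}"
  then obtain \<delta> where \<delta>: "0 < \<delta>" "\<And>z. (S, z) \<in> X \<Longrightarrow> \<delta> \<le> cmod (z - w)"
    by (auto simp: closure_approachable dist_norm not_less)
  have S: "maximal_tail E S" using Sw by (auto simp: tail_pairs_def)
  have unit: "cmod z = 1" if "(T, z) \<in> tail_pairs E" for T z
    using that by (auto simp: tail_pairs_def norm_power)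
  obtain d1 d2 where d: "cmod d1 \<le> 1" "cmod d2 \<le> 1" and w: "0 < Re (d1 * w)" "0 < Re (d2 * w)"
    and far: "\<And>z. cmod z = 1 \<Longrightarrow> \<delta> \<le> cmod (z - w) \<Longrightarrow> Re (d1 * z) \<le> 0 \<or> Re (d2 * z) \<le> 0"
    using small_arc[OF unit[OF Sw] \<delta>(1)] by blast
  define v where "v = head E (cycle_path \<mu> 0)"
  have \<mu>c: "graph_cycle E \<mu>" by (rule cycle_no_entranceD(1)[OF \<mu>S])
  have Per: "Per E S = length \<mu>" by (rule Per_eq_length[OF E S \<mu>S])
  have vS: "v \<in> S" using cycle_no_entranceD(3)[OF \<mu>S] by (simp add: v_def)
  then have vE: "v \<in> verts E" using S by (auto simp: maximal_tail_def)
  let ?a = "seq_class (free_alg E) (universal_seminorm E) (arc_element E v \<mu> d1 d2)"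
  obtain x u where x: "path_space E x u" "class_vertices E x = S" "u ^ Per E S = w"
    "tail_ideal E S w = rep_kernel (graph_cstar E) (shift_tail_class E x) (path_rep E x u)"
    by (rule tail_ideal_representation[OF E Sw])
  have "?a \<notin> tail_ideal E S w"
    using path_space.arc_element_kernel_iff[OF x(1) _ v_def d, of w] \<mu>S w x(3) by (simp add: x(2,4) Per)
  moreover have "?a \<in> tail_ideal E T z" if Tz: "(T, z) \<in> X" for T z
  proof -
    have T: "maximal_tail E T" using X Tz by (auto simp: tail_pairs_def)
    obtain x' u' where x': "path_space E x' u'" "class_vertices E x' = T" "u' ^ Per E T = z"
      "tail_ideal E T z = rep_kernel (graph_cstar E) (shift_tail_class E x') (path_rep E x' u')"
      using tail_ideal_representation[OF E] X Tz by blast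
    show ?thesis
    proof (cases "v \<in> T")
      case False
      then show ?thesis
        using path_space.arc_element_kernel_outside[OF x'(1) \<mu>c vE _ d] by (simp add: x')
    next
      case True
      have "T \<subseteq> (\<Union>(T, z)\<in>X. T)" using Tz by blast
      then have \<mu>T: "cycle_no_entrance E T \<mu>"
        using True by (intro no_entrance_subset[OF \<mu>U T, of 0]) (simp_all add: v_def)
      have cyc: "cycle_path \<mu> \<in> shift_tail_class E x''"
        if "class_vertices E x'' = R" "cycle_no_entrance E R \<mu>" for x'' R
      proof -
        have "v \<in> class_vertices E x''" using cycle_no_entranceD(3)[OF that(2)] that(1) by (simp add: v_def)
        then obtain y where y: "y \<in> shift_tail_class E x''" "head E (y 0) = v"
          by (auto simp: class_vertices_def path_range_def)
        have "y = cycle_path \<mu>"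
          using class_no_entrance_path[OF y(1) that, of 0] y(2) by (auto simp: v_def)
        then show ?thesis using y(1) by simp
      qed
      have "shift_tail_class E x = shift_tail_class E x'"
        using shift_tail_class_common cyc[OF x(2) \<mu>S] cyc[OF x'(2) \<mu>T] by blast
      then have "T = S" using x(2) x'(2) by (simp add: class_vertices_def)
      then have "Re (d1 * z) \<le> 0 \<or> Re (d2 * z) \<le> 0"
        using far[of z] \<delta>(2)[of z] unit[of T z] X Tz by blast
      then show ?thesis
        using path_space.arc_element_kernel_iff[OF x'(1) _ v_def d, of z] \<mu>T x'(3) Per_eq_length[OF E T \<mu>T]
        by (simp add: x'(2,4))
    qed
  qed
  moreover have "?a \<in> sa_carrier (graph_cstar E)"
    by (rule path_space.cls_in[OF x(1) arc_element_cauchy[OF E \<mu>c vE d]])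
  ultimately show False using incl by blast
qed

theorem theorem4p1:
  fixes E :: "('v, 'e) pre_digraph"
    and X :: "('v set \<times> complex) set"
    and S :: "'v set" and w :: complex
  assumes "row_finite_no_sources E"
    and "X \<subseteq> tail_pairs E"
    and "(S, w) \<in> tail_pairs E"
  shows "sa_carrier (graph_cstar E) \<inter> (\<Inter>(T, z)\<in>X. tail_ideal E T z) \<subseteq> tail_ideal E S w \<longleftrightarrow>
           S \<subseteq> (\<Union>(T, z)\<in>X. T) \<and>
           (cyclic_tail E S \<longrightarrow>
             (\<forall>\<mu>. cycle_no_entrance E S \<mu> \<and> cycle_no_entrance E (\<Union>(T, z)\<in>X. T) \<mu> \<longrightarrow>
                w \<in> closure {z. (S, z) \<in> X}))"
proof (intro iffI conjI impI allI)
  assume incl: "sa_carrier (graph_cstar E) \<inter> (\<Inter>(T, z)\<in>X. tail_ideal E T z) \<subseteq> tail_ideal E S w"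
  show "S \<subseteq> (\<Union>(T, z)\<in>X. T)" by (rule tail_ideal_inclusion_cover[OF assms incl])
  show "w \<in> closure {z. (S, z) \<in> X}"
    if "cycle_no_entrance E S \<mu> \<and> cycle_no_entrance E (\<Union>(T, z)\<in>X. T) \<mu>" for \<mu>
    using that tail_ideal_inclusion_closure[OF assms incl] by blast
next
  assume cond: "S \<subseteq> (\<Union>(T, z)\<in>X. T) \<and> (cyclic_tail E S \<longrightarrow>
    (\<forall>\<mu>. cycle_no_entrance E S \<mu> \<and> cycle_no_entrance E (\<Union>(T, z)\<in>X. T) \<mu> \<longrightarrow> w \<in> closure {z. (S, z) \<in> X}))"
  have "maximal_tail E S" using assms(3) by (auto simp: tail_pairs_def)
  then have cyclic: "cyclic_tail E S" if "cycle_no_entrance E S \<mu>" for \<mu>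
    using that by (auto simp: cyclic_tail_def)
  show "sa_carrier (graph_cstar E) \<inter> (\<Inter>(T, z)\<in>X. tail_ideal E T z) \<subseteq> tail_ideal E S w"
    using cond cyclic by (intro tail_ideal_inclusion_if[OF assms]) blast+
qed

end
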